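(* Let $T:\Lambda\to\Lambda$ be a (possibly non-uniformly hyperbolic) system of the class described in the context, let $d\ge 1$ and let $\Phi=(\phi_n)_{n\ge1}\in\mathcal{C}_{aa}(\Lambda,T,d)$ be a vector-valued almost additive potential. Assume that for every $\epsilon>0$ there exists $\nu\in\mathcal{M}(\Lambda,T)$ such that $\lambda(\nu,T)>0$ and $$\frac{h(\nu,T)}{\lambda(\nu,T)}>\dim_H\Lambda-\epsilon .$$ Assume moreover that the set $\mathcal{L}_\Phi=\{\Phi_*(\mu):\mu\in\mathcal{M}(\Lambda,T)\}$ has at least two elements. Then $$\dim_H\Lambda_{irr}=\dim_H\Lambda .$$
   Context: **The system.** Let $I_1,\dots,I_m\subset[0,1]$ be closed intervals that do not overlap (their interiors are pairwise disjoint; common endpoints are allowed). Let $T:\bigcup_{i=1}^m I_i\to[0,1]$ be a piecewise $C^1$ map such that for each $j$: the branch $T|_{I_j}:I_j\to[0,1]$ is $C^1$ (one-sided derivatives at endpoints) and onto, and there is a unique $x_j\in I_j$ with $T(x_j)=x_j$; moreover $T'(x)>1$ for $x\notin\{x_1,\dots,x_m\}$. (Hence $T'(x_j)\ge1$; equality is allowed.) Let $T_i:[0,1]\to I_i$ be the inverse of the branch $T|_{I_i}$. **Coding and attractor.** Let $\Sigma=\{1,\dots,m\}^{\mathbb{N}}$ and let $\Pi:\Sigma\to[0,1]$ be given by $\Pi(\omega)=\lim_{n\to\infty}T_{\omega_1}\circ\cdots\circ T_{\omega_n}([0,1])$ (the nested intervals shrink to a single point). The attractor is $\Lambda=\{x\in\bigcup_j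 I_j: T^n(x)\in[0,1]\text{ for all } n\ge0\}$, i.e. the set of points whose orbit under the branches stays forever in $\bigcup_j I_j$; one has $\Lambda=\Pi(\Sigma)$. $T$ is regarded as a map $\Lambda\to\Lambda$. If a point of $\Lambda$ is a common endpoint of two of the intervals, $T$ (and $T'$) at that point is given by a fixed choice of one of the two adjacent branches whose value at the point lies in $\Lambda$. **Measures.** $\mathcal{M}(\Lambda,T)$ is the set of $T$-invariant Borel probability measures on $\Lambda$; $h(\nu,T)$ is the metric (Kolmogorov–Sinai) entropy and $\lambda(\nu,T)=\int\log|T'|\,d\nu$ is the Lyapunov exponent. **Almost additive potentials.** A sequence of continuous functions $\phi_n:\Lambda\to\mathbb{R}$ $(n\ge1)$ is almost additive if there is a constant $C>0$ with $$-C+\phi_n(x)+\phi_p(T^nx)\le\phi_{n+p}(x)\le\phi_n(x)+\phi_p(T^nx)+C\quad\text{for all } n,p\in\mathbb{N},\ x\in\Lambda.$$ $\mathcal{C}_{aa}(\Lambda,T,d)$ is the set of sequences $\Phi=(\phi_n)_{n\ge1}$, $\phi_n=(\phi_n^1,\dots,\phi_n^d):\Lambda\to\mathbb{R}^d$, such that each coordinate sequence $(\phi_n^j)_{n\ge1}$ is almost additive. For $\mu\in\mathcal{M}(\Lambda,T)$, $\Phi_*(\mu)=\lim_{n\to\infty}\frac1n\int\phi_n\,d\mu\in\mathbb{R}^d$ (the limit exists). **Irregular set.** $\Lambda_{irr}=\{x\in\Lambda:\lim_{n\to\infty}\phi_n(x)/n\text{ does not exist}\}$. $\dim_H$ denotes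 Hausdorff dimension. *)

theory Defs
  imports "HOL-Probability.Probability"
begin

subsection \<open>Hausdorff dimension\<close>

text \<open>The case distinction implements the usual conventions \<open>diam(\<emptyset>)\<^sup>s = 0\<close> and
  \<open>diam(U)\<^sup>0 = 1\<close> for \<open>U\<close> nonempty (whereas \<open>0 powr 0 = 0\<close>).\<close>

definition diam_pow :: "real \<Rightarrow> 'a::metric_space set \<Rightarrow> ennreal" where
  "diam_pow s U = (if U = {} then 0 else if s = 0 then 1 else ennreal (diameter U powr s))"

text \<open>Boundedness is required because \<^const>\<open>diameter\<close> is unspecified on unbounded sets.\<close>

definition hausdorff_premeasure :: "real \<Rightarrow> real \<Rightarrow> 'a::metric_space set \<Rightarrow> ennreal" where
  "hausdorff_premeasure s \<delta> A =
     (INF U \<in> {U :: nat \<Rightarrow> 'a set. A \<subseteq> (\<Union>i. U i) \<and> (\<forall>i. bounded (U i) \<and> diameter (U i) \<le> \<delta>)}.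
        (\<Sum>i. diam_pow s (U i)))"

definition hausdorff_measure :: "real \<Rightarrow> 'a::metric_space set \<Rightarrow> ennreal" where
  "hausdorff_measure s A = (SUP \<delta> \<in> {0<..}. hausdorff_premeasure s \<delta> A)"

definition hausdorff_dim :: "'a::metric_space set \<Rightarrow> ereal" where
  "hausdorff_dim A = (INF s \<in> {s :: real. 0 \<le> s \<and> hausdorff_measure s A = 0}. ereal s)"


subsection \<open>Invariant measures and metric entropy\<close>

definition invariant_measures :: "'a::topological_space set \<Rightarrow> ('a \<Rightarrow> 'a) \<Rightarrow> 'a measure set" where
  "invariant_measures X T =
     {\<mu>. prob_space \<mu> \<and> space \<mu> = X \<and> sets \<mu> = sets (restrict_space borel X)
         \<and> T \<in> measurable \<mu> \<mu> \<and> distr \<mu> \<mu> T = \<mu>}"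

text \<open>The partition \<open>P \<or> T\<^sup>-\<^sup>1 P \<or> \<dots> \<or> T\<^sup>-\<^sup>(\<^sup>n\<^sup>-\<^sup>1\<^sup>) P\<close>.\<close>

definition iterated_join :: "'a measure \<Rightarrow> ('a \<Rightarrow> 'a) \<Rightarrow> 'a set set \<Rightarrow> nat \<Rightarrow> 'a set set" where
  "iterated_join \<mu> T P n =
     {{x \<in> space \<mu>. \<forall>i<n. (T ^^ i) x \<in> c i} | c. \<forall>i<n. c i \<in> P} - {{}}"

text \<open>Null atoms contribute \<open>0\<close>, since \<open>0 * ln 0 = 0\<close>.\<close>

definition partition_entropy :: "'a measure \<Rightarrow> 'a set set \<Rightarrow> real" where
  "partition_entropy \<mu> P = - (\<Sum>A\<in>P. measure \<mu> A * ln (measure \<mu> A))"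

definition entropy_wrt_partition :: "'a measure \<Rightarrow> ('a \<Rightarrow> 'a) \<Rightarrow> 'a set set \<Rightarrow> real" where
  "entropy_wrt_partition \<mu> T P =
     lim (\<lambda>n. partition_entropy \<mu> (iterated_join \<mu> T P n) / real n)"

definition metric_entropy :: "'a measure \<Rightarrow> ('a \<Rightarrow> 'a) \<Rightarrow> ereal" where
  "metric_entropy \<mu> T =
     (SUP P \<in> {P. finite P \<and> P \<subseteq> sets \<mu> \<and> partition_on (space \<mu>) P}.
        ereal (entropy_wrt_partition \<mu> T P))"


subsection \<open>Piecewise expanding interval systems\<close>

text \<open>Branch \<open>j\<close> is \<open>f j\<close> restricted to \<open>I j\<close>; since two intervals may share an endpoint, where
  the two branches differ, the system is described by its branches. Derivatives are taken within
  \<open>I j\<close>, so they are one-sided at the endpoints.\<close>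

definition branch_deriv :: "(nat \<Rightarrow> real set) \<Rightarrow> (nat \<Rightarrow> real \<Rightarrow> real) \<Rightarrow> nat \<Rightarrow> real \<Rightarrow> real" where
  "branch_deriv I f j x = vector_derivative (f j) (at x within I j)"

definition interval_system :: "nat \<Rightarrow> (nat \<Rightarrow> real set) \<Rightarrow> (nat \<Rightarrow> real \<Rightarrow> real) \<Rightarrow> bool" where
  "interval_system m I f \<longleftrightarrow>
     1 \<le> m \<and>
     (\<forall>j\<in>{1..m}. \<exists>a b. a < b \<and> I j = {a..b} \<and> I j \<subseteq> {0..1}) \<and>
     (\<forall>i\<in>{1..m}. \<forall>j\<in>{1..m}. i \<noteq> j \<longrightarrow> interior (I i) \<inter> interior (I j) = {}) \<and>
     (\<forall>j\<in>{1..m}.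
        (\<forall>x\<in>I j. f j differentiable (at x within I j)) \<and>
        continuous_on (I j) (branch_deriv I f j) \<and>
        f j ` I j = {0..1} \<and>
        (\<exists>!x. x \<in> I j \<and> f j x = x)) \<and>
     (\<forall>j\<in>{1..m}. \<forall>x\<in>I j.
        x \<notin> {z. \<exists>i\<in>{1..m}. z \<in> I i \<and> f i z = z} \<longrightarrow> branch_deriv I f j x > 1)"

text \<open>Points having an orbit \<open>y\<close> under the branches, with itinerary \<open>\<omega>\<close>, that never leaves the
  union of the intervals.\<close>

definition attractor :: "nat \<Rightarrow> (nat \<Rightarrow> real set) \<Rightarrow> (nat \<Rightarrow> real \<Rightarrow> real) \<Rightarrow> real set" where
  "attractor m I f =
     {x. \<exists>y \<omega>. y 0 = x \<and>
           (\<forall>n::nat. \<omega> n \<in> {1..m} \<and> y n \<in> I (\<omega> n) \<and> y (Suc n) = f (\<omega> n) (y n))}"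

text \<open>\<open>\<sigma> x\<close> is the branch used at \<open>x\<close>. Only at common endpoints of two intervals is there
  anything to choose.\<close>

definition branch_choice ::
  "nat \<Rightarrow> (nat \<Rightarrow> real set) \<Rightarrow> (nat \<Rightarrow> real \<Rightarrow> real) \<Rightarrow> (real \<Rightarrow> nat) \<Rightarrow> bool" where
  "branch_choice m I f \<sigma> \<longleftrightarrow>
     (\<forall>x\<in>attractor m I f. \<sigma> x \<in> {1..m} \<and> x \<in> I (\<sigma> x) \<and> f (\<sigma> x) x \<in> attractor m I f)"

definition system_map :: "(nat \<Rightarrow> real \<Rightarrow> real) \<Rightarrow> (real \<Rightarrow> nat) \<Rightarrow> real \<Rightarrow> real" where
  "system_map f \<sigma> x = f (\<sigma> x) x"

definition system_deriv ::
  "(nat \<Rightarrow> real set) \<Rightarrow> (nat \<Rightarrow> real \<Rightarrow> real) \<Rightarrow> (real \<Rightarrow> nat) \<Rightarrow> real \<Rightarrow> real" where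
  "system_deriv I f \<sigma> x = branch_deriv I f (\<sigma> x) x"

definition lyapunov_exponent :: "(real \<Rightarrow> real) \<Rightarrow> real measure \<Rightarrow> real" where
  "lyapunov_exponent T' \<nu> = (\<integral>x. ln \<bar>T' x\<bar> \<partial>\<nu>)"


subsection \<open>Almost additive potentials\<close>

text \<open>Sequences are indexed by \<open>n \<ge> 1\<close>; the term with index \<open>0\<close> is irrelevant.\<close>

definition almost_additive ::
  "'a::topological_space set \<Rightarrow> ('a \<Rightarrow> 'a) \<Rightarrow> (nat \<Rightarrow> 'a \<Rightarrow> real) \<Rightarrow> bool" where
  "almost_additive X T \<phi> \<longleftrightarrow>
     (\<forall>n\<ge>1. continuous_on X (\<phi> n)) \<and>
     (\<exists>C>0. \<forall>n\<ge>1. \<forall>p\<ge>1. \<forall>x\<in>X.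
        - C + \<phi> n x + \<phi> p ((T ^^ n) x) \<le> \<phi> (n + p) x \<and>
        \<phi> (n + p) x \<le> \<phi> n x + \<phi> p ((T ^^ n) x) + C)"

definition almost_additive_vec ::
  "'a::topological_space set \<Rightarrow> ('a \<Rightarrow> 'a) \<Rightarrow> (nat \<Rightarrow> 'a \<Rightarrow> real ^ 'd) \<Rightarrow> bool" where
  "almost_additive_vec X T \<Phi> \<longleftrightarrow> (\<forall>j. almost_additive X T (\<lambda>n x. \<Phi> n x $ j))"

definition limit_average :: "(nat \<Rightarrow> 'a \<Rightarrow> real ^ 'd) \<Rightarrow> 'a measure \<Rightarrow> real ^ 'd" where
  "limit_average \<Phi> \<mu> = lim (\<lambda>n. (1 / real n) *\<^sub>R (\<integral>x. \<Phi> n x \<partial>\<mu>))"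

definition irregular_set :: "'a set \<Rightarrow> (nat \<Rightarrow> 'a \<Rightarrow> real ^ 'd) \<Rightarrow> 'a set" where
  "irregular_set X \<Phi> = {x \<in> X. \<not> convergent (\<lambda>n. (1 / real n) *\<^sub>R \<Phi> n x)}"

end

theory Submission
  imports Defs
begin

text \<open>Only the lower bound needs an argument. Let \<open>0 < s < dim \<Lambda>\<close>. The plan is to find inside the
irregular set a Cantor set of symbolic origin that carries a probability measure giving mass at
most \<open>K r\<^sup>s\<close> to sets of diameter \<open>r\<close> (\<open>mass_distribution\<close>).

\<^emph>\<open>Enough words.\<close> To a word \<open>w\<close> in the branches belong its cylinder and the number
\<open>log_expansion w\<close>, an upper bound, subadditive under concatenation, for the logarithm of the
derivative along the cylinder. By hypothesis there is an invariant measure \<open>\<nu>\<close> whose entropy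
exceeds \<open>s\<close> times its Lyapunov exponent. Then \<open>\<Sum> exp (- s log_expansion w)\<close>, over all words of
length \<open>n\<close>, tends to infinity with \<open>n\<close> (\<open>partition_function_large\<close>). This is the easy half of the
variational principle, and it is obtained from a single application of Gibbs' inequality: the
itinerary of a point with respect to an arbitrary finite partition is predicted, up to small cost,
from its itinerary with respect to the branches, because long cylinders are short intervals
(\<open>entropy_le_partition_function\<close>).

\<^emph>\<open>Irregularity for free.\<close> Two invariant measures with different averages, in some coordinate
\<open>\<phi>\<close> of \<open>\<Phi>\<close>, yield two words \<open>a\<close> and \<open>b\<close> such that on the cylinder of \<open>a\<close> the average of \<open>\<phi>\<close> is
at most \<open>\<alpha>\<close>, and on that of \<open>b\<close> it is at least \<open>\<beta> > \<alpha>\<close> (\<open>low_words\<close>). Consider a sequence of blocks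
which is completely free, except that in sparse stages the blocks are forced to be \<open>a\<close> or,
alternately, \<open>b\<close>; the length of each stage is a fixed fraction of the time elapsed before it.
If the averages of \<open>\<phi>\<close> along the orbit converged to \<open>L\<close>, the stages of \<open>a\<close> would give \<open>L \<le> \<alpha>\<close>,
and those of \<open>b\<close> would give \<open>L \<ge> \<beta>\<close> (\<open>limit_le_of_low_stages\<close>). So every such sequence codes an
irregular point, whatever its free blocks are.

\<^emph>\<open>Dimension.\<close> Give the free blocks \<open>w\<close> independent weights proportional to
\<open>exp (- s log_expansion w)\<close>. As these add up to \<open>Z > 1\<close> before normalization, every free block
improves the comparison of mass with the \<open>s\<close>-th power of length by the factor \<open>Z\<close>, and this pays
for the forced blocks if the stages are sparse enough. There is thus no loss of dimension
(\<open>irregular_set_has_mass\<close>). Appending to each free block a fixed word whose cylinder lies in the open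
unit interval keeps the cylinders of different blocks apart, and keeps all orbits away from the
end points of the intervals, where the coding is ambiguous.\<close>

section \<open>Hausdorff dimension and the mass distribution principle\<close>

lemma hausdorff_measure_mono:
  assumes "A \<subseteq> B"
  shows "hausdorff_measure s A \<le> hausdorff_measure s B"
  unfolding hausdorff_measure_def hausdorff_premeasure_def
  by (intro SUP_mono' INF_superset_mono) (use assms in auto)

lemma hausdorff_dim_mono:
  assumes "A \<subseteq> B"
  shows "hausdorff_dim A \<le> hausdorff_dim B"
  unfolding hausdorff_dim_def
proof (intro INF_superset_mono subsetI)
  fix s assume s: "s \<in> {s. 0 \<le> s \<and> hausdorff_measure s B = 0}"
  then have "hausdorff_measure s A \<le> 0"
    using hausdorff_measure_mono[OF assms, of s] by auto
  then show "s \<in> {s. 0 \<le> s \<and> hausdorff_measure s A = 0}" using s by auto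
qed simp

lemma powr_diameter_le_diam_pow:
  assumes "0 \<le> t" "t \<le> s" "bounded U" "diameter U \<le> 1" "U \<noteq> {}"
  shows "ennreal (diameter U powr s) \<le> diam_pow t U"
proof (cases "t = 0")
  case True
  have "diameter U powr s \<le> 1"
    using assms diameter_ge_0[of U] by (intro powr_le1) auto
  then show ?thesis using True assms by (simp add: diam_pow_def ennreal_le_1)
next
  case False
  have "diameter U powr s \<le> diameter U powr t"
    using assms diameter_ge_0[OF assms(3)] by (intro powr_mono') auto
  then show ?thesis using False assms by (simp add: diam_pow_def ennreal_leI)
qed

text \<open>Countably many cylinders that cover a product of finite probability spaces have total mass at
least \<open>1\<close>. Since only cylinders are measured, the coding map to which this is applied below can be
any function.\<close>

lemma sum_product_cylinders_ge_1:
  fixes S :: "nat \<Rightarrow> 'a set" and p :: "nat \<Rightarrow> 'a \<Rightarrow> real"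
  assumes fin: "\<And>i. finite (S i)"
    and nonneg: "\<And>i a. a \<in> S i \<Longrightarrow> 0 \<le> p i a"
    and sum1: "\<And>i. (\<Sum>a\<in>S i. p i a) = 1"
    and cover: "\<And>\<omega>. \<omega> \<in> PiE UNIV S \<Longrightarrow> \<exists>j\<in>J. \<forall>i<k j. \<omega> i = \<eta> j i"
    and \<eta>: "\<And>j. j \<in> J \<Longrightarrow> \<eta> j \<in> PiE UNIV S"
  shows "(1::ennreal) \<le> (\<Sum>j::nat. if j \<in> J then ennreal (\<Prod>i<k j. p i (\<eta> j i)) else 0)"
proof -
  define M where "M i = point_measure (S i) (\<lambda>a. ennreal (p i a))" for i
  have "prob_space (M i)" for i
  proof (rule prob_spaceI)
    have "emeasure (M i) (space (M i)) = (\<Sum>a\<in>S i. ennreal (p i a))"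
      unfolding M_def space_point_measure by (intro emeasure_point_measure_finite fin) auto
    also have "\<dots> = ennreal (\<Sum>a\<in>S i. p i a)" by (intro sum_ennreal nonneg)
    finally show "emeasure (M i) (space (M i)) = 1" by (simp add: sum1)
  qed
  then interpret product_prob_space M UNIV
    by (simp add: product_prob_space_def product_sigma_finite_def product_prob_space_axioms_def
        prob_space_imp_sigma_finite)
  let ?P = "Pi\<^sub>M UNIV M"
  have sp: "space ?P = PiE UNIV S" by (simp add: space_PiM M_def space_point_measure)
  define C where "C j = (if j \<in> J then {\<omega>\<in>space ?P. \<forall>i\<in>{..<k j}. \<omega> i \<in> {\<eta> j i}} else {})" for j
  have mC: "C j \<in> sets ?P" for j
  proof (cases "j \<in> J")
    case True
    have "{\<omega>\<in>space ?P. \<omega> i \<in> {\<eta> j i}} \<in> sets ?P" for i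
    proof -
      have "{\<eta> j i} \<in> sets (M i)"
        using \<eta>[OF True] by (auto simp: M_def sets_point_measure)
      then have "(\<lambda>\<omega>. \<omega> i) -` {\<eta> j i} \<inter> space ?P \<in> sets ?P"
        by (intro measurable_sets[OF measurable_component_singleton]) auto
      then show ?thesis by (simp add: vimage_def Int_def conj_commute)
    qed
    then show ?thesis
      unfolding C_def if_P[OF True] by (intro sets.sets_Collect_finite_All) auto
  qed (simp add: C_def)
  have eC: "emeasure ?P (C j) = (if j \<in> J then ennreal (\<Prod>i<k j. p i (\<eta> j i)) else 0)" for j
  proof (cases "j \<in> J")
    case True
    have in_S: "\<eta> j i \<in> S i" for i using \<eta>[OF True] by (auto simp: PiE_iff)
    have "emeasure ?P (C j) = (\<Prod>i\<in>{..<k j}. emeasure (M i) {\<eta> j i})"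
      unfolding C_def using True in_S
      by (simp only: if_True) (intro emeasure_PiM_Collect, auto simp: M_def sets_point_measure)
    also have "\<dots> = (\<Prod>i<k j. ennreal (p i (\<eta> j i)))"
      using in_S by (intro prod.cong refl) (simp add: M_def emeasure_point_measure_finite fin)
    also have "\<dots> = ennreal (\<Prod>i<k j. p i (\<eta> j i))"
      using in_S nonneg by (intro prod_ennreal) auto
    finally show ?thesis using True by simp
  qed (simp add: C_def)
  have "space ?P \<subseteq> (\<Union>j. C j)"
    using cover unfolding C_def sp by fastforce
  then have "emeasure ?P (space ?P) \<le> emeasure ?P (\<Union>j. C j)"
    using mC by (intro emeasure_mono) auto
  also have "\<dots> \<le> (\<Sum>j. emeasure ?P (C j))"
    using mC by (intro emeasure_subadditive_countably) auto
  finally show ?thesis by (simp add: eC emeasure_space_1)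
qed

text \<open>The mass distribution principle for the image of a product of finite probability spaces. If the
cylinder fixed by the common initial segment of two sequences has mass at most \<open>K\<close> times the \<open>s\<close>-th
power of the distance of their images, then a set of diameter \<open>l\<close> meets the image in (the image of)
a single cylinder of mass at most \<open>K l\<^sup>s\<close>: the first index at which two of the sequences in question
differ determines this cylinder.\<close>

lemma mass_distribution:
  fixes S :: "nat \<Rightarrow> 'a set" and p :: "nat \<Rightarrow> 'a \<Rightarrow> real" and X :: "(nat \<Rightarrow> 'a) \<Rightarrow> real"
  assumes fin: "\<And>i. finite (S i)"
    and nonneg: "\<And>i a. a \<in> S i \<Longrightarrow> 0 \<le> p i a"
    and sum1: "\<And>i. (\<Sum>a\<in>S i. p i a) = 1"
    and vanish: "\<And>\<omega>. \<omega> \<in> PiE UNIV S \<Longrightarrow> (\<lambda>k. \<Prod>i<k. p i (\<omega> i)) \<longlonglongrightarrow> 0"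
    and sep: "\<And>\<omega> \<omega>' k. \<lbrakk>\<omega> \<in> PiE UNIV S; \<omega>' \<in> PiE UNIV S; \<forall>i<k. \<omega>' i = \<omega> i; \<omega>' k \<noteq> \<omega> k\<rbrakk>
        \<Longrightarrow> (\<Prod>i<k. p i (\<omega> i)) \<le> K * \<bar>X \<omega>' - X \<omega>\<bar> powr s"
    and t: "0 \<le> t" "t \<le> s" and s: "0 < s" and K: "0 < K"
    and sub: "X ` PiE UNIV S \<subseteq> B"
  shows "hausdorff_measure t B \<noteq> 0"
proof
  let ?\<Omega> = "PiE UNIV S"
  let ?m = "\<lambda>\<omega> k. \<Prod>i<k. p i (\<omega> i)"
  have small_cyl: "\<exists>k. (\<forall>\<omega>'\<in>?\<Omega>. \<bar>X \<omega>' - X \<omega>\<bar> \<le> l \<longrightarrow> (\<forall>i<k. \<omega>' i = \<omega> i)) \<and> ?m \<omega> k \<le> K * l powr s"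
    if \<omega>: "\<omega> \<in> ?\<Omega>" and l: "l > 0" for \<omega> l
  proof (cases "\<exists>k. \<exists>\<omega>'\<in>?\<Omega>. \<bar>X \<omega>' - X \<omega>\<bar> \<le> l \<and> \<omega>' k \<noteq> \<omega> k")
    case True
    define k where "k = (LEAST k. \<exists>\<omega>'\<in>?\<Omega>. \<bar>X \<omega>' - X \<omega>\<bar> \<le> l \<and> \<omega>' k \<noteq> \<omega> k)"
    have agree: "\<omega>' i = \<omega> i" if "\<omega>' \<in> ?\<Omega>" "\<bar>X \<omega>' - X \<omega>\<bar> \<le> l" "i < k" for \<omega>' i
      using not_less_Least that unfolding k_def by blast
    obtain \<omega>' where \<omega>': "\<omega>' \<in> ?\<Omega>" "\<bar>X \<omega>' - X \<omega>\<bar> \<le> l" "\<omega>' k \<noteq> \<omega> k"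
      using LeastI_ex[OF True] unfolding k_def by blast
    have "?m \<omega> k \<le> K * \<bar>X \<omega>' - X \<omega>\<bar> powr s"
      using \<omega>' agree by (intro sep \<omega>) auto
    also have "\<dots> \<le> K * l powr s"
      using K s \<omega>' by (intro mult_left_mono powr_mono2) auto
    finally show ?thesis using agree by blast
  next
    case False
    have "0 < K * l powr s" using K l by simp
    then have "eventually (\<lambda>k. ?m \<omega> k < K * l powr s) sequentially"
      using order_tendstoD(2)[OF vanish[OF \<omega>]] by blast
    then obtain k where "?m \<omega> k < K * l powr s"
      by (auto simp: eventually_sequentially)
    then show ?thesis using False by (intro exI[of _ k]) auto
  qed
  assume "hausdorff_measure t B = 0"
  then have "hausdorff_premeasure t 1 B \<le> 0"
    unfolding hausdorff_measure_def by (metis SUP_upper greaterThan_iff zero_less_one)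
  then have "hausdorff_premeasure t 1 B < ennreal (1 / (4 * K))"
    using K by (simp add: less_le_not_le)
  then obtain U where U: "B \<subseteq> (\<Union>i. U i)" "\<And>i. bounded (U i)" "\<And>i. diameter (U i) \<le> 1"
    and sumU: "(\<Sum>i. diam_pow t (U i)) < ennreal (1 / (4 * K))"
    unfolding hausdorff_premeasure_def INF_less_iff by auto
  define J where "J = {j. \<exists>\<omega>\<in>?\<Omega>. X \<omega> \<in> U j}"
  \<comment> \<open>The margin \<open>(1/2)^(j+2)\<close> takes care of the pieces of diameter \<open>0\<close>.\<close>
  have "\<exists>\<omega> k. \<omega> \<in> ?\<Omega> \<and> (\<forall>\<omega>'\<in>?\<Omega>. X \<omega>' \<in> U j \<longrightarrow> (\<forall>i<k. \<omega>' i = \<omega> i)) \<and>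
      ?m \<omega> k \<le> K * diameter (U j) powr s + (1/2)^(j+2)" if "j \<in> J" for j
  proof -
    obtain \<omega> where \<omega>: "\<omega> \<in> ?\<Omega>" "X \<omega> \<in> U j" using \<open>j \<in> J\<close> unfolding J_def by blast
    define l where "l = (if diameter (U j) > 0 then diameter (U j) else ((1/2)^(j+2) / K) powr (1 / s))"
    have l: "l > 0" "diameter (U j) \<le> l" unfolding l_def using K by (auto intro: order_trans[of _ 0] simp: not_less)
    have dge: "0 \<le> diameter (U j)" using U(2) by (rule diameter_ge_0)
    have "K * l powr s \<le> K * diameter (U j) powr s + (1/2)^(j+2)"
      unfolding l_def using K s dge by (auto simp: powr_powr)
    moreover obtain k where "\<forall>\<omega>'\<in>?\<Omega>. \<bar>X \<omega>' - X \<omega>\<bar> \<le> l \<longrightarrow> (\<forall>i<k. \<omega>' i = \<omega> i)" "?m \<omega> k \<le> K * l powr s"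
      using small_cyl[OF \<omega>(1) l(1)] by blast
    moreover have "\<bar>X \<omega>' - X \<omega>\<bar> \<le> l" if "X \<omega>' \<in> U j" for \<omega>'
      using diameter_bounded_bound[OF U(2) that \<omega>(2)] l(2) by (simp add: dist_real_def)
    ultimately show ?thesis using \<omega> by (intro exI[of _ \<omega>] exI[of _ k]) force
  qed
  then obtain \<eta> k where \<eta>k: "\<And>j. j \<in> J \<Longrightarrow> \<eta> j \<in> ?\<Omega> \<and>
      (\<forall>\<omega>'\<in>?\<Omega>. X \<omega>' \<in> U j \<longrightarrow> (\<forall>i<k j. \<omega>' i = \<eta> j i)) \<and>
      ?m (\<eta> j) (k j) \<le> K * diameter (U j) powr s + (1/2)^(j+2)"
    by metis
  have "1 \<le> (\<Sum>j. if j \<in> J then ennreal (?m (\<eta> j) (k j)) else 0)"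
  proof (rule sum_product_cylinders_ge_1[OF fin nonneg sum1])
    fix \<omega> assume \<omega>: "\<omega> \<in> ?\<Omega>"
    then obtain j where "X \<omega> \<in> U j" using sub U(1) by blast
    then show "\<exists>j\<in>J. \<forall>i<k j. \<omega> i = \<eta> j i"
      using \<omega> \<eta>k unfolding J_def by blast
  qed (use \<eta>k in auto)
  also have "\<dots> \<le> (\<Sum>j. ennreal K * diam_pow t (U j) + ennreal ((1/2)^(j+2)))"
  proof (intro suminf_le)
    fix j
    show "(if j \<in> J then ennreal (?m (\<eta> j) (k j)) else 0) \<le> ennreal K * diam_pow t (U j) + ennreal ((1/2)^(j+2))"
    proof (cases "j \<in> J")
      case True
      then have ne: "U j \<noteq> {}" unfolding J_def by auto
      have "ennreal (?m (\<eta> j) (k j)) \<le> ennreal (K * diameter (U j) powr s + (1/2)^(j+2))"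
        using \<eta>k[OF True] by (intro ennreal_leI) auto
      also have "\<dots> = ennreal K * ennreal (diameter (U j) powr s) + ennreal ((1/2)^(j+2))"
        using K by (simp add: ennreal_plus ennreal_mult)
      also have "\<dots> \<le> ennreal K * diam_pow t (U j) + ennreal ((1/2)^(j+2))"
        by (intro add_right_mono mult_left_mono powr_diameter_le_diam_pow t U ne) auto
      finally show ?thesis using True by simp
    qed simp
  qed auto
  also have "\<dots> = ennreal K * (\<Sum>j. diam_pow t (U j)) + (\<Sum>j. ennreal ((1/2)^(j+2)))"
    by (subst suminf_add[symmetric]) auto
  also have "(\<Sum>j. ennreal ((1/2)^(j+2))) = ennreal (1/2)"
  proof (rule suminf_ennreal_eq)
    have "(\<lambda>j. (1/4) * (1/2::real)^j) sums ((1/4) * (1 / (1 - 1/2)))"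
      by (intro sums_mult geometric_sums) auto
    then show "(\<lambda>j. (1/2::real)^(j+2)) sums (1/2)" by (simp add: power_add mult.commute)
  qed auto
  also have "ennreal K * (\<Sum>j. diam_pow t (U j)) + ennreal (1/2) \<le> ennreal K * ennreal (1 / (4 * K)) + ennreal (1/2)"
    using sumU by (intro add_right_mono mult_left_mono) auto
  also have "\<dots> = ennreal (3/4)"
  proof -
    have "ennreal K * ennreal (1 / (4 * K)) + ennreal (1/2) = ennreal (K * (1 / (4 * K)) + 1/2)"
      using K by (subst ennreal_plus) (auto simp: ennreal_mult[symmetric] simp del: divide_ennreal)
    also have "K * (1 / (4 * K)) + 1/2 = 3/4" using K by simp
    finally show ?thesis .
  qed
  finally show False by (simp flip: ennreal_1 add: ennreal_le_iff del: ennreal_1)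
qed

section \<open>Subadditive sequences\<close>

text \<open>Writing \<open>n = q k + r\<close> with \<open>1 \<le> r \<le> k\<close> bounds \<open>a n\<close> by \<open>q\<close> times \<open>a k\<close> plus one of finitely many
values. The index \<open>0\<close> is excluded throughout, since potentials are indexed from \<open>1\<close>.\<close>

lemma fekete:
  fixes a :: "nat \<Rightarrow> real"
  assumes sub: "\<And>n p. \<lbrakk>n \<ge> 1; p \<ge> 1\<rbrakk> \<Longrightarrow> a (n + p) \<le> a n + a p"
    and bdd: "\<And>n. n \<ge> 1 \<Longrightarrow> - K * real n \<le> a n"
  shows "convergent (\<lambda>n. a n / real n)"
proof -
  define L where "L = (INF n\<in>{1..}. a n / real n)"
  have lower: "bdd_below ((\<lambda>n. a n / real n) ` {1..})"
    using bdd by (intro bdd_belowI[of _ "- K"]) (auto simp: field_simps)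
  have L_le: "L \<le> a n / real n" if "n \<ge> 1" for n
    unfolding L_def using that by (intro cINF_lower lower) auto
  have "(\<lambda>n. a n / real n) \<longlonglongrightarrow> L"
  proof (rule LIMSEQ_I)
    fix e :: real assume e: "e > 0"
    have "\<exists>k\<in>{1..}. a k / real k < L + e / 2"
      using e cINF_less_iff[of "{1..}" "\<lambda>n. a n / real n" "L + e/2"] lower
      unfolding L_def by auto
    then obtain k where k: "k \<ge> 1" "a k / real k < L + e / 2" by auto
    define c where "c = L + e / 2"
    define B where "B = Max ((\<lambda>r. a r - c * real r) ` {1..k})"
    have step: "a (q * k + r) - c * real (q * k + r) \<le> B" if "r \<in> {1..k}" for q r
    proof (induction q)
      case 0
      show ?case unfolding B_def using that by (auto intro!: Max_ge)
    next
      case (Suc q)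
      have "a (k + (q * k + r)) \<le> a k + a (q * k + r)"
        using k that by (intro sub) auto
      moreover have "a k \<le> c * real k"
        using k unfolding c_def by (simp add: pos_divide_less_eq)
      ultimately show ?case using Suc by (simp add: algebra_simps)
    qed
    have upper: "a n \<le> c * real n + B" if "n \<ge> 1" for n
    proof -
      define q r where "q = (n - 1) div k" and "r = Suc ((n - 1) mod k)"
      have "n = q * k + r"
        using that div_mult_mod_eq[of "n - 1" k] unfolding q_def r_def by linarith
      moreover have "r \<in> {1..k}" using k unfolding r_def by (simp add: Suc_leI)
      ultimately show ?thesis using step[of r q] by simp
    qed
    obtain n0 :: nat where n0: "n0 > 2 * \<bar>B\<bar> / e"
      using reals_Archimedean2 by blast
    show "\<exists>n0. \<forall>n\<ge>n0. norm (a n / real n - L) < e"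
    proof (intro exI[of _ "max 1 n0"] allI impI)
      fix n assume n: "n \<ge> max 1 n0"
      have "2 * \<bar>B\<bar> / e < real n" using n n0 by linarith
      then have "B < (e / 2) * real n" using e by (simp add: field_simps)
      then have "a n < (L + e) * real n"
        using upper[of n] n unfolding c_def by (simp add: algebra_simps)
      then have "a n / real n < L + e" using n by (simp add: field_simps)
      moreover have "L \<le> a n / real n" using n by (intro L_le) auto
      ultimately show "norm (a n / real n - L) < e" by (simp add: abs_if)
    qed
  qed
  then show ?thesis by (auto simp: convergent_def)
qed

text \<open>Adding the constant \<open>C\<close> turns an almost additive sequence into a subadditive one.\<close>

lemma convergent_almost_additive_average:
  fixes a :: "nat \<Rightarrow> real"
  assumes "\<And>n p. \<lbrakk>n \<ge> 1; p \<ge> 1\<rbrakk> \<Longrightarrow> \<bar>a (n + p) - (a n + a p)\<bar> \<le> C"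
  shows "convergent (\<lambda>n. a n / real n)"
proof -
  define K where "K = \<bar>a 1\<bar> + \<bar>C\<bar>"
  have lower: "- K * real n \<le> a n" if "n \<ge> 1" for n
    using that
  proof (induction n rule: dec_induct)
    case base
    show ?case by (simp add: K_def)
  next
    case (step n)
    have "a n + a 1 - C \<le> a (Suc n)" using assms[of n 1] step.hyps by (simp add: abs_le_iff)
    then show ?case using step.IH unfolding K_def by (simp add: algebra_simps)
  qed
  have "convergent (\<lambda>n. (a n + C) / real n)"
  proof (rule fekete)
    fix n p :: nat assume np: "n \<ge> 1" "p \<ge> 1"
    have "a (n + p) - (a n + a p) \<le> C"
      using abs_ge_self order_trans assms[OF np] by blast
    then show "a (n + p) + C \<le> (a n + C) + (a p + C)" by linarith
  next
    fix n :: nat assume n: "n \<ge> 1"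
    have "\<bar>C\<bar> * 1 \<le> \<bar>C\<bar> * real n"
      using n by (intro mult_left_mono) auto
    then show "- (K + \<bar>C\<bar>) * real n \<le> a n + C"
      using lower[OF n] by (simp add: algebra_simps)
  qed
  moreover have "convergent (\<lambda>n. C / real n)"
    by (rule convergentI[OF lim_const_over_n])
  ultimately have "convergent (\<lambda>n. (a n + C) / real n - C / real n)"
    by (rule convergent_diff)
  then show ?thesis by (simp add: add_divide_distrib)
qed

section \<open>Entropy\<close>

definition words :: "'b set \<Rightarrow> nat \<Rightarrow> 'b list set" where
  "words L n = {w. set w \<subseteq> L \<and> length w = n}"

lemma finite_words: "finite L \<Longrightarrow> finite (words L n)"
  unfolding words_def by (rule finite_lists_length_eq)

lemma words_0 [simp]: "words L 0 = {[]}"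
  by (auto simp: words_def)

lemma sum_words_append:
  fixes F :: "'b list \<Rightarrow> real"
  shows "(\<Sum>w\<in>words L (n + k). F w) = (\<Sum>u\<in>words L n. \<Sum>v\<in>words L k. F (u @ v))"
proof -
  have "(\<Sum>u\<in>words L n. \<Sum>v\<in>words L k. F (u @ v)) = (\<Sum>(u, v)\<in>words L n \<times> words L k. F (u @ v))"
    by (rule sum.cartesian_product)
  also have "\<dots> = (\<Sum>w\<in>words L (n + k). F w)"
    by (rule sum.reindex_bij_witness[of _ "\<lambda>w. (take n w, drop n w)" "\<lambda>(u, v). u @ v"])
      (auto simp: words_def dest: in_set_takeD in_set_dropD)
  finally show ?thesis ..
qed

lemma sum_words_prod:
  fixes F :: "nat \<Rightarrow> 'b \<Rightarrow> real"
  shows "(\<Sum>w\<in>words L n. \<Prod>i<n. F i (w ! i)) = (\<Prod>i<n. \<Sum>b\<in>L. F i b)"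
proof (induction n)
  case (Suc n)
  have one: "words L (Suc 0) = (\<lambda>b. [b]) ` L"
    by (auto simp: words_def length_Suc_conv)
  have "(\<Sum>w\<in>words L (n + 1). \<Prod>i<Suc n. F i (w ! i))
      = (\<Sum>u\<in>words L n. \<Sum>b\<in>L. (\<Prod>i<n. F i ((u @ [b]) ! i)) * F n ((u @ [b]) ! n))"
    unfolding sum_words_append by (simp add: one sum.reindex inj_on_def)
  also have "\<dots> = (\<Sum>u\<in>words L n. \<Sum>b\<in>L. (\<Prod>i<n. F i (u ! i)) * F n b)"
    by (intro sum.cong refl arg_cong2[where f = "(*)"] prod.cong)
      (auto simp: words_def nth_append)
  also have "\<dots> = (\<Prod>i<Suc n. \<Sum>b\<in>L. F i b)"
    by (simp add: sum_distrib_left[symmetric] sum_distrib_right[symmetric] Suc)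
  finally show ?case by simp
qed simp

lemma measurable_vimage_singleton:
  assumes "g \<in> measurable M (count_space B)" "b \<in> B"
  shows "{x \<in> space M. g x = b} \<in> sets M"
proof -
  have "g -` {b} \<inter> space M \<in> sets M" using assms by (intro measurable_sets) auto
  then show ?thesis by (simp add: vimage_def Int_def conj_commute)
qed

lemma integral_finite_valued:
  fixes F :: "'b \<Rightarrow> real"
  assumes M: "finite_measure M" and g: "g \<in> measurable M (count_space B)" and B: "finite B"
  shows "integrable M (\<lambda>x. F (g x))"
    and "(\<integral>x. F (g x) \<partial>M) = (\<Sum>b\<in>B. F b * measure M {x \<in> space M. g x = b})"
proof -
  interpret finite_measure M by fact
  let ?A = "\<lambda>b. {x \<in> space M. g x = b}"
  have eq: "F (g x) = (\<Sum>b\<in>B. F b * indicator (?A b) x)" if "x \<in> space M" for x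
  proof -
    have "g x \<in> B" using measurable_space[OF g that] by simp
    then have "(\<Sum>b\<in>B. F b * indicator (?A b) x) = (\<Sum>b\<in>{g x}. F b * indicator (?A b) x)"
      using B by (intro sum.mono_neutral_right) (auto simp: indicator_def)
    then show ?thesis using that by simp
  qed
  have int: "integrable M (\<lambda>x. \<Sum>b\<in>B. F b * indicator (?A b) x)"
    using measurable_vimage_singleton[OF g]
    by (intro Bochner_Integration.integrable_sum integrable_mult_right integrable_real_indicator)
      (auto simp: less_top[symmetric])
  then show "integrable M (\<lambda>x. F (g x))"
    using eq by (simp cong: Bochner_Integration.integrable_cong)
  have "(\<integral>x. F (g x) \<partial>M) = (\<integral>x. (\<Sum>b\<in>B. F b * indicator (?A b) x) \<partial>M)"
    by (intro Bochner_Integration.integral_cong refl eq)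
  also have "\<dots> = (\<Sum>b\<in>B. \<integral>x. F b * indicator (?A b) x \<partial>M)"
    using measurable_vimage_singleton[OF g]
    by (intro Bochner_Integration.integral_sum integrable_mult_right integrable_real_indicator)
      (auto simp: less_top[symmetric])
  also have "\<dots> = (\<Sum>b\<in>B. F b * measure M (?A b))"
    using measurable_vimage_singleton[OF g] by (intro sum.cong refl) (simp add: Int_absorb2)
  finally show "(\<integral>x. F (g x) \<partial>M) = (\<Sum>b\<in>B. F b * measure M (?A b))" .
qed

locale measure_preserving = prob_space \<nu> for \<nu> :: "'a measure" +
  fixes T :: "'a \<Rightarrow> 'a"
  assumes T_measurable: "T \<in> measurable \<nu> \<nu>" and T_invariant: "distr \<nu> \<nu> T = \<nu>"
begin

lemma iterate_measurable: "(T ^^ n) \<in> measurable \<nu> \<nu>"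
proof (induction n)
  case (Suc n)
  show ?case unfolding funpow.simps by (rule measurable_comp[OF Suc T_measurable])
qed (simp add: id_def)

lemma iterate_invariant: "distr \<nu> \<nu> (T ^^ n) = \<nu>"
proof (induction n)
  case 0
  then show ?case by (simp add: id_def distr_id)
next
  case (Suc n)
  have "distr \<nu> \<nu> (T ^^ Suc n) = distr (distr \<nu> \<nu> (T ^^ n)) \<nu> T"
    by (simp add: distr_distr[OF T_measurable iterate_measurable])
  then show ?case by (simp only: Suc T_invariant)
qed

lemma integral_iterate:
  fixes g :: "'a \<Rightarrow> real"
  assumes "g \<in> borel_measurable \<nu>"
  shows "(\<integral>x. g ((T ^^ n) x) \<partial>\<nu>) = (\<integral>x. g x \<partial>\<nu>)"
  using integral_distr[OF iterate_measurable assms] iterate_invariant by metis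

lemma integrable_iterate:
  fixes g :: "'a \<Rightarrow> real"
  assumes "integrable \<nu> g"
  shows "integrable \<nu> (\<lambda>x. g ((T ^^ n) x))"
  using integrable_distr[OF iterate_measurable, where f = g] iterate_invariant assms by metis

end

text \<open>The itinerary of length \<open>n\<close>. Itineraries with respect to the branches and with respect to an
arbitrary finite partition are both instances.\<close>

definition code :: "('a \<Rightarrow> 'a) \<Rightarrow> ('a \<Rightarrow> 'b) \<Rightarrow> nat \<Rightarrow> 'a \<Rightarrow> 'b list" where
  "code T lab n x = map (\<lambda>i. lab ((T ^^ i) x)) [0..<n]"

lemma length_code [simp]: "length (code T lab n x) = n"
  by (simp add: code_def)

lemma nth_code [simp]: "i < n \<Longrightarrow> code T lab n x ! i = lab ((T ^^ i) x)"
  by (simp add: code_def)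

lemma take_code: "j \<le> n \<Longrightarrow> take j (code T lab n x) = code T lab j x"
  by (rule nth_equalityI) auto

lemma drop_code: "drop j (code T lab n x) = code T lab (n - j) ((T ^^ j) x)"
  by (rule nth_equalityI) (auto simp: funpow_add add.commute)

lemma code_Suc: "code T lab (Suc n) x = lab x # code T lab n (T x)"
  by (rule nth_equalityI) (auto simp: nth_Cons' less_Suc_eq_0_disj funpow_swap1)

locale labelled_system = measure_preserving \<nu> T for \<nu> :: "'a measure" and T +
  fixes L :: "'b set" and lab :: "'a \<Rightarrow> 'b"
  assumes finite_L: "finite L" and lab_measurable: "lab \<in> measurable \<nu> (count_space L)"
begin

definition word_prob :: "nat \<Rightarrow> 'b list \<Rightarrow> real" where
  "word_prob n w = measure \<nu> {x \<in> space \<nu>. code T lab n x = w}"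

definition word_entropy :: "nat \<Rightarrow> real" where
  "word_entropy n = - (\<Sum>w\<in>words L n. word_prob n w * ln (word_prob n w))"

lemma lab_iterate: "x \<in> space \<nu> \<Longrightarrow> lab ((T ^^ i) x) \<in> L"
  using measurable_space[OF lab_measurable] measurable_space[OF iterate_measurable] by fastforce

lemma code_in_words: "x \<in> space \<nu> \<Longrightarrow> code T lab n x \<in> words L n"
  using lab_iterate by (auto simp: words_def code_def)

lemma code_measurable: "code T lab n \<in> measurable \<nu> (count_space (words L n))"
proof (subst measurable_count_space_eq2[OF finite_words[OF finite_L]], safe)
  fix w assume w: "w \<in> words L n"
  have "{x \<in> space \<nu>. lab ((T ^^ i) x) = w ! i} \<in> sets \<nu>" if "i < n" for i
    using measurable_vimage_singleton[OF measurable_compose[OF iterate_measurable lab_measurable], of "w ! i"] w that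
    by (auto simp: words_def subset_iff)
  then have "{x \<in> space \<nu>. \<forall>i\<in>{..<n}. lab ((T ^^ i) x) = w ! i} \<in> sets \<nu>"
    by (intro sets.sets_Collect_finite_All) auto
  moreover have "code T lab n -` {w} \<inter> space \<nu> = {x \<in> space \<nu>. \<forall>i\<in>{..<n}. lab ((T ^^ i) x) = w ! i}"
    using w by (auto simp: words_def list_eq_iff_nth_eq)
  ultimately show "code T lab n -` {w} \<inter> space \<nu> \<in> sets \<nu>" by simp
qed (rule code_in_words)

lemma integrable_code: "integrable \<nu> (\<lambda>x. F (code T lab n x) :: real)"
  using integral_finite_valued(1)[OF finite_measure_axioms code_measurable finite_words[OF finite_L]] .

lemma integral_code:
  "(\<integral>x. F (code T lab n x) \<partial>\<nu>) = (\<Sum>w\<in>words L n. (F w :: real) * word_prob n w)"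
  using integral_finite_valued(2)[OF finite_measure_axioms code_measurable finite_words[OF finite_L]]
  unfolding word_prob_def .

lemma word_prob_nonneg: "0 \<le> word_prob n w"
  by (simp add: word_prob_def)

lemma sum_word_prob: "(\<Sum>w\<in>words L n. word_prob n w) = 1"
  using integral_code[of "\<lambda>_. 1" n] by (simp add: prob_space)

lemma word_entropy_integral: "word_entropy n = (\<integral>x. - ln (word_prob n (code T lab n x)) \<partial>\<nu>)"
  unfolding integral_code[of "\<lambda>w. - ln (word_prob n w)"] word_entropy_def
  by (simp add: sum_negf mult.commute)

lemma word_entropy_nonneg: "0 \<le> word_entropy n"
  unfolding word_entropy_def
proof (subst sum_negf[symmetric], intro sum_nonneg)
  fix w
  have "word_prob n w \<le> 1" by (simp add: word_prob_def)
  then show "0 \<le> - (word_prob n w * ln (word_prob n w))"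
    using word_prob_nonneg[of n w]
    by (cases "word_prob n w = 0") (auto simp: mult_le_0_iff)
qed

text \<open>Relative entropy is nonnegative, termwise by \<open>ln x \<le> x - 1\<close>. All entropy estimates below are
obtained by choosing a suitable \<open>q\<close>, so that conditional entropy is never introduced.\<close>

lemma gibbs_inequality:
  assumes q: "\<And>w. w \<in> words L n \<Longrightarrow> 0 \<le> q w"
    and pos: "\<And>w. \<lbrakk>w \<in> words L n; word_prob n w > 0\<rbrakk> \<Longrightarrow> q w > 0"
    and le1: "(\<Sum>w\<in>words L n. q w) \<le> 1"
  shows "word_entropy n \<le> (\<integral>x. - ln (q (code T lab n x)) \<partial>\<nu>)"
proof -
  have "word_prob n w * ln (q w) - word_prob n w * ln (word_prob n w) \<le> q w - word_prob n w"
    if w: "w \<in> words L n" for w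
  proof (cases "word_prob n w = 0")
    case False
    then have p: "word_prob n w > 0" using word_prob_nonneg[of n w] by linarith
    have "ln (q w) - ln (word_prob n w) = ln (q w / word_prob n w)"
      using p pos[OF w p] by (simp add: ln_div)
    also have "\<dots> \<le> q w / word_prob n w - 1"
      using p pos[OF w p] by (intro ln_le_minus_one) auto
    finally have "word_prob n w * (ln (q w) - ln (word_prob n w)) \<le> word_prob n w * (q w / word_prob n w - 1)"
      using p by (intro mult_left_mono) auto
    then show ?thesis using p by (simp add: algebra_simps)
  qed (use q w in auto)
  then have "(\<Sum>w\<in>words L n. word_prob n w * ln (q w) - word_prob n w * ln (word_prob n w))
      \<le> (\<Sum>w\<in>words L n. q w - word_prob n w)"
    by (intro sum_mono)
  also have "\<dots> \<le> 0" using le1 by (simp add: sum_subtractf sum_word_prob)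
  finally show ?thesis
    unfolding integral_code[of "\<lambda>w. - ln (q w)"] word_entropy_def
    by (simp add: sum_subtractf sum_negf mult.commute)
qed

lemma prob_code_iterate: "measure \<nu> {x \<in> space \<nu>. code T lab n ((T ^^ k) x) = w} = word_prob n w"
proof (cases "w \<in> words L n")
  case True
  have "measure \<nu> {x \<in> space \<nu>. code T lab n x = w}
      = measure (distr \<nu> \<nu> (T ^^ k)) {x \<in> space \<nu>. code T lab n x = w}"
    by (simp add: iterate_invariant)
  also have "\<dots> = measure \<nu> ((T ^^ k) -` {x \<in> space \<nu>. code T lab n x = w} \<inter> space \<nu>)"
    by (intro measure_distr iterate_measurable measurable_vimage_singleton[OF code_measurable True])
  also have "(T ^^ k) -` {x \<in> space \<nu>. code T lab n x = w} \<inter> space \<nu>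
      = {x \<in> space \<nu>. code T lab n ((T ^^ k) x) = w}"
    using measurable_space[OF iterate_measurable] by auto
  finally show ?thesis by (simp add: word_prob_def)
next
  case False
  then have "code T lab n x \<noteq> w" if "x \<in> space \<nu>" for x using code_in_words that by blast
  moreover have "(T ^^ k) x \<in> space \<nu>" if "x \<in> space \<nu>" for x
    using measurable_space[OF iterate_measurable that] .
  ultimately have "{x \<in> space \<nu>. code T lab n ((T ^^ k) x) = w} = {}" "{x \<in> space \<nu>. code T lab n x = w} = {}"
    by auto
  then show ?thesis unfolding word_prob_def by (simp only:)
qed

text \<open>Gibbs' inequality for the measure that makes the first \<open>n\<close> letters independent of the last \<open>k\<close>.\<close>

lemma word_entropy_subadditive: "word_entropy (n + k) \<le> word_entropy n + word_entropy k"
proof -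
  define q where "q w = word_prob n (take n w) * word_prob k (drop n w)" for w
  have codes: "take n (code T lab (n + k) x) = code T lab n x"
    "drop n (code T lab (n + k) x) = code T lab k ((T ^^ n) x)" for x
    by (simp_all add: take_code drop_code)
  have ac: "word_prob n (take n w) > 0 \<and> word_prob k (drop n w) > 0" if "word_prob (n + k) w > 0" "w \<in> words L (n + k)" for w
  proof -
    have "word_prob (n + k) w \<le> word_prob n (take n w)"
      unfolding word_prob_def
      using that(2) by (intro finite_measure_mono measurable_vimage_singleton[OF code_measurable])
        (auto simp: codes words_def dest: in_set_takeD)
    moreover have "word_prob (n + k) w \<le> measure \<nu> {x \<in> space \<nu>. code T lab k ((T ^^ n) x) = drop n w}"
      unfolding word_prob_def
      using that(2)
      by (intro finite_measure_mono measurable_vimage_singleton[OF measurable_compose[OF iterate_measurable code_measurable]])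
        (auto simp: codes words_def dest: in_set_dropD)
    ultimately show ?thesis using that(1) by (simp add: prob_code_iterate)
  qed
  have "word_entropy (n + k) \<le> (\<integral>x. - ln (q (code T lab (n + k) x)) \<partial>\<nu>)"
  proof (rule gibbs_inequality)
    show "0 \<le> q w" for w unfolding q_def by (intro mult_nonneg_nonneg word_prob_nonneg)
    show "q w > 0" if "w \<in> words L (n + k)" "word_prob (n + k) w > 0" for w
      using ac[OF that(2,1)] unfolding q_def by simp
    have "(\<Sum>w\<in>words L (n + k). q w) = (\<Sum>u\<in>words L n. \<Sum>v\<in>words L k. word_prob n u * word_prob k v)"
      unfolding sum_words_append q_def by (intro sum.cong refl) (auto simp: words_def)
    then show "(\<Sum>w\<in>words L (n + k). q w) \<le> 1"
      by (simp add: sum_distrib_left[symmetric] sum_word_prob)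
  qed
  also have "\<dots> = (\<integral>x. - ln (word_prob n (take n (code T lab (n + k) x)))
        + - ln (word_prob k (drop n (code T lab (n + k) x))) \<partial>\<nu>)"
    unfolding integral_code[of "\<lambda>w. - ln (q w)"]
      integral_code[of "\<lambda>w. - ln (word_prob n (take n w)) + - ln (word_prob k (drop n w))"]
  proof (intro sum.cong refl)
    fix w assume w: "w \<in> words L (n + k)"
    show "- ln (q w) * word_prob (n + k) w
        = (- ln (word_prob n (take n w)) + - ln (word_prob k (drop n w))) * word_prob (n + k) w"
    proof (cases "word_prob (n + k) w = 0")
      case False
      then have "word_prob (n + k) w > 0" using word_prob_nonneg[of "n + k" w] by linarith
      from ac[OF this w] show ?thesis unfolding q_def by (simp add: ln_mult)
    qed simp
  qed
  also have "\<dots> = (\<integral>x. - ln (word_prob n (code T lab n x)) \<partial>\<nu>)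
      + (\<integral>x. - ln (word_prob k (code T lab k ((T ^^ n) x))) \<partial>\<nu>)"
    unfolding codes
    using integrable_code[of "\<lambda>w. - ln (word_prob n w)" n]
      integrable_iterate[OF integrable_code[of "\<lambda>w. - ln (word_prob k w)" k]]
    by (intro Bochner_Integration.integral_add) auto
  also have "(\<integral>x. - ln (word_prob k (code T lab k ((T ^^ n) x))) \<partial>\<nu>)
      = (\<integral>x. - ln (word_prob k (code T lab k x)) \<partial>\<nu>)"
    by (intro integral_iterate borel_measurable_integrable integrable_code)
  finally show ?thesis by (simp add: word_entropy_integral)
qed

lemma convergent_word_entropy: "convergent (\<lambda>n. word_entropy n / real n)"
  by (rule fekete[of word_entropy 0]) (auto simp: word_entropy_subadditive word_entropy_nonneg)

end

text \<open>Labels the points of \<open>X\<close> by the partition element containing them, so that entropies of iterated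
joins become entropies of itineraries.\<close>

lemma the_partition_element_eq_iff:
  assumes part: "partition_on X P" and "x \<in> X" "A \<in> P"
  shows "(THE A. A \<in> P \<and> x \<in> A) = A \<longleftrightarrow> x \<in> A"
proof -
  have uniq: "B = C" if "B \<in> P" "x \<in> B" "C \<in> P" "x \<in> C" for B C
    using disjointD[OF partition_onD2[OF part], of B C] that by auto
  obtain B where B: "B \<in> P" "x \<in> B"
    using partition_onD1[OF part] \<open>x \<in> X\<close> by auto
  then have "(THE A. A \<in> P \<and> x \<in> A) = B"
    using uniq by (intro the_equality) simp_all
  then show ?thesis using B uniq[of B A] assms(3) by blast
qed

lemma partition_labelled_system:
  assumes "measure_preserving \<nu> T" and fin: "finite P" and P: "P \<subseteq> sets \<nu>" and part: "partition_on (space \<nu>) P"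
  defines "lab \<equiv> (\<lambda>x. THE A. A \<in> P \<and> x \<in> A)"
  shows "labelled_system \<nu> T P lab"
    and "partition_entropy \<nu> (iterated_join \<nu> T P n) = labelled_system.word_entropy \<nu> T P lab n"
proof -
  interpret measure_preserving \<nu> T by fact
  have lab: "lab x = A \<longleftrightarrow> x \<in> A" if "x \<in> space \<nu>" "A \<in> P" for x A
    unfolding lab_def by (rule the_partition_element_eq_iff[OF part that])
  have labP: "lab x \<in> P" if "x \<in> space \<nu>" for x
    using lab[OF that] partition_onD1[OF part] that by auto
  show lsys: "labelled_system \<nu> T P lab"
  proof
    show "lab \<in> measurable \<nu> (count_space P)"
    proof (subst measurable_count_space_eq2[OF fin], safe)
      fix A assume A: "A \<in> P"
      have "lab -` {A} \<inter> space \<nu> = A"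
        using lab A sets.sets_into_space[of A \<nu>] P by auto
      then show "lab -` {A} \<inter> space \<nu> \<in> sets \<nu>" using A P by auto
    qed (rule labP)
  qed (rule fin)
  interpret labelled_system \<nu> T P lab by (rule lsys)
  let ?A = "\<lambda>w. {x \<in> space \<nu>. code T lab n x = w}"
  have atom: "{x \<in> space \<nu>. \<forall>i<n. (T ^^ i) x \<in> c i} = ?A (map c [0..<n])" if "\<forall>i<n. c i \<in> P" for c
  proof (intro Collect_cong conj_cong refl)
    fix x assume "x \<in> space \<nu>"
    then have "lab ((T ^^ i) x) = c i \<longleftrightarrow> (T ^^ i) x \<in> c i" if "i < n" for i
      using \<open>\<forall>i<n. c i \<in> P\<close> that by (intro lab measurable_space[OF iterate_measurable]) auto
    then show "(\<forall>i<n. (T ^^ i) x \<in> c i) = (code T lab n x = map c [0..<n])"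
      by (simp add: list_eq_iff_nth_eq)
  qed
  have join: "iterated_join \<nu> T P n = ?A ` words P n - {{}}"
  proof -
    have "{{x \<in> space \<nu>. \<forall>i<n. (T ^^ i) x \<in> c i} | c. \<forall>i<n. c i \<in> P} = ?A ` words P n"
    proof safe
      fix c :: "nat \<Rightarrow> 'a set" assume c: "\<forall>i<n. c i \<in> P"
      then show "{x \<in> space \<nu>. \<forall>i<n. (T ^^ i) x \<in> c i} \<in> ?A ` words P n"
        using atom[OF c] by (intro image_eqI[of _ _ "map c [0..<n]"]) (auto simp: words_def)
    next
      fix w assume w: "w \<in> words P n"
      then have eq: "map ((!) w) [0..<n] = w" by (auto simp: words_def map_nth)
      have nth: "\<forall>i<n. w ! i \<in> P" using w by (auto simp: words_def)
      show "\<exists>c. ?A w = {x \<in> space \<nu>. \<forall>i<n. (T ^^ i) x \<in> c i} \<and> (\<forall>i<n. c i \<in> P)"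
        using atom[OF nth] nth unfolding eq by blast
    qed
    then show ?thesis unfolding iterated_join_def by simp
  qed
  have "partition_entropy \<nu> (iterated_join \<nu> T P n)
      = - (\<Sum>A\<in>?A ` (words P n \<inter> {w. ?A w \<noteq> {}}). measure \<nu> A * ln (measure \<nu> A))"
    unfolding partition_entropy_def join by (intro arg_cong[of _ _ uminus] sum.cong) auto
  also have "\<dots> = - (\<Sum>w\<in>words P n \<inter> {w. ?A w \<noteq> {}}. word_prob n w * ln (word_prob n w))"
    by (subst sum.reindex) (auto simp: inj_on_def word_prob_def)
  also have "\<dots> = word_entropy n"
  proof -
    have "word_prob n w = 0" if "?A w = {}" for w
      using that unfolding word_prob_def by (simp only: measure_empty)
    then show ?thesis
      unfolding word_entropy_def
      by (intro arg_cong[of _ _ uminus] sum.mono_neutral_left finite_words fin) auto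
  qed
  finally show "partition_entropy \<nu> (iterated_join \<nu> T P n) = word_entropy n" .
qed

section \<open>Cylinders of an expanding interval system\<close>

locale expanding_system =
  fixes m :: nat and I :: "nat \<Rightarrow> real set" and f :: "nat \<Rightarrow> real \<Rightarrow> real" and \<sigma> :: "real \<Rightarrow> nat"
  assumes interval_system: "interval_system m I f" and branch_choice: "branch_choice m I f \<sigma>"
begin

abbreviation \<Lambda> :: "real set" where "\<Lambda> \<equiv> attractor m I f"
abbreviation T :: "real \<Rightarrow> real" where "T \<equiv> system_map f \<sigma>"
abbreviation d :: "nat \<Rightarrow> real \<Rightarrow> real" where "d \<equiv> branch_deriv I f"

definition lo :: "nat \<Rightarrow> real" where "lo j = Inf (I j)"
definition hi :: "nat \<Rightarrow> real" where "hi j = Sup (I j)"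

lemmas system_conditions = interval_system[unfolded interval_system_def]
lemmas branch_interval_exists = system_conditions[THEN conjunct2, THEN conjunct1, THEN bspec]
lemmas interiors_disjoint =
  system_conditions[THEN conjunct2, THEN conjunct2, THEN conjunct1, THEN bspec, THEN bspec, THEN mp]
lemmas branch_conditions =
  system_conditions[THEN conjunct2, THEN conjunct2, THEN conjunct2, THEN conjunct1, THEN bspec]
lemmas branch_deriv_gt_1 =
  system_conditions[THEN conjunct2, THEN conjunct2, THEN conjunct2, THEN conjunct2, THEN bspec, THEN bspec, THEN mp]

lemma branch_interval:
  assumes "j \<in> {1..m}"
  shows "I j = {lo j..hi j}" "lo j < hi j" "0 \<le> lo j" "hi j \<le> 1"
proof -
  obtain a b where ab: "a < b" "I j = {a..b}" "I j \<subseteq> {0..1}"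
    using branch_interval_exists[OF assms] by blast
  then show "I j = {lo j..hi j}" "lo j < hi j" "0 \<le> lo j" "hi j \<le> 1"
    unfolding lo_def hi_def by (auto simp: atLeastatMost_subset_iff)
qed

lemma branch_subset: "j \<in> {1..m} \<Longrightarrow> I j \<subseteq> {0..1}"
  using branch_interval[of j] by auto

lemma branch_image: "j \<in> {1..m} \<Longrightarrow> f j ` I j = {0..1}"
  using branch_conditions by blast

lemma branch_in_unit: "\<lbrakk>j \<in> {1..m}; x \<in> I j\<rbrakk> \<Longrightarrow> f j x \<in> {0..1}"
  using branch_image by blast

lemma deriv_continuous: "j \<in> {1..m} \<Longrightarrow> continuous_on (I j) (d j)"
  using branch_conditions by blast

lemma has_derivative_branch:
  assumes "j \<in> {1..m}" "x \<in> I j"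
  shows "(f j has_real_derivative d j x) (at x within I j)"
proof -
  have "f j differentiable (at x within I j)"
    using branch_conditions[OF assms(1)] assms(2) by blast
  then show ?thesis
    unfolding branch_deriv_def has_real_derivative_iff_has_vector_derivative
    by (rule vector_derivative_works[THEN iffD1])
qed

lemma branch_continuous: "j \<in> {1..m} \<Longrightarrow> continuous_on (I j) (f j)"
  using has_derivative_branch by (intro DERIV_continuous_on)

lemma non_overlapping:
  assumes "i \<in> {1..m}" "j \<in> {1..m}" "i \<noteq> j"
  shows "min (hi i) (hi j) \<le> max (lo i) (lo j)"
proof (rule ccontr)
  assume *: "\<not> ?thesis"
  have "interior (I i) \<inter> interior (I j) = {}"
    by (rule interiors_disjoint[OF assms])
  then have "{lo i<..<hi i} \<inter> {lo j<..<hi j} = {}"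
    using branch_interval(1) assms by (simp add: interior_atLeastAtMost_real)
  moreover obtain z where "max (lo i) (lo j) < z" "z < min (hi i) (hi j)"
    using * dense by (meson not_le)
  ultimately show False by auto
qed

definition fixed_points :: "real set" where
  "fixed_points = {z. \<exists>i\<in>{1..m}. z \<in> I i \<and> f i z = z}"

lemma finite_fixed_points: "finite fixed_points"
proof -
  have "finite {z. z \<in> I i \<and> f i z = z}" if "i \<in> {1..m}" for i
  proof -
    have "\<exists>!x. x \<in> I i \<and> f i x = x"
      using branch_conditions[OF that] by blast
    then obtain p where "\<And>x. x \<in> I i \<and> f i x = x \<Longrightarrow> x = p" by metis
    then have "{z. z \<in> I i \<and> f i z = z} \<subseteq> {p}" by blast
    then show ?thesis by (rule finite_subset) simp
  qed
  moreover have "fixed_points = (\<Union>i\<in>{1..m}. {z. z \<in> I i \<and> f i z = z})"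
    unfolding fixed_points_def by auto
  ultimately show ?thesis by auto
qed

lemma deriv_gt_1: "\<lbrakk>j \<in> {1..m}; x \<in> I j; x \<notin> fixed_points\<rbrakk> \<Longrightarrow> d j x > 1"
  unfolding fixed_points_def by (rule branch_deriv_gt_1)

text \<open>At the finitely many fixed points, the bound is inherited by continuity of the derivative;
this also covers a fixed point of one branch that is an end point of another interval.\<close>

lemma deriv_ge_1:
  assumes "j \<in> {1..m}" "x \<in> I j"
  shows "d j x \<ge> 1"
proof (rule ccontr)
  assume "\<not> d j x \<ge> 1"
  then have lt: "1 - d j x > 0" by simp
  obtain e where e: "e > 0" "\<And>y. \<lbrakk>y \<in> I j; dist y x < e\<rbrakk> \<Longrightarrow> dist (d j y) (d j x) < 1 - d j x"
    using deriv_continuous[OF assms(1)] assms(2) lt unfolding continuous_on_iff by meson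
  \<comment> \<open>A nondegenerate interval of points with derivative below \<open>1\<close>, all of which would be fixed points.\<close>
  let ?J = "{max (lo j) (x - e/2)..min (hi j) (x + e/2)}"
  have "y \<in> fixed_points" if y: "y \<in> ?J" for y
  proof (rule ccontr)
    assume "y \<notin> fixed_points"
    have yI: "y \<in> I j" using y branch_interval(1)[OF assms(1)] by auto
    have "dist y x < e" using y e(1) by (auto simp: dist_real_def)
    then have "d j y < 1" using e(2)[OF yI] by (auto simp: dist_real_def)
    then show False using deriv_gt_1[OF assms(1) yI] \<open>y \<notin> fixed_points\<close> by simp
  qed
  then have "?J \<subseteq> fixed_points" by blast
  then have "finite ?J" using finite_fixed_points by (rule finite_subset)
  moreover have "infinite ?J"
    using branch_interval[OF assms(1)] assms(2) e(1) by (intro infinite_Icc) auto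
  ultimately show False by simp
qed

lemma mean_value:
  assumes "j \<in> {1..m}" "x \<in> I j" "y \<in> I j" "x < y"
  shows "\<exists>z\<in>{x<..<y}. z \<in> I j \<and> f j y - f j x = d j z * (y - x)"
proof -
  have sub: "{x..y} \<subseteq> I j" using assms branch_interval(1)[of j] by auto
  have "\<exists>z\<in>{x<..<y}. f j y - f j x = (*) (d j z) (y - x)"
  proof (rule mvt_simple[OF assms(4)])
    fix z assume "x \<le> z" "z \<le> y"
    then have "z \<in> I j" using sub by auto
    then show "(f j has_derivative (*) (d j z)) (at z within {x..y})"
      using has_derivative_subset[OF has_derivative_branch[OF assms(1), unfolded has_field_derivative_def] sub]
      by blast
  qed
  then obtain z where z: "z \<in> {x<..<y}" "f j y - f j x = d j z * (y - x)" by blast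
  then have "z \<in> I j" using sub by auto
  then show ?thesis using z by blast
qed

lemma branch_expanding:
  assumes "j \<in> {1..m}" "x \<in> I j" "y \<in> I j" "x \<le> y"
  shows "y - x \<le> f j y - f j x"
proof (cases "x = y")
  case False
  then obtain z where z: "z \<in> I j" "f j y - f j x = d j z * (y - x)"
    using mean_value[of j x y] assms by auto
  have "1 * (y - x) \<le> d j z * (y - x)"
    using deriv_ge_1[OF assms(1) z(1)] assms(4) by (intro mult_right_mono) auto
  then show ?thesis using z(2) by simp
qed simp

lemma branch_strictly_expanding:
  assumes "j \<in> {1..m}" "x \<in> I j" "y \<in> I j" "x < y"
  shows "y - x < f j y - f j x"
proof -
  \<comment> \<open>To the right of \<open>x\<close>, the derivative is larger than \<open>1\<close> up to the next fixed point.\<close>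
  define u where "u = Min (insert y (fixed_points \<inter> {x<..<y}))"
  have fin: "finite (insert y (fixed_points \<inter> {x<..<y}))" using finite_fixed_points by simp
  have "u \<in> insert y (fixed_points \<inter> {x<..<y})"
    unfolding u_def using fin by (intro Min_in) auto
  then have u: "x < u" "u \<le> y" "u \<in> I j" using assms branch_interval(1)[of j] by auto
  have no_fix: "z \<notin> fixed_points" if "z \<in> {x<..<u}" for z
  proof
    assume "z \<in> fixed_points"
    then have "u \<le> z" unfolding u_def using that u fin by (intro Min_le) auto
    then show False using that by simp
  qed
  obtain z where z: "z \<in> {x<..<u}" "z \<in> I j" "f j u - f j x = d j z * (u - x)"
    using mean_value[OF assms(1,2) u(3,1)] by blast
  have "1 * (u - x) < d j z * (u - x)"
    using deriv_gt_1[OF assms(1) z(2) no_fix[OF z(1)]] u by (intro mult_strict_right_mono) auto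
  moreover have "y - u \<le> f j y - f j u" using branch_expanding[OF assms(1) u(3) assms(3) u(2)] .
  ultimately show ?thesis using z(3) by simp
qed

lemma branch_mono: "\<lbrakk>j \<in> {1..m}; x \<in> I j; y \<in> I j; x \<le> y\<rbrakk> \<Longrightarrow> f j x \<le> f j y"
  using branch_expanding by fastforce

lemma branch_endpoints:
  assumes "j \<in> {1..m}"
  shows "f j (lo j) = 0" "f j (hi j) = 1"
proof -
  have end_in: "lo j \<in> I j" "hi j \<in> I j" using branch_interval[OF assms] by auto
  obtain x where x: "x \<in> I j" "f j x = 0" using branch_image[OF assms] by (metis atLeastAtMost_iff imageE order_refl zero_le_one)
  obtain y where y: "y \<in> I j" "f j y = 1" using branch_image[OF assms] by (metis atLeastAtMost_iff imageE order_refl zero_le_one)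
  have "f j (lo j) \<le> f j x" using branch_mono[OF assms end_in(1) x(1)] branch_interval[OF assms] x by auto
  moreover have "f j y \<le> f j (hi j)" using branch_mono[OF assms y(1) end_in(2)] branch_interval[OF assms] y by auto
  ultimately show "f j (lo j) = 0" "f j (hi j) = 1"
    using x y branch_in_unit[OF assms end_in(1)] branch_in_unit[OF assms end_in(2)] by auto
qed

text \<open>Two intervals meet at most in an end point, and branches map end points to \<open>0\<close> or \<open>1\<close>. Together
with the next lemma, this confines the ambiguity of the coding to orbits that end in \<open>0\<close> or \<open>1\<close>.\<close>

lemma common_point_to_boundary:
  assumes "i \<in> {1..m}" "j \<in> {1..m}" "i \<noteq> j" "x \<in> I i" "x \<in> I j"
  shows "f i x \<in> {0, 1}"
proof -
  have "x = lo i \<or> x = hi i"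
    using non_overlapping[OF assms(1-3)] branch_interval[OF assms(1)] branch_interval[OF assms(2)] assms(4,5)
    by auto
  then show ?thesis using branch_endpoints[OF assms(1)] by auto
qed

lemma boundary_fixed:
  assumes "j \<in> {1..m}" "x \<in> I j" "x \<in> {0, 1}"
  shows "f j x = x"
proof -
  have "x = lo j \<and> x = 0 \<or> x = hi j \<and> x = 1"
    using assms(2,3) branch_interval[OF assms(1)] by auto
  then show ?thesis using branch_endpoints[OF assms(1)] by auto
qed

text \<open>By compactness, intervals of length at least \<open>e\<close> grow by a definite amount under a branch, although
the derivative need not be bounded away from \<open>1\<close>. This is all the hyperbolicity that is available
at a neutral fixed point.\<close>

lemma uniformly_expanding:
  assumes "e > 0"
  shows "\<exists>\<kappa>>0. \<forall>j\<in>{1..m}. \<forall>x\<in>I j. \<forall>y\<in>I j. e \<le> \<bar>x - y\<bar> \<longrightarrow> \<bar>x - y\<bar> + \<kappa> \<le> \<bar>f j x - f j y\<bar>"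
proof -
  have "\<exists>\<kappa>>0. \<forall>x\<in>I j. \<forall>y\<in>I j. x + e \<le> y \<longrightarrow> (y - x) + \<kappa> \<le> f j y - f j x" if j: "j \<in> {1..m}" for j
  proof -
    let ?h = "\<lambda>p. (f j (snd p) - f j (fst p)) - (snd p - fst p)"
    define K where "K = (I j \<times> I j) \<inter> {p. fst p + e \<le> snd p}"
    have "compact K"
      unfolding K_def using branch_interval(1)[OF j]
      by (intro compact_Int_closed compact_Times closed_Collect_le continuous_intros) auto
    moreover have "continuous_on K ?h"
      unfolding K_def
      by (intro continuous_intros continuous_on_compose2[OF branch_continuous[OF j]]) auto
    ultimately have *: "\<exists>p\<in>K. \<forall>q\<in>K. ?h p \<le> ?h q" if "K \<noteq> {}"
      using continuous_attains_inf that by blast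
    show ?thesis
    proof (cases "K = {}")
      case True
      then show ?thesis unfolding K_def by (intro exI[of _ 1]) auto
    next
      case False
      then obtain p where p: "p \<in> K" "\<And>q. q \<in> K \<Longrightarrow> ?h p \<le> ?h q" using * by blast
      have "?h p > 0"
        using branch_strictly_expanding[OF j, of "fst p" "snd p"] p(1) assms unfolding K_def by auto
      moreover have "(y - x) + ?h p \<le> f j y - f j x" if "x \<in> I j" "y \<in> I j" "x + e \<le> y" for x y
        using p(2)[of "(x, y)"] that unfolding K_def by simp
      ultimately show ?thesis by blast
    qed
  qed
  then obtain \<kappa> where \<kappa>: "\<And>j. j \<in> {1..m} \<Longrightarrow> \<kappa> j > 0"
    "\<And>j x y. \<lbrakk>j \<in> {1..m}; x \<in> I j; y \<in> I j; x + e \<le> y\<rbrakk> \<Longrightarrow> (y - x) + \<kappa> j \<le> f j y - f j x"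
    by metis
  define k where "k = Min (insert 1 (\<kappa> ` {1..m}))"
  have k: "k > 0" "\<And>j. j \<in> {1..m} \<Longrightarrow> k \<le> \<kappa> j"
  proof -
    show "k > 0" unfolding k_def using \<kappa>(1) by (subst Min_gr_iff) auto
    show "k \<le> \<kappa> j" if "j \<in> {1..m}" for j unfolding k_def using that by (intro Min_le) auto
  qed
  show ?thesis
  proof (intro exI[of _ k] conjI k(1) ballI impI)
    fix j x y assume *: "j \<in> {1..m}" "x \<in> I j" "y \<in> I j" "e \<le> \<bar>x - y\<bar>"
    show "\<bar>x - y\<bar> + k \<le> \<bar>f j x - f j y\<bar>"
    proof (cases "x \<le> y")
      case True
      then show ?thesis using \<kappa>(2)[OF *(1-3)] k(2)[OF *(1)] *(4) by auto
    next
      case False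
      then show ?thesis using \<kappa>(2)[OF *(1,3,2)] k(2)[OF *(1)] *(4) by auto
    qed
  qed
qed

abbreviation admissible :: "nat list \<Rightarrow> bool" where
  "admissible w \<equiv> set w \<subseteq> {1..m}"

fun cyl :: "nat list \<Rightarrow> real set" where
  "cyl [] = {0..1}"
| "cyl (j # w) = {x \<in> I j. f j x \<in> cyl w}"

fun fwd :: "nat list \<Rightarrow> real \<Rightarrow> real" where
  "fwd [] x = x"
| "fwd (j # w) x = fwd w (f j x)"

lemma cyl_subset: "admissible w \<Longrightarrow> cyl w \<subseteq> {0..1}"
  by (cases w) (use branch_subset in auto)

lemma fwd_in_unit: "\<lbrakk>admissible w; x \<in> cyl w\<rbrakk> \<Longrightarrow> fwd w x \<in> {0..1}"
  by (induction w arbitrary: x) auto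

lemma fwd_append: "fwd (u @ v) x = fwd v (fwd u x)"
  by (induction u arbitrary: x) auto

lemma cyl_append:
  "\<lbrakk>admissible u; admissible v\<rbrakk> \<Longrightarrow> x \<in> cyl (u @ v) \<longleftrightarrow> x \<in> cyl u \<and> fwd u x \<in> cyl v"
proof (induction u arbitrary: x)
  case Nil
  then show ?case using cyl_subset[of v] by auto
qed auto

lemma cyl_append_subset: "\<lbrakk>admissible u; admissible v\<rbrakk> \<Longrightarrow> cyl (u @ v) \<subseteq> cyl u"
  using cyl_append by blast

lemma cyl_nonempty: "admissible w \<Longrightarrow> cyl w \<noteq> {}"
proof (induction w)
  case (Cons j w)
  then obtain y where y: "y \<in> cyl w" by auto
  then have "y \<in> f j ` I j" using cyl_subset[of w] branch_image[of j] Cons.prems by auto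
  then show ?case using y by auto
qed simp

lemma cyl_compact: "admissible w \<Longrightarrow> compact (cyl w)"
proof (induction w)
  case (Cons j w)
  then have "closed (cyl w)" by (auto intro: compact_imp_closed)
  moreover have "closed (I j)" using branch_interval(1)[of j] Cons.prems by auto
  ultimately have "closed (I j \<inter> f j -` cyl w)"
    using branch_continuous[of j] Cons.prems by (intro continuous_closed_preimage) auto
  moreover have "cyl (j # w) = I j \<inter> (I j \<inter> f j -` cyl w)" by auto
  moreover have "compact (I j)" using branch_interval(1)[of j] Cons.prems by auto
  ultimately show ?case by (simp only: compact_Int_closed)
qed simp

lemma cyl_interval:
  "\<lbrakk>admissible w; x \<in> cyl w; y \<in> cyl w; x \<le> z; z \<le> y\<rbrakk> \<Longrightarrow> z \<in> cyl w"
proof (induction w arbitrary: x y z)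
  case (Cons j w)
  have z: "z \<in> I j" using branch_interval(1)[of j] Cons.prems by auto
  then have "f j x \<le> f j z" "f j z \<le> f j y" using Cons.prems by (auto intro!: branch_mono)
  then show ?case using Cons z by auto
qed auto

text \<open>If a long word had points at distance \<open>e\<close> in its cylinder, their distance would grow by \<open>\<kappa>\<close> in every
step and would exceed \<open>1\<close> in the end.\<close>

lemma cyl_small:
  assumes "e > 0"
  shows "\<exists>M. \<forall>w. admissible w \<longrightarrow> M \<le> length w \<longrightarrow> (\<forall>x\<in>cyl w. \<forall>y\<in>cyl w. \<bar>x - y\<bar> < e)"
proof -
  obtain \<kappa> where \<kappa>: "\<kappa> > 0"
    "\<And>j x y. \<lbrakk>j \<in> {1..m}; x \<in> I j; y \<in> I j; e \<le> \<bar>x - y\<bar>\<rbrakk> \<Longrightarrow> \<bar>x - y\<bar> + \<kappa> \<le> \<bar>f j x - f j y\<bar>"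
    using uniformly_expanding[OF assms] by blast
  have grow: "\<bar>x - y\<bar> + real (length w) * \<kappa> \<le> \<bar>fwd w x - fwd w y\<bar>"
    if "admissible w" "x \<in> cyl w" "y \<in> cyl w" "e \<le> \<bar>x - y\<bar>" for w x y
    using that
  proof (induction w arbitrary: x y)
    case (Cons j w)
    then have 1: "\<bar>x - y\<bar> + \<kappa> \<le> \<bar>f j x - f j y\<bar>" by (intro \<kappa>(2)) auto
    then have "\<bar>f j x - f j y\<bar> + real (length w) * \<kappa> \<le> \<bar>fwd w (f j x) - fwd w (f j y)\<bar>"
      using Cons.prems \<kappa>(1) by (intro Cons.IH) auto
    then show ?case using 1 by (simp add: algebra_simps)
  qed simp
  obtain M :: nat where M: "1 < real M * \<kappa>" using reals_Archimedean3[OF \<kappa>(1)] by blast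
  have "\<bar>x - y\<bar> < e" if w: "admissible w" "M \<le> length w" "x \<in> cyl w" "y \<in> cyl w" for w x y
  proof (rule ccontr)
    assume "\<not> \<bar>x - y\<bar> < e"
    then have "\<bar>x - y\<bar> + real (length w) * \<kappa> \<le> \<bar>fwd w x - fwd w y\<bar>" using grow w by auto
    also have "\<dots> \<le> 1"
      using fwd_in_unit[OF w(1,3)] fwd_in_unit[OF w(1,4)] by (auto simp: abs_le_iff)
    finally have "real (length w) * \<kappa> \<le> 1" by linarith
    moreover have "real M * \<kappa> \<le> real (length w) * \<kappa>" using w(2) \<kappa>(1) by (intro mult_right_mono) auto
    ultimately show False using M by linarith
  qed
  then show ?thesis by blast
qed

lemma boundary_fwd: "\<lbrakk>admissible w; x \<in> cyl w; x \<in> {0, 1}\<rbrakk> \<Longrightarrow> fwd w x = x"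
proof (induction w arbitrary: x)
  case (Cons j w)
  then have "f j x = x" by (intro boundary_fixed) auto
  then show ?case using Cons by auto
qed simp

text \<open>Cylinders of different words of equal length can share end points only, which are carried to \<open>0\<close> or
\<open>1\<close>; a mark \<open>c\<close> whose cylinder avoids \<open>0\<close> and \<open>1\<close> makes them disjoint.\<close>

lemma marked_cyl_disjoint:
  assumes "length u = length v" "u \<noteq> v" "admissible u" "admissible v" "admissible c" "cyl c \<subseteq> {0<..<1}"
  shows "cyl (u @ c) \<inter> cyl (v @ c) = {}"
  using assms
proof (induction u v rule: list_induct2)
  case (Cons i u j v)
  show ?case
  proof (cases "i = j")
    case True
    then show ?thesis using Cons by fastforce
  next
    case False
    have False if x: "x \<in> cyl ((i # u) @ c)" "x \<in> cyl ((j # v) @ c)" for x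
    proof -
      have fx: "f i x \<in> {0, 1}"
        using x False Cons.prems by (intro common_point_to_boundary[of i j]) auto
      have "f i x \<in> cyl (u @ c)" using x by simp
      then have "f i x \<in> cyl u" "fwd u (f i x) \<in> cyl c" using Cons.prems by (auto simp: cyl_append)
      then have "f i x \<in> {0<..<1}" using boundary_fwd[of u "f i x"] fx Cons.prems by auto
      then show False using fx by auto
    qed
    then show ?thesis by blast
  qed
qed simp

text \<open>Of two branches, take first the left one and then the right one: the cylinder stays to the left of
the second interval, hence away from \<open>1\<close>, and a point at \<open>0\<close> would be mapped to \<open>0\<close>, which is not
in the second interval.\<close>

lemma interior_word_exists:
  assumes "i \<in> {1..m}" "j \<in> {1..m}" "i \<noteq> j"
  shows "\<exists>c. admissible c \<and> length c = 2 \<and> cyl c \<subseteq> {0<..<1}"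
proof -
  have *: "cyl [l, r] \<subseteq> {0<..<1}" if lr: "l \<in> {1..m}" "r \<in> {1..m}" "hi l \<le> lo r" for l r
  proof
    fix x assume "x \<in> cyl [l, r]"
    then have x: "x \<in> I l" "f l x \<in> I r" by auto
    have "x \<noteq> 0"
    proof
      assume "x = 0"
      then have "f l x = 0" using boundary_fixed[OF lr(1) x(1)] by simp
      then show False using x branch_interval[OF lr(1)] branch_interval[OF lr(2)] lr(3) by auto
    qed
    then show "x \<in> {0<..<1}"
      using x branch_interval[OF lr(1)] branch_interval[OF lr(2)] lr(3) by auto
  qed
  have "hi i \<le> lo j \<or> hi j \<le> lo i"
    using non_overlapping[OF assms] branch_interval[OF assms(1)] branch_interval[OF assms(2)] by auto
  then show ?thesis
  proof
    assume "hi i \<le> lo j"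
    then show ?thesis using *[OF assms(1,2)] assms by (intro exI[of _ "[i, j]"]) auto
  next
    assume "hi j \<le> lo i"
    then show ?thesis using *[OF assms(2,1)] assms by (intro exI[of _ "[j, i]"]) auto
  qed
qed

subsection \<open>The attractor\<close>

lemma attractor_step: "x \<in> \<Lambda> \<Longrightarrow> \<exists>j\<in>{1..m}. x \<in> I j \<and> f j x \<in> \<Lambda>"
  using branch_choice unfolding branch_choice_def by blast

text \<open>A set whose points can each be continued by some branch within the set consists of points with an
infinite orbit.\<close>

lemma attractor_coinduct:
  assumes "\<And>x. x \<in> S \<Longrightarrow> \<exists>j\<in>{1..m}. x \<in> I j \<and> f j x \<in> S"
  shows "S \<subseteq> \<Lambda>"
proof
  fix x assume x: "x \<in> S"
  obtain h where h: "\<And>x. x \<in> S \<Longrightarrow> h x \<in> {1..m} \<and> x \<in> I (h x) \<and> f (h x) x \<in> S"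
    using assms by metis
  define y where "y n = ((\<lambda>x. f (h x) x) ^^ n) x" for n
  have y: "y n \<in> S" for n unfolding y_def by (induction n) (auto simp: x h)
  have "y 0 = x" "\<And>n. y (Suc n) = f (h (y n)) (y n)" unfolding y_def by auto
  then show "x \<in> \<Lambda>"
    unfolding attractor_def using h[OF y] by (intro CollectI exI[of _ y] exI[of _ "\<lambda>n. h (y n)"]) auto
qed

lemma attractor_subset: "\<Lambda> \<subseteq> {0..1}"
  using attractor_step branch_subset by blast

text \<open>The closure of the attractor inherits the continuation property of \<open>attractor_coinduct\<close>, because
there are finitely many branches, each of them continuous on a closed interval.\<close>

lemma attractor_compact: "compact \<Lambda>"
proof -
  have "closure \<Lambda> \<subseteq> \<Lambda>"
  proof (rule attractor_coinduct)
    fix x assume x: "x \<in> closure \<Lambda>"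
    let ?L = "\<lambda>j. {x \<in> I j. f j x \<in> closure \<Lambda>}"
    have "closed (\<Union>j\<in>{1..m}. ?L j)"
    proof (intro closed_UN ballI)
      fix j assume j: "j \<in> {1..m}"
      have "closed (I j \<inter> f j -` closure \<Lambda>)"
        using branch_continuous[OF j] branch_interval(1)[OF j] by (intro continuous_closed_preimage) auto
      then show "closed (?L j)" by (simp add: Int_def vimage_def)
    qed simp
    moreover have "\<Lambda> \<subseteq> (\<Union>j\<in>{1..m}. ?L j)"
      using attractor_step closure_subset[of \<Lambda>] by blast
    ultimately have "closure \<Lambda> \<subseteq> (\<Union>j\<in>{1..m}. ?L j)" by (intro closure_minimal)
    then show "\<exists>j\<in>{1..m}. x \<in> I j \<and> f j x \<in> closure \<Lambda>" using x by blast
  qed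
  then have "closed \<Lambda>" using closure_subset closure_eq by blast
  moreover have "bounded \<Lambda>" using attractor_subset bounded_subset bounded_closed_interval by blast
  ultimately show ?thesis by (simp add: compact_eq_bounded_closed)
qed

lemma branch_choice_in:
  assumes "x \<in> \<Lambda>"
  shows "\<sigma> x \<in> {1..m}" "x \<in> I (\<sigma> x)" "T x \<in> \<Lambda>"
  using branch_choice assms unfolding branch_choice_def system_map_def by auto

lemma iterate_in: "x \<in> \<Lambda> \<Longrightarrow> (T ^^ n) x \<in> \<Lambda>"
  by (induction n) (auto intro: branch_choice_in)

lemma admissible_code: "x \<in> \<Lambda> \<Longrightarrow> admissible (code T \<sigma> n x)"
  using branch_choice_in(1) iterate_in by (auto simp: code_def)

lemma in_cyl_code: "x \<in> \<Lambda> \<Longrightarrow> x \<in> cyl (code T \<sigma> n x)"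
proof (induction n arbitrary: x)
  case 0
  then show ?case using attractor_subset by (auto simp: code_def)
next
  case (Suc n)
  then show ?case using branch_choice_in[OF Suc.prems] by (auto simp: code_Suc system_map_def)
qed

text \<open>A point in all cylinders of a sequence of letters follows this sequence also under the fixed choice
of branches, provided that its orbit returns to the open unit interval again and again: a different
choice would be possible only at a common end point, after which the orbit would stay at \<open>0\<close> or \<open>1\<close>.\<close>

lemma itinerary_realized:
  assumes u: "\<And>n. u n \<in> {1..m}" and x: "\<And>n. x \<in> cyl (map u [0..<n])"
    and inner: "\<And>n. \<exists>k\<ge>n. fwd (map u [0..<k]) x \<in> {0<..<1}"
  shows "x \<in> \<Lambda>" and "\<sigma> ((T ^^ n) x) = u n" and "(T ^^ n) x = fwd (map u [0..<n]) x"
proof -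
  define y where "y n = fwd (map u [0..<n]) x" for n
  have y0: "y 0 = x" by (simp add: y_def)
  have adm: "admissible (map u [0..<n])" for n using u by auto
  have "x \<in> cyl (map u [0..<n] @ [u n])" for n using x[of "Suc n"] by simp
  then have yI: "y n \<in> I (u n)" for n using cyl_append[OF adm, of "[u n]"] u by (auto simp: y_def)
  have ySuc: "y (Suc n) = f (u n) (y n)" for n by (simp add: y_def fwd_append)
  have "y (0 + k) \<in> \<Lambda>" for k
    unfolding attractor_def using u yI ySuc
    by (intro CollectI exI[of _ "\<lambda>n. y (n + k)"] exI[of _ "\<lambda>n. u (n + k)"]) auto
  then have y\<Lambda>: "y n \<in> \<Lambda>" for n by simp
  then show "x \<in> \<Lambda>" using y0 by metis
  have boundary: "y (n + k) = y n" if "y n \<in> {0, 1}" for n k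
  proof (induction k)
    case (Suc k)
    then have "f (u (n + k)) (y (n + k)) = y (n + k)"
      using that by (intro boundary_fixed u yI) auto
    then show ?case using Suc by (simp add: ySuc)
  qed simp
  have \<sigma>y: "\<sigma> (y n) = u n" for n
  proof (rule ccontr)
    assume "\<sigma> (y n) \<noteq> u n"
    then have "y (Suc n) \<in> {0, 1}"
      unfolding ySuc using branch_choice_in[OF y\<Lambda>] yI u
      by (intro common_point_to_boundary[of _ "\<sigma> (y n)"]) auto
    moreover obtain k where "k \<ge> Suc n" "y k \<in> {0<..<1}" using inner[of "Suc n"] unfolding y_def by blast
    ultimately show False using boundary[of "Suc n" "k - Suc n"] by auto
  qed
  have "(T ^^ n) x = y n" for n
    by (induction n) (auto simp: y0 ySuc system_map_def \<sigma>y)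
  then show "\<sigma> ((T ^^ n) x) = u n" "(T ^^ n) x = fwd (map u [0..<n]) x"
    using \<sigma>y by (auto simp: y_def)
qed

lemma nested_cylinders:
  assumes u: "\<And>n. u n \<in> {1..m}"
  shows "\<exists>x. \<forall>n. x \<in> cyl (map u [0..<n])"
proof -
  have adm: "admissible (map u [0..<n])" for n using u by auto
  have "(\<Inter>n. cyl (map u [0..<n])) \<noteq> {}"
  proof (rule compact_nest)
    show "compact (cyl (map u [0..<n]))" "cyl (map u [0..<n]) \<noteq> {}" for n
      by (rule cyl_compact[OF adm], rule cyl_nonempty[OF adm])
    fix n k :: nat assume "n \<le> k"
    then have "map u [0..<k] = map u [0..<n] @ map u [n..<k]"
      by (metis le_add_diff_inverse map_append upt_add_eq_append zero_le)
    moreover have "admissible (map u [n..<k])" using u by auto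
    ultimately show "cyl (map u [0..<k]) \<subseteq> cyl (map u [0..<n])"
      using cyl_append_subset[OF adm] by metis
  qed
  then show ?thesis by blast
qed

subsection \<open>Logarithmic expansion along a word\<close>

text \<open>The supremum is taken over the cylinder of the whole remaining word, not just over \<open>I j\<close>. This makes
the bound sharp up to an error sublinear in the length (\<open>log_expansion_code_le\<close>) while keeping it
subadditive (\<open>log_expansion_append\<close>).\<close>

fun log_expansion :: "nat list \<Rightarrow> real" where
  "log_expansion [] = 0"
| "log_expansion (j # w) = (SUP x\<in>cyl (j # w). ln (d j x)) + log_expansion w"

lemma log_deriv_bounded: "\<exists>G\<ge>0. \<forall>j\<in>{1..m}. \<forall>x\<in>I j. ln (d j x) \<le> G"
proof -
  have "\<exists>G. \<forall>x\<in>I j. ln (d j x) \<le> G" if j: "j \<in> {1..m}" for j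
  proof -
    have "\<exists>p\<in>I j. \<forall>x\<in>I j. d j x \<le> d j p"
      using branch_interval[OF j] by (intro continuous_attains_sup deriv_continuous j) auto
    then obtain p where p: "p \<in> I j" "\<And>x. x \<in> I j \<Longrightarrow> d j x \<le> d j p" by blast
    then have "ln (d j x) \<le> ln (d j p)" if "x \<in> I j" for x
      using that deriv_ge_1[OF j that] deriv_ge_1[OF j p(1)] by (subst ln_le_cancel_iff) (auto intro: less_le_trans)
    then show ?thesis by blast
  qed
  then obtain G where G: "\<And>j x. \<lbrakk>j \<in> {1..m}; x \<in> I j\<rbrakk> \<Longrightarrow> ln (d j x) \<le> G j" by metis
  have "ln (d j x) \<le> Max (insert 0 (G ` {1..m}))" if "j \<in> {1..m}" "x \<in> I j" for j x
    using that by (intro order_trans[OF G[OF that] Max_ge]) auto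
  moreover have "0 \<le> Max (insert 0 (G ` {1..m}))" by (intro Max_ge) auto
  ultimately show ?thesis by blast
qed

definition G :: real where "G = (SOME G. G \<ge> 0 \<and> (\<forall>j\<in>{1..m}. \<forall>x\<in>I j. ln (d j x) \<le> G))"

lemma G: "G \<ge> 0" "\<lbrakk>j \<in> {1..m}; x \<in> I j\<rbrakk> \<Longrightarrow> ln (d j x) \<le> G"
proof -
  have "G \<ge> 0 \<and> (\<forall>j\<in>{1..m}. \<forall>x\<in>I j. ln (d j x) \<le> G)"
    unfolding G_def by (rule someI_ex) (rule log_deriv_bounded)
  then show "G \<ge> 0" "\<lbrakk>j \<in> {1..m}; x \<in> I j\<rbrakk> \<Longrightarrow> ln (d j x) \<le> G" by blast+
qed

lemma log_deriv_nonneg: "\<lbrakk>j \<in> {1..m}; x \<in> I j\<rbrakk> \<Longrightarrow> 0 \<le> ln (d j x)"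
  using deriv_ge_1 by simp

lemma log_deriv_bdd_above: "j \<in> {1..m} \<Longrightarrow> bdd_above ((\<lambda>x. ln (d j x)) ` cyl (j # w))"
  using G(2) by (intro bdd_aboveI2[of _ _ G]) auto

lemma log_deriv_le_SUP:
  "\<lbrakk>j \<in> {1..m}; x \<in> cyl (j # w)\<rbrakk> \<Longrightarrow> ln (d j x) \<le> (SUP x\<in>cyl (j # w). ln (d j x))"
  by (intro cSUP_upper log_deriv_bdd_above)

lemma SUP_log_deriv_bounds:
  assumes "admissible (j # w)"
  shows "0 \<le> (SUP x\<in>cyl (j # w). ln (d j x))" "(SUP x\<in>cyl (j # w). ln (d j x)) \<le> G"
proof -
  obtain x where x: "x \<in> cyl (j # w)" using cyl_nonempty[OF assms] by blast
  then have "0 \<le> ln (d j x)" using assms by (intro log_deriv_nonneg) auto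
  also have "\<dots> \<le> (SUP x\<in>cyl (j # w). ln (d j x))" using assms x by (intro log_deriv_le_SUP) auto
  finally show "0 \<le> (SUP x\<in>cyl (j # w). ln (d j x))" .
  show "(SUP x\<in>cyl (j # w). ln (d j x)) \<le> G"
    using cyl_nonempty[OF assms] assms by (intro cSUP_least G(2)) auto
qed

lemma log_expansion_nonneg: "admissible w \<Longrightarrow> 0 \<le> log_expansion w"
  by (induction w) (auto intro!: add_nonneg_nonneg SUP_log_deriv_bounds simp del: cyl.simps)

lemma log_expansion_le: "admissible w \<Longrightarrow> log_expansion w \<le> G * real (length w)"
proof (induction w)
  case (Cons j w)
  then show ?case using SUP_log_deriv_bounds(2)[OF Cons.prems] by (simp add: algebra_simps del: cyl.simps)
qed simp

lemma log_expansion_append: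
  "\<lbrakk>admissible u; admissible v\<rbrakk> \<Longrightarrow> log_expansion (u @ v) \<le> log_expansion u + log_expansion v"
proof (induction u)
  case (Cons j u)
  have "(SUP x\<in>cyl (j # (u @ v)). ln (d j x)) \<le> (SUP x\<in>cyl (j # u). ln (d j x))"
    using Cons.prems cyl_append_subset[of "j # u" v] cyl_nonempty[of "j # u @ v"]
    by (intro cSUP_subset_mono log_deriv_bdd_above) auto
  moreover have "log_expansion (u @ v) \<le> log_expansion u + log_expansion v" using Cons by auto
  ultimately show ?case by (simp del: cyl.simps)
qed simp

text \<open>The mean value theorem, one letter at a time. The intermediate point stays in the cylinder because
cylinders are intervals.\<close>

lemma expansion_bound:
  "\<lbrakk>admissible w; x \<in> cyl w; y \<in> cyl w\<rbrakk> \<Longrightarrow> \<bar>fwd w x - fwd w y\<bar> \<le> exp (log_expansion w) * \<bar>x - y\<bar>"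
proof (induction w arbitrary: x y)
  case (Cons j w)
  let ?S = "SUP x\<in>cyl (j # w). ln (d j x)"
  have j: "j \<in> {1..m}" using Cons.prems by auto
  have one_step: "\<bar>f j x - f j y\<bar> \<le> exp ?S * \<bar>x - y\<bar>"
    if xy: "x \<in> cyl (j # w)" "y \<in> cyl (j # w)" "x < y" for x y
  proof -
    have "x \<in> I j" "y \<in> I j" using xy by auto
    then obtain z where z: "z \<in> {x<..<y}" "z \<in> I j" "f j y - f j x = d j z * (y - x)"
      using mean_value[OF j _ _ xy(3)] by blast
    have "z \<in> cyl (j # w)"
      using z xy by (intro cyl_interval[OF Cons.prems(1) xy(1,2)]) auto
    then have "ln (d j z) \<le> ?S" by (intro log_deriv_le_SUP j)
    moreover have "d j z > 0" using deriv_ge_1[OF j z(2)] by simp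
    ultimately have "d j z \<le> exp ?S" by (metis exp_le_cancel_iff exp_ln)
    then have "d j z * (y - x) \<le> exp ?S * (y - x)" using xy by (intro mult_right_mono) auto
    moreover have "f j x \<le> f j y" using branch_mono[OF j] xy by auto
    ultimately show ?thesis using z(3) xy(3) by auto
  qed
  have "\<bar>f j x - f j y\<bar> \<le> exp ?S * \<bar>x - y\<bar>"
    using one_step[of x y] one_step[of y x] Cons.prems(2,3)
    by (cases x y rule: linorder_cases) (auto simp: abs_minus_commute)
  then have "exp (log_expansion w) * \<bar>f j x - f j y\<bar> \<le> exp (log_expansion w) * (exp ?S * \<bar>x - y\<bar>)"
    by (intro mult_left_mono) auto
  then have "exp (log_expansion w) * \<bar>f j x - f j y\<bar> \<le> exp (?S + log_expansion w) * \<bar>x - y\<bar>"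
    by (simp only: exp_add mult_ac)
  moreover have "\<bar>fwd w (f j x) - fwd w (f j y)\<bar> \<le> exp (log_expansion w) * \<bar>f j x - f j y\<bar>"
    using Cons by auto
  ultimately show ?case unfolding fwd.simps log_expansion.simps by (rule order_trans[rotated])
qed simp

text \<open>Long cylinders are short, so by uniform continuity of \<open>ln (d j)\<close> the supremum over the cylinder of
the remaining word exceeds the value at the point by at most \<open>\<eta>\<close>, except for the last \<open>M\<close> letters,
which contribute at most \<open>G\<close> each.\<close>

lemma log_expansion_code_le:
  assumes "\<eta> > 0"
  shows "\<exists>B. \<forall>n. \<forall>x\<in>\<Lambda>. log_expansion (code T \<sigma> n x)
      \<le> (\<Sum>i<n. ln (system_deriv I f \<sigma> ((T ^^ i) x))) + \<eta> * real n + B"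
proof -
  have "\<exists>e>0. \<forall>x\<in>I j. \<forall>y\<in>I j. \<bar>x - y\<bar> < e \<longrightarrow> ln (d j x) \<le> ln (d j y) + \<eta>" if j: "j \<in> {1..m}" for j
  proof -
    have "uniformly_continuous_on (I j) (\<lambda>x. ln (d j x))"
      using deriv_ge_1[OF j] branch_interval(1)[OF j]
      by (intro compact_uniformly_continuous continuous_on_ln deriv_continuous j) (auto, fastforce)
    then obtain e where "e > 0" "\<And>x y. \<lbrakk>x \<in> I j; y \<in> I j; dist y x < e\<rbrakk> \<Longrightarrow> dist (ln (d j y)) (ln (d j x)) < \<eta>"
      unfolding uniformly_continuous_on_def using assms by metis
    then show ?thesis
      by (intro exI[of _ e]) (force simp: dist_real_def)
  qed
  then obtain e where e: "\<And>j. j \<in> {1..m} \<Longrightarrow> e j > 0"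
    "\<And>j x y. \<lbrakk>j \<in> {1..m}; x \<in> I j; y \<in> I j; \<bar>x - y\<bar> < e j\<rbrakk> \<Longrightarrow> ln (d j x) \<le> ln (d j y) + \<eta>"
    by metis
  define e0 where "e0 = Min (insert 1 (e ` {1..m}))"
  have e0: "e0 > 0" "\<And>j. j \<in> {1..m} \<Longrightarrow> e0 \<le> e j"
  proof -
    show "e0 > 0" unfolding e0_def using e(1) by (subst Min_gr_iff) auto
    show "e0 \<le> e j" if "j \<in> {1..m}" for j unfolding e0_def using that by (intro Min_le) auto
  qed
  obtain M where M: "\<And>w x y. \<lbrakk>admissible w; M \<le> length w; x \<in> cyl w; y \<in> cyl w\<rbrakk> \<Longrightarrow> \<bar>x - y\<bar> < e0"
    using cyl_small[OF e0(1)] by blast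
  have "log_expansion (code T \<sigma> n x)
      \<le> (\<Sum>i<n. ln (system_deriv I f \<sigma> ((T ^^ i) x))) + \<eta> * real n + G * real (min n M)"
    if "x \<in> \<Lambda>" for n x
    using that
  proof (induction n arbitrary: x)
    case (Suc n)
    let ?w = "code T \<sigma> n (T x)"
    let ?S = "SUP y\<in>cyl (\<sigma> x # ?w). ln (d (\<sigma> x) y)"
    have \<sigma>: "\<sigma> x \<in> {1..m}" "x \<in> I (\<sigma> x)" using branch_choice_in[OF Suc.prems] by auto
    have adm: "admissible (\<sigma> x # ?w)" using admissible_code[OF Suc.prems, of "Suc n"] by (simp add: code_Suc)
    have x: "x \<in> cyl (\<sigma> x # ?w)" using in_cyl_code[OF Suc.prems, of "Suc n"] by (simp only: code_Suc)
    have "?S \<le> ln (d (\<sigma> x) x) + \<eta> + G * real (min (Suc n) M) - G * real (min n M)"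
    proof (cases "M \<le> Suc n")
      case True
      have "ln (d (\<sigma> x) y) \<le> ln (d (\<sigma> x) x) + \<eta>" if y: "y \<in> cyl (\<sigma> x # ?w)" for y
        using M[OF adm _ y x] True e0(2)[OF \<sigma>(1)] y \<sigma> by (intro e(2)) auto
      then have "?S \<le> ln (d (\<sigma> x) x) + \<eta>" using x by (intro cSUP_least) auto
      moreover have "G * real (min n M) \<le> G * real (min (Suc n) M)" using G(1) by (intro mult_left_mono) auto
      ultimately show ?thesis by linarith
    next
      case False
      have "?S \<le> G" by (rule SUP_log_deriv_bounds(2)[OF adm])
      moreover have "0 \<le> ln (d (\<sigma> x) x)" by (rule log_deriv_nonneg[OF \<sigma>])
      moreover have "G * real (min (Suc n) M) = G + G * real (min n M)"
        using False by (simp add: min_def algebra_simps)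
      ultimately show ?thesis using assms by linarith
    qed
    moreover have "log_expansion ?w \<le> (\<Sum>i<n. ln (system_deriv I f \<sigma> ((T ^^ i) (T x)))) + \<eta> * real n + G * real (min n M)"
      by (intro Suc.IH branch_choice_in(3) Suc.prems)
    moreover have "(\<Sum>i<Suc n. ln (system_deriv I f \<sigma> ((T ^^ i) x)))
        = ln (d (\<sigma> x) x) + (\<Sum>i<n. ln (system_deriv I f \<sigma> ((T ^^ i) (T x))))"
      unfolding sum.lessThan_Suc_shift by (simp add: funpow_swap1 system_deriv_def)
    ultimately show ?case unfolding code_Suc log_expansion.simps by (simp add: algebra_simps del: cyl.simps)
  qed (simp add: code_def)
  moreover have "G * real (min n M) \<le> G * real M" for n using G(1) by (intro mult_left_mono) auto
  ultimately show ?thesis by (intro exI[of _ "G * real M"]) (meson add_left_mono order_trans)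
qed

end

section \<open>Entropy bounds the partition function\<close>

context expanding_system
begin

lemma invariant_measure_facts:
  assumes "\<nu> \<in> invariant_measures \<Lambda> T"
  shows "measure_preserving \<nu> T" "space \<nu> = \<Lambda>" "sets \<nu> = sets (restrict_space borel \<Lambda>)"
  using assms unfolding invariant_measures_def measure_preserving_def measure_preserving_axioms_def
  by auto

lemma sets_invariant_measure:
  assumes "\<nu> \<in> invariant_measures \<Lambda> T"
  shows "A \<in> sets \<nu> \<longleftrightarrow> A \<subseteq> \<Lambda> \<and> A \<in> sets borel"
  unfolding invariant_measure_facts(3)[OF assms]
  using attractor_compact by (intro sets_restrict_space_iff) (auto simp: borel_compact)

text \<open>Away from the end points of \<open>I j\<close>, choosing branch \<open>j\<close> means lying in \<open>I j\<close>; the arbitrary choices at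
the two end points do not affect measurability.\<close>

lemma branch_labelled_system:
  assumes \<nu>: "\<nu> \<in> invariant_measures \<Lambda> T"
  shows "labelled_system \<nu> T {1..m} \<sigma>"
proof -
  interpret measure_preserving \<nu> T by (rule invariant_measure_facts[OF \<nu>])
  show ?thesis
  proof
    show "\<sigma> \<in> measurable \<nu> (count_space {1..m})"
    proof (subst measurable_count_space_eq2)
      have "\<sigma> -` {j} \<inter> \<Lambda> \<in> sets \<nu>" if j: "j \<in> {1..m}" for j
      proof -
        have inner: "\<sigma> x = j" if "x \<in> \<Lambda>" "lo j < x" "x < hi j" for x
        proof (rule ccontr)
          assume "\<sigma> x \<noteq> j"
          then have "min (hi (\<sigma> x)) (hi j) \<le> max (lo (\<sigma> x)) (lo j)"
            using branch_choice_in(1)[OF that(1)] j by (intro non_overlapping) auto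
          moreover have "lo (\<sigma> x) \<le> x" "x \<le> hi (\<sigma> x)"
            using branch_choice_in(1,2)[OF that(1)] branch_interval(1)[of "\<sigma> x"] by auto
          ultimately show False
            using that branch_interval(2)[OF branch_choice_in(1)[OF that(1)]] branch_interval(2)[OF j]
            by (auto simp: min_def max_def split: if_splits)
        qed
        have bounds: "lo j \<le> x \<and> x \<le> hi j" if "x \<in> \<Lambda>" "\<sigma> x = j" for x
          using branch_choice_in(2)[OF that(1)] branch_interval(1)[OF j] that(2) by auto
        have "\<sigma> -` {j} \<inter> \<Lambda> = (\<Lambda> \<inter> {lo j<..<hi j}) \<union> (\<sigma> -` {j} \<inter> \<Lambda> \<inter> {lo j, hi j})"
        proof (intro equalityI subsetI)
          fix x assume x: "x \<in> \<sigma> -` {j} \<inter> \<Lambda>"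
          then have "lo j \<le> x \<and> x \<le> hi j" using bounds by blast
          then show "x \<in> (\<Lambda> \<inter> {lo j<..<hi j}) \<union> (\<sigma> -` {j} \<inter> \<Lambda> \<inter> {lo j, hi j})"
            using x by (cases "x = lo j \<or> x = hi j") (blast, simp)
        next
          fix x assume "x \<in> (\<Lambda> \<inter> {lo j<..<hi j}) \<union> (\<sigma> -` {j} \<inter> \<Lambda> \<inter> {lo j, hi j})"
          then show "x \<in> \<sigma> -` {j} \<inter> \<Lambda>" using inner[of x] by (elim UnE) simp_all
        qed
        moreover have "\<sigma> -` {j} \<inter> \<Lambda> \<inter> {lo j, hi j} \<in> sets borel"
          by (rule sets.countable) (auto intro: countable_finite)
        moreover have "\<Lambda> \<inter> {lo j<..<hi j} \<in> sets borel"
          using attractor_compact by (auto simp: borel_compact)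
        ultimately have "\<sigma> -` {j} \<inter> \<Lambda> \<in> sets borel" by (metis sets.Un)
        then show ?thesis by (simp add: sets_invariant_measure[OF \<nu>])
      qed
      then show "\<sigma> \<in> space \<nu> \<rightarrow> {1..m} \<and> (\<forall>j\<in>{1..m}. \<sigma> -` {j} \<inter> space \<nu> \<in> sets \<nu>)"
        using branch_choice_in(1) unfolding invariant_measure_facts(2)[OF \<nu>] by blast
    qed simp
  qed simp
qed

lemma compact_approximation:
  assumes \<nu>: "\<nu> \<in> invariant_measures \<Lambda> T" and A: "A \<in> sets \<nu>" and \<delta>: "\<delta> > 0"
  shows "\<exists>K\<subseteq>A. compact K \<and> measure \<nu> (A - K) < \<delta>"
proof -
  interpret measure_preserving \<nu> T by (rule invariant_measure_facts[OF \<nu>])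
  define N where "N = distr \<nu> borel (\<lambda>x. x)"
  have id: "(\<lambda>x. x) \<in> measurable \<nu> borel"
    using sets_invariant_measure[OF \<nu>] invariant_measure_facts(2)[OF \<nu>]
      attractor_compact by (intro measurableI) (auto simp: vimage_def borel_compact intro!: sets.Int)
  interpret N: prob_space N unfolding N_def by (rule prob_space_distr[OF id])
  have N: "measure N B = measure \<nu> B" if "B \<in> sets \<nu>" for B
  proof -
    have "B \<in> sets borel" "B \<inter> space \<nu> = B"
      using that sets_invariant_measure[OF \<nu>] invariant_measure_facts(2)[OF \<nu>] by auto
    then show ?thesis unfolding N_def by (subst measure_distr[OF id]) (auto simp: vimage_def Int_def)
  qed
  have "A \<in> sets borel" using A sets_invariant_measure[OF \<nu>] by auto
  then have "emeasure N A = (SUP K\<in>{K. K \<subseteq> A \<and> compact K}. emeasure N K)"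
    by (intro inner_regular) (auto simp: N_def N.emeasure_finite[unfolded N_def])
  moreover have "measure N A < \<delta> \<or> ennreal (measure N A - \<delta>) < emeasure N A"
    using \<delta> by (cases "measure N A < \<delta>") (simp_all add: N.emeasure_eq_measure ennreal_less_iff)
  ultimately consider "measure N A < \<delta>" | K where "K \<subseteq> A" "compact K" "ennreal (measure N A - \<delta>) < emeasure N K"
    by (metis (mono_tags, lifting) less_SUP_iff mem_Collect_eq)
  then show ?thesis
  proof cases
    case 1
    then show ?thesis using N[OF A] by (intro exI[of _ "{}"]) auto
  next
    case (2 K)
    have K: "K \<in> sets \<nu>"
      using 2 A sets_invariant_measure[OF \<nu>] by (auto simp: borel_compact)
    have "measure N A - \<delta> < measure N K"
    proof (cases "measure N A - \<delta> \<ge> 0")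
      case True
      then show ?thesis using 2(3) by (simp add: N.emeasure_eq_measure ennreal_less_iff)
    next
      case False
      then show ?thesis using measure_nonneg[of N K] by linarith
    qed
    then have "measure \<nu> (A - K) < \<delta>"
      using 2(1) by (simp add: finite_measure_Diff[OF A K] N[OF A] N[OF K])
    then show ?thesis using 2 by blast
  qed
qed

text \<open>Approximate the elements of the partition from inside by compact sets. These have positive distance
from one another, so a sufficiently short cylinder meets at most one of them, and this one is the
prediction \<open>dec\<close>.\<close>

lemma cylinders_determine_partition:
  assumes \<nu>: "\<nu> \<in> invariant_measures \<Lambda> T"
    and fin: "finite P" and P: "P \<subseteq> sets \<nu>" and part: "partition_on \<Lambda> P"
    and lab: "\<And>x A. \<lbrakk>x \<in> \<Lambda>; A \<in> P\<rbrakk> \<Longrightarrow> lab x = A \<longleftrightarrow> x \<in> A"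
    and \<delta>: "\<delta> > 0"
  shows "\<exists>M dec. (\<forall>w. dec w \<in> P) \<and> (\<exists>E\<in>sets \<nu>. measure \<nu> E \<le> \<delta> \<and>
      (\<forall>x\<in>\<Lambda> - E. dec (code T \<sigma> M x) = lab x))"
proof -
  interpret measure_preserving \<nu> T by (rule invariant_measure_facts[OF \<nu>])
  have "P \<noteq> {}" using partition_onD1[OF part] not_empty invariant_measure_facts(2)[OF \<nu>] by auto
  then have card: "card P > 0" using fin by (simp add: card_gt_0_iff)
  have "\<exists>K\<subseteq>A. compact K \<and> measure \<nu> (A - K) < \<delta> / card P" if "A \<in> P" for A
    using that P card \<delta> by (intro compact_approximation[OF \<nu>]) auto
  then obtain K where K: "\<And>A. A \<in> P \<Longrightarrow> K A \<subseteq> A" "\<And>A. A \<in> P \<Longrightarrow> compact (K A)"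
    "\<And>A. A \<in> P \<Longrightarrow> measure \<nu> (A - K A) < \<delta> / card P" by metis
  have "\<exists>e>0. A \<noteq> B \<longrightarrow> (\<forall>x\<in>K A. \<forall>y\<in>K B. e \<le> dist x y)" if "A \<in> P" "B \<in> P" for A B
  proof (cases "A = B")
    case False
    then have "K A \<inter> K B = {}"
      using disjointD[OF partition_onD2[OF part] that] K(1)[OF that(1)] K(1)[OF that(2)] by blast
    then show ?thesis
      using separate_compact_closed[OF K(2)[OF that(1)] compact_imp_closed[OF K(2)[OF that(2)]]] by blast
  qed (auto intro: exI[of _ 1])
  then obtain e where e: "\<And>A B. \<lbrakk>A \<in> P; B \<in> P\<rbrakk> \<Longrightarrow> e A B > 0"
    "\<And>A B x y. \<lbrakk>A \<in> P; B \<in> P; A \<noteq> B; x \<in> K A; y \<in> K B\<rbrakk> \<Longrightarrow> e A B \<le> dist x y" by metis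
  define e0 where "e0 = Min (insert 1 ((\<lambda>(A, B). e A B) ` (P \<times> P)))"
  have e0: "e0 > 0" unfolding e0_def using e(1) fin by (subst Min_gr_iff) auto
  have e0_le: "e0 \<le> e A B" if "A \<in> P" "B \<in> P" for A B
    unfolding e0_def using that fin by (intro Min_le) auto
  obtain M where M: "\<And>w x y. \<lbrakk>admissible w; M \<le> length w; x \<in> cyl w; y \<in> cyl w\<rbrakk> \<Longrightarrow> \<bar>x - y\<bar> < e0"
    using cyl_small[OF e0] by blast
  obtain A0 where A0: "A0 \<in> P" using \<open>P \<noteq> {}\<close> by blast
  define dec where "dec w = (if \<exists>A\<in>P. K A \<inter> cyl w \<noteq> {} then SOME A. A \<in> P \<and> K A \<inter> cyl w \<noteq> {} else A0)" for w
  have dec_ex: "dec w \<in> P \<and> K (dec w) \<inter> cyl w \<noteq> {}" if "\<exists>A\<in>P. K A \<inter> cyl w \<noteq> {}" for w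
    unfolding dec_def if_P[OF that] by (rule someI_ex) (use that in blast)
  have "dec w \<in> P" for w
    using dec_ex A0 by (cases "\<exists>A\<in>P. K A \<inter> cyl w \<noteq> {}") (auto simp: dec_def)
  moreover define E where "E = (\<Union>A\<in>P. A - K A)"
  have AK: "A - K A \<in> sets \<nu>" if "A \<in> P" for A
    using that P K(1,2)[OF that] sets_invariant_measure[OF \<nu>] by (intro sets.Diff) (auto simp: borel_compact)
  have "E \<in> sets \<nu>" unfolding E_def using AK fin by (intro sets.finite_UN) auto
  moreover have "measure \<nu> E \<le> \<delta>"
  proof -
    have "measure \<nu> E \<le> (\<Sum>A\<in>P. measure \<nu> (A - K A))"
      unfolding E_def using AK by (intro finite_measure_subadditive_finite fin) auto
    also have "\<dots> \<le> (\<Sum>A\<in>P. \<delta> / card P)" using K(3) by (intro sum_mono) (auto intro: less_imp_le)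
    also have "\<dots> = \<delta>" using card by simp
    finally show ?thesis .
  qed
  moreover have "dec (code T \<sigma> M x) = lab x" if x: "x \<in> \<Lambda> - E" for x
  proof -
    let ?w = "code T \<sigma> M x"
    have adm: "admissible ?w" and xw: "x \<in> cyl ?w" using admissible_code in_cyl_code x by auto
    obtain A where A: "A \<in> P" "x \<in> A" using partition_onD1[OF part] x by auto
    then have xK: "x \<in> K A" using x unfolding E_def by auto
    then obtain y where y: "dec ?w \<in> P" "y \<in> K (dec ?w)" "y \<in> cyl ?w"
      using dec_ex[of ?w] A xw by blast
    have "dec ?w = A"
    proof (rule ccontr)
      assume "dec ?w \<noteq> A"
      then have "e0 \<le> dist y x"
        using e(2)[OF y(1) A(1) _ y(2) xK] e0_le[OF y(1) A(1)] by auto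
      then show False using M[OF adm _ y(3) xw] by (auto simp: dist_real_def)
    qed
    then show ?thesis using lab[of x A] x A by auto
  qed
  ultimately show ?thesis by blast
qed

text \<open>The partition function of the potential \<open>- s ln \<bar>T'\<bar>\<close>, with suprema over cylinders in the place of
values.\<close>

definition partition_function :: "real \<Rightarrow> nat \<Rightarrow> real" where
  "partition_function s n = (\<Sum>w\<in>words {1..m} n. exp (- s * log_expansion w))"

lemma words_nonempty: "words {1..m} n \<noteq> {}"
proof -
  have "1 \<in> {1..m}" using system_conditions by auto
  then have "replicate n 1 \<in> words {1..m} n" by (auto simp: words_def)
  then show ?thesis by blast
qed

lemma partition_function_pos: "partition_function s n > 0"
  unfolding partition_function_def
  by (intro sum_pos finite_words words_nonempty) auto

text \<open>Gibbs' inequality for the following law on itineraries \<open>xs\<close> with respect to \<open>P\<close>: draw a word \<open>w\<close> of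
branches of length \<open>n + M\<close> with probability proportional to \<open>exp (- s log_expansion w)\<close>; then, at each
time \<open>i\<close>, take the element of \<open>P\<close> that the window of length \<open>M\<close> of \<open>w\<close> at \<open>i\<close> predicts, with
probability \<open>1 - \<epsilon>\<close>, and otherwise one that is chosen uniformly. To bound \<open>q\<close> from below at the
itinerary of a point, it suffices to keep the term of the branch itinerary of that point.\<close>

lemma entropy_le_partition_function:
  assumes \<nu>: "\<nu> \<in> invariant_measures \<Lambda> T"
    and fin: "finite P" and P: "P \<subseteq> sets \<nu>" and part: "partition_on \<Lambda> P"
    and lyap: "lyapunov_exponent (system_deriv I f \<sigma>) \<nu> > 0"
    and s: "0 \<le> s" and \<eta>: "0 < \<eta>"
  shows "\<exists>M B. \<forall>n. partition_entropy \<nu> (iterated_join \<nu> T P n)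
      \<le> ln (partition_function s (n + M)) + real n * \<eta>
        + s * (real (n + M) * (lyapunov_exponent (system_deriv I f \<sigma>) \<nu> + \<eta>) + B)"
proof -
  note sp = invariant_measure_facts(2)[OF \<nu>]
  have mp: "measure_preserving \<nu> T" by (rule invariant_measure_facts[OF \<nu>])
  define lab where "lab = (\<lambda>x. THE A. A \<in> P \<and> x \<in> A)"
  have part': "partition_on (space \<nu>) P" using part sp by simp
  interpret P: labelled_system \<nu> T P lab
    unfolding lab_def by (rule partition_labelled_system[OF mp fin P part'])
  interpret S: labelled_system \<nu> T "{1..m}" \<sigma>
    by (rule branch_labelled_system[OF \<nu>])
  have lab: "lab x = A \<longleftrightarrow> x \<in> A" if "x \<in> \<Lambda>" "A \<in> P" for x A
    unfolding lab_def by (rule the_partition_element_eq_iff[OF part that])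
  define c where "c = real (card P)"
  have "P \<noteq> {}" using partition_onD1[OF part] P.not_empty sp by auto
  then have c: "c \<ge> 1" using fin unfolding c_def by (simp add: Suc_leI card_gt_0_iff)
  \<comment> \<open>A correct prediction costs \<open>\<eta>/2\<close>; a wrong one costs \<open>b\<close>, but happens with probability at most
    \<open>\<eta>/(2(b+1))\<close>.\<close>
  define \<epsilon> where "\<epsilon> = 1 - exp (- \<eta> / 2)"
  have \<epsilon>: "0 < \<epsilon>" "\<epsilon> < 1" and ln\<epsilon>: "- ln (1 - \<epsilon>) = \<eta> / 2" using \<eta> unfolding \<epsilon>_def by auto
  define b where "b = ln (c / \<epsilon>)"
  have "c / \<epsilon> \<ge> 1" using c \<epsilon> by (simp add: field_simps)
  then have b: "b \<ge> 0" unfolding b_def by simp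
  have "\<eta> / (2 * (b + 1)) > 0" using \<eta> b by auto
  then obtain M dec E where dec: "\<And>w. dec w \<in> P" and E: "E \<in> sets \<nu>" "measure \<nu> E \<le> \<eta> / (2 * (b + 1))"
    and decE: "\<And>x. x \<in> \<Lambda> - E \<Longrightarrow> dec (code T \<sigma> M x) = lab x"
    using cylinders_determine_partition[OF \<nu> fin P part lab, of "\<eta> / (2 * (b + 1))"] by blast
  define \<kappa> where "\<kappa> w A = (if A = dec w then 1 - \<epsilon> else \<epsilon> / c)" for w A
  have \<kappa>_pos: "\<kappa> w A > 0" for w A unfolding \<kappa>_def using \<epsilon> c by auto
  have \<kappa>_sum: "(\<Sum>A\<in>P. \<kappa> w A) \<le> 1" for w
  proof -
    have "(\<Sum>A\<in>P. \<kappa> w A) \<le> (\<Sum>A\<in>P. (if A = dec w then 1 - \<epsilon> else 0) + \<epsilon> / c)"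
      unfolding \<kappa>_def using \<epsilon> c by (intro sum_mono) auto
    also have "\<dots> = 1" using dec[of w] fin \<open>P \<noteq> {}\<close> by (simp add: sum.distrib c_def)
    finally show ?thesis .
  qed
  obtain B where B: "\<And>n x. x \<in> \<Lambda> \<Longrightarrow> log_expansion (code T \<sigma> n x)
      \<le> (\<Sum>i<n. ln (system_deriv I f \<sigma> ((T ^^ i) x))) + \<eta> * real n + B"
    using log_expansion_code_le[OF \<eta>] by blast
  let ?ly = "lyapunov_exponent (system_deriv I f \<sigma>) \<nu>"
  let ?l = "\<lambda>x. ln \<bar>system_deriv I f \<sigma> x\<bar>"
  \<comment> \<open>The integral of a function that is not integrable is \<open>0\<close> by convention, so a positive exponent
    entails integrability.\<close>
  have int_l: "integrable \<nu> ?l"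
    using lyap not_integrable_integral_eq unfolding lyapunov_exponent_def by fastforce
  have pos_deriv: "\<bar>system_deriv I f \<sigma> x\<bar> = system_deriv I f \<sigma> x" if "x \<in> \<Lambda>" for x
    using deriv_ge_1[OF branch_choice_in(1,2)[OF that]] by (simp add: system_deriv_def)
  have expansion_integral: "(\<integral>x. log_expansion (code T \<sigma> n x) \<partial>\<nu>) \<le> real n * (?ly + \<eta>) + B" for n
  proof -
    have int: "integrable \<nu> (\<lambda>x. (\<Sum>i<n. ?l ((T ^^ i) x)))"
      by (intro Bochner_Integration.integrable_sum P.integrable_iterate int_l)
    have "(\<integral>x. log_expansion (code T \<sigma> n x) \<partial>\<nu>) \<le> (\<integral>x. (\<Sum>i<n. ?l ((T ^^ i) x)) + (\<eta> * real n + B) \<partial>\<nu>)"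
    proof (intro integral_mono S.integrable_code Bochner_Integration.integrable_add int)
      fix x assume "x \<in> space \<nu>"
      then have x: "x \<in> \<Lambda>" by (simp add: sp)
      show "log_expansion (code T \<sigma> n x) \<le> (\<Sum>i<n. ?l ((T ^^ i) x)) + (\<eta> * real n + B)"
        using B[OF x, of n] by (simp add: pos_deriv iterate_in[OF x] add.assoc)
    qed
    also have "\<dots> = (\<integral>x. (\<Sum>i<n. ?l ((T ^^ i) x)) \<partial>\<nu>) + (\<eta> * real n + B)"
      using int by (simp add: P.prob_space)
    also have "(\<integral>x. (\<Sum>i<n. ?l ((T ^^ i) x)) \<partial>\<nu>) = (\<Sum>i<n. \<integral>x. ?l ((T ^^ i) x) \<partial>\<nu>)"
      by (intro Bochner_Integration.integral_sum P.integrable_iterate int_l)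
    also have "\<dots> = real n * ?ly"
      using P.integral_iterate[OF borel_measurable_integrable[OF int_l]]
      by (simp add: lyapunov_exponent_def)
    finally show ?thesis by (simp add: algebra_simps)
  qed
  have bound: "partition_entropy \<nu> (iterated_join \<nu> T P n)
      \<le> ln (partition_function s (n + M)) + real n * \<eta> + s * (real (n + M) * (?ly + \<eta>) + B)" for n
  proof -
    let ?Z = "partition_function s (n + M)"
    let ?W = "words {1..m} (n + M)"
    define q where "q xs = (\<Sum>w\<in>?W. exp (- s * log_expansion w) / ?Z * (\<Prod>i<n. \<kappa> (take M (drop i w)) (xs ! i)))" for xs
    have Z: "?Z > 0" by (rule partition_function_pos)
    have term_pos: "exp (- s * log_expansion w) / ?Z * (\<Prod>i<n. \<kappa> (take M (drop i w)) (xs ! i)) > 0" for w xs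
      using Z \<kappa>_pos by (intro mult_pos_pos prod_pos divide_pos_pos) auto
    have q_pos: "q xs > 0" for xs
      unfolding q_def by (intro sum_pos finite_words words_nonempty term_pos) auto
    have "(\<Sum>xs\<in>words P n. q xs)
        = (\<Sum>w\<in>?W. exp (- s * log_expansion w) / ?Z * (\<Sum>xs\<in>words P n. \<Prod>i<n. \<kappa> (take M (drop i w)) (xs ! i)))"
      unfolding q_def by (subst sum.swap) (simp add: sum_distrib_left)
    also have "\<dots> \<le> (\<Sum>w\<in>?W. exp (- s * log_expansion w) / ?Z * 1)"
    proof (intro sum_mono mult_left_mono)
      fix w
      have "(\<Sum>xs\<in>words P n. \<Prod>i<n. \<kappa> (take M (drop i w)) (xs ! i)) = (\<Prod>i<n. \<Sum>A\<in>P. \<kappa> (take M (drop i w)) A)"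
        by (rule sum_words_prod)
      also have "\<dots> \<le> 1"
        using \<kappa>_sum less_imp_le[OF \<kappa>_pos] by (intro prod_le_1) (auto intro!: sum_nonneg)
      finally show "(\<Sum>xs\<in>words P n. \<Prod>i<n. \<kappa> (take M (drop i w)) (xs ! i)) \<le> 1" .
    qed (use Z in auto)
    also have "\<dots> = 1" using Z by (simp add: partition_function_def flip: sum_divide_distrib)
    finally have q_sum: "(\<Sum>xs\<in>words P n. q xs) \<le> 1" .
    let ?h = "\<lambda>x. \<eta> / 2 + b * indicator E x"
    have int_h: "integrable \<nu> ?h"
      using E(1) by (intro Bochner_Integration.integrable_add integrable_mult_right integrable_real_indicator)
        (auto simp: less_top[symmetric])
    have int_sum: "integrable \<nu> (\<lambda>x. \<Sum>i<n. ?h ((T ^^ i) x))"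
      by (rule Bochner_Integration.integrable_sum) (rule P.integrable_iterate[OF int_h])
    have int_exp: "integrable \<nu> (\<lambda>x. s * log_expansion (code T \<sigma> (n + M) x) + ln ?Z)"
      by (rule S.integrable_code[of "\<lambda>w. s * log_expansion w + ln ?Z"])
    have pointwise: "- ln (q (code T lab n x)) \<le> (\<Sum>i<n. ?h ((T ^^ i) x)) + (s * log_expansion (code T \<sigma> (n + M) x) + ln ?Z)"
      if "x \<in> space \<nu>" for x
    proof -
      let ?w = "code T \<sigma> (n + M) x"
      have block: "take M (drop i ?w) = code T \<sigma> M ((T ^^ i) x)" if "i < n" for i
        using that by (simp add: drop_code take_code)
      have step: "- ln (\<kappa> (code T \<sigma> M y) (lab y)) \<le> ?h y" if "y \<in> \<Lambda>" for y
      proof (cases "dec (code T \<sigma> M y) = lab y")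
        case True
        then show ?thesis using ln\<epsilon> b by (simp add: \<kappa>_def indicator_def)
      next
        case False
        then have "y \<in> E" using decE[of y] that by auto
        moreover have "- ln (\<epsilon> / c) = b" unfolding b_def using \<epsilon> c by (simp add: ln_div)
        ultimately show ?thesis using False \<eta> by (simp add: \<kappa>_def)
      qed
      have "exp (- s * log_expansion ?w) / ?Z * (\<Prod>i<n. \<kappa> (take M (drop i ?w)) (code T lab n x ! i)) \<le> q (code T lab n x)"
        unfolding q_def using S.code_in_words[OF that]
        by (intro member_le_sum finite_words less_imp_le[OF term_pos]) auto
      then have "ln (exp (- s * log_expansion ?w) / ?Z * (\<Prod>i<n. \<kappa> (take M (drop i ?w)) (code T lab n x ! i))) \<le> ln (q (code T lab n x))"
        by (subst ln_le_cancel_iff[OF term_pos q_pos])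
      also have "ln (exp (- s * log_expansion ?w) / ?Z * (\<Prod>i<n. \<kappa> (take M (drop i ?w)) (code T lab n x ! i)))
          = - s * log_expansion ?w - ln ?Z + (\<Sum>i<n. ln (\<kappa> (take M (drop i ?w)) (code T lab n x ! i)))"
        using Z \<kappa>_pos prod_pos[of "{..<n}" "\<lambda>i. \<kappa> (take M (drop i ?w)) (code T lab n x ! i)"]
        by (simp add: ln_mult ln_div ln_prod less_imp_neq[symmetric])
      also have "(\<Sum>i<n. ln (\<kappa> (take M (drop i ?w)) (code T lab n x ! i)))
          = (\<Sum>i<n. ln (\<kappa> (code T \<sigma> M ((T ^^ i) x)) (lab ((T ^^ i) x))))"
        using block by (intro sum.cong) auto
      finally have "- ln (q (code T lab n x)) \<le> (\<Sum>i<n. - ln (\<kappa> (code T \<sigma> M ((T ^^ i) x)) (lab ((T ^^ i) x))))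
          + (s * log_expansion ?w + ln ?Z)"
        by (simp add: sum_negf)
      also have "(\<Sum>i<n. - ln (\<kappa> (code T \<sigma> M ((T ^^ i) x)) (lab ((T ^^ i) x)))) \<le> (\<Sum>i<n. ?h ((T ^^ i) x))"
        using that sp by (intro sum_mono step iterate_in) auto
      finally show ?thesis by simp
    qed
    have "partition_entropy \<nu> (iterated_join \<nu> T P n) = P.word_entropy n"
      unfolding lab_def by (rule partition_labelled_system(2)[OF mp fin P part'])
    also have "\<dots> \<le> (\<integral>x. - ln (q (code T lab n x)) \<partial>\<nu>)"
      by (intro P.gibbs_inequality q_sum q_pos less_imp_le[OF q_pos])
    also have "\<dots> \<le> (\<integral>x. (\<Sum>i<n. ?h ((T ^^ i) x)) + (s * log_expansion (code T \<sigma> (n + M) x) + ln ?Z) \<partial>\<nu>)"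
      using P.integrable_code[of "\<lambda>w. - ln (q w)" n]
      by (rule integral_mono[OF _ Bochner_Integration.integrable_add[OF int_sum int_exp] pointwise])
    also have "\<dots> = (\<integral>x. (\<Sum>i<n. ?h ((T ^^ i) x)) \<partial>\<nu>) + (\<integral>x. s * log_expansion (code T \<sigma> (n + M) x) + ln ?Z \<partial>\<nu>)"
      by (rule Bochner_Integration.integral_add[OF int_sum int_exp])
    also have "(\<integral>x. (\<Sum>i<n. ?h ((T ^^ i) x)) \<partial>\<nu>) = (\<Sum>i<n. \<integral>x. ?h ((T ^^ i) x) \<partial>\<nu>)"
      by (rule Bochner_Integration.integral_sum) (rule P.integrable_iterate[OF int_h])
    also have "\<dots> = real n * (\<integral>x. ?h x \<partial>\<nu>)"
      using P.integral_iterate[OF borel_measurable_integrable[OF int_h]] by simp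
    also have "(\<integral>x. ?h x \<partial>\<nu>) = \<eta> / 2 + b * measure \<nu> E"
    proof -
      have "integrable \<nu> (indicator E :: real \<Rightarrow> real)"
        using E(1) by (intro integrable_real_indicator) (auto simp: less_top[symmetric])
      then show ?thesis
        using sets.sets_into_space[OF E(1)] by (simp add: P.prob_space Int_absorb2)
    qed
    also have "(\<integral>x. s * log_expansion (code T \<sigma> (n + M) x) + ln ?Z \<partial>\<nu>)
        = s * (\<integral>x. log_expansion (code T \<sigma> (n + M) x) \<partial>\<nu>) + ln ?Z"
      using S.integrable_code[of log_expansion "n + M"] by (simp add: P.prob_space)
    finally have main: "partition_entropy \<nu> (iterated_join \<nu> T P n)
        \<le> real n * (\<eta> / 2 + b * measure \<nu> E) + (s * (\<integral>x. log_expansion (code T \<sigma> (n + M) x) \<partial>\<nu>) + ln ?Z)" .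
    have "b * measure \<nu> E \<le> (b + 1) * (\<eta> / (2 * (b + 1)))"
      using E(2) b by (intro mult_mono) auto
    also have "(b + 1) * (\<eta> / (2 * (b + 1))) = \<eta> / 2" using b by (simp add: field_simps)
    finally have "b * measure \<nu> E \<le> \<eta> / 2" .
    then have "real n * (\<eta> / 2 + b * measure \<nu> E) \<le> real n * \<eta>" by (intro mult_left_mono) auto
    moreover have "s * (\<integral>x. log_expansion (code T \<sigma> (n + M) x) \<partial>\<nu>) \<le> s * (real (n + M) * (?ly + \<eta>) + B)"
      using s by (intro mult_left_mono expansion_integral)
    ultimately show ?thesis using main by linarith
  qed
  then show ?thesis by blast
qed

lemma partition_function_large:
  assumes \<nu>: "\<nu> \<in> invariant_measures \<Lambda> T"
    and lyap: "lyapunov_exponent (system_deriv I f \<sigma>) \<nu> > 0"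
    and s: "0 \<le> s"
    and h: "ereal (s * lyapunov_exponent (system_deriv I f \<sigma>) \<nu>) < metric_entropy \<nu> T"
  shows "eventually (\<lambda>n. partition_function s n > R) sequentially"
proof -
  let ?ly = "lyapunov_exponent (system_deriv I f \<sigma>) \<nu>"
  let ?H = "\<lambda>P n. partition_entropy \<nu> (iterated_join \<nu> T P n)"
  note sp = invariant_measure_facts(2)[OF \<nu>]
  have mp: "measure_preserving \<nu> T" by (rule invariant_measure_facts[OF \<nu>])
  obtain P where P: "finite P" "P \<subseteq> sets \<nu>" "partition_on (space \<nu>) P"
    and hP: "s * ?ly < entropy_wrt_partition \<nu> T P"
    using h unfolding metric_entropy_def less_SUP_iff by auto
  interpret P: labelled_system \<nu> T P "\<lambda>x. THE A. A \<in> P \<and> x \<in> A"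
    by (rule partition_labelled_system[OF mp P])
  define hP where "hP = entropy_wrt_partition \<nu> T P"
  have "convergent (\<lambda>n. ?H P n / real n)"
    using P.convergent_word_entropy partition_labelled_system(2)[OF mp P] by simp
  then have lim: "(\<lambda>n. ?H P n / real n) \<longlonglongrightarrow> hP"
    unfolding hP_def entropy_wrt_partition_def by (simp add: convergent_LIMSEQ_iff)
  define c where "c = hP - s * ?ly"
  have c: "c > 0" using hP unfolding c_def hP_def by simp
  define \<eta> where "\<eta> = c / (2 * (s + 2))"
  have \<eta>: "\<eta> > 0" "\<eta> * (s + 2) = c / 2" unfolding \<eta>_def using c s by (auto simp: field_simps)
  obtain M B where MB: "\<And>n. ?H P n \<le> ln (partition_function s (n + M)) + real n * \<eta>
        + s * (real (n + M) * (?ly + \<eta>) + B)"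
    using entropy_le_partition_function[OF \<nu> P(1,2) _ lyap s \<eta>(1)] P(3) sp by auto
  define D where "D = s * (real M * (?ly + \<eta>) + B)"
  obtain n0 :: nat where n0: "real n0 * (c / 2) > D + ln (max R 1)"
    using reals_Archimedean3[of "c / 2"] half_gt_zero[OF c] by blast
  have "eventually (\<lambda>n. hP - \<eta> < ?H P n / real n) sequentially"
    using order_tendstoD(1)[OF lim, of "hP - \<eta>"] \<eta>(1) by simp
  moreover have "eventually (\<lambda>n. n \<ge> max 1 n0) sequentially" by (rule eventually_ge_at_top)
  ultimately have "eventually (\<lambda>n. partition_function s (n + M) > R) sequentially"
  proof eventually_elim
    case (elim n)
    have n: "real n \<ge> real n0" "n \<ge> 1" using elim by auto
    have "real n * (hP - \<eta>) < ?H P n" using elim n by (simp add: field_simps)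
    also have "\<dots> \<le> ln (partition_function s (n + M)) + real n * \<eta> + s * (real (n + M) * (?ly + \<eta>) + B)"
      by (rule MB)
    also have "\<dots> = ln (partition_function s (n + M)) + real n * (\<eta> + s * ?ly + s * \<eta>) + D"
      unfolding D_def by (simp add: algebra_simps)
    finally have "real n * (c - \<eta> * (s + 2)) - D < ln (partition_function s (n + M))"
      unfolding c_def by (simp add: algebra_simps)
    then have "real n * (c / 2) - D < ln (partition_function s (n + M))" using \<eta>(2) by simp
    moreover have "real n0 * (c / 2) \<le> real n * (c / 2)" using n c by (intro mult_right_mono) auto
    ultimately have "ln (max R 1) < ln (partition_function s (n + M))" using n0 by linarith
    then have "max R 1 < partition_function s (n + M)"
      by (subst (asm) ln_less_cancel_iff) (auto intro: partition_function_pos)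
    then show ?case by simp
  qed
  then show ?thesis by (rule eventually_sequentially_seg[THEN iffD1])
qed

end

section \<open>Almost additive potentials\<close>

text \<open>With the constant made explicit and the two inequalities in symmetric form, the condition is
invariant under \<open>\<phi> \<mapsto> - \<phi>\<close>; hence what is shown for low values of \<open>\<phi>\<close> holds for high values too.\<close>

definition almost_additive_with :: "'a set \<Rightarrow> ('a \<Rightarrow> 'a) \<Rightarrow> real \<Rightarrow> (nat \<Rightarrow> 'a \<Rightarrow> real) \<Rightarrow> bool" where
  "almost_additive_with X T C \<phi> \<longleftrightarrow>
     (\<forall>n\<ge>1. \<forall>p\<ge>1. \<forall>x\<in>X. \<bar>\<phi> (n + p) x - (\<phi> n x + \<phi> p ((T ^^ n) x))\<bar> \<le> C)"

lemma almost_additive_withD: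
  "\<lbrakk>almost_additive_with X T C \<phi>; n \<ge> 1; p \<ge> 1; x \<in> X\<rbrakk>
    \<Longrightarrow> \<bar>\<phi> (n + p) x - (\<phi> n x + \<phi> p ((T ^^ n) x))\<bar> \<le> C"
  unfolding almost_additive_with_def by blast

lemma almost_additive_with_uminus:
  assumes "almost_additive_with X T C \<phi>"
  shows "almost_additive_with X T C (\<lambda>n x. - \<phi> n x)"
  unfolding almost_additive_with_def
proof (intro allI impI ballI)
  fix n p :: nat and x assume "n \<ge> 1" "p \<ge> 1" "x \<in> X"
  from almost_additive_withD[OF assms this]
  show "\<bar>- \<phi> (n + p) x - (- \<phi> n x + - \<phi> p ((T ^^ n) x))\<bar> \<le> C" by linarith
qed

lemma almost_additive_obtain_constant:
  assumes "almost_additive X T \<phi>"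
  obtains C where "C > 0" "almost_additive_with X T C \<phi>"
proof -
  obtain C where C: "C > 0" "\<forall>n\<ge>1. \<forall>p\<ge>1. \<forall>x\<in>X.
        - C + \<phi> n x + \<phi> p ((T ^^ n) x) \<le> \<phi> (n + p) x \<and>
        \<phi> (n + p) x \<le> \<phi> n x + \<phi> p ((T ^^ n) x) + C"
    using assms unfolding almost_additive_def by blast
  have "almost_additive_with X T C \<phi>"
    unfolding almost_additive_with_def
  proof (intro allI impI ballI)
    fix n p :: nat and x assume "n \<ge> 1" "p \<ge> 1" "x \<in> X"
    then have "- C + \<phi> n x + \<phi> p ((T ^^ n) x) \<le> \<phi> (n + p) x"
        "\<phi> (n + p) x \<le> \<phi> n x + \<phi> p ((T ^^ n) x) + C"
      using C(2) by auto
    then show "\<bar>\<phi> (n + p) x - (\<phi> n x + \<phi> p ((T ^^ n) x))\<bar> \<le> C" by linarith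
  qed
  with C(1) show ?thesis by (rule that)
qed

text \<open>Between the times \<open>N q J\<close> and \<open>N (q + 1) J\<close>, a positive fraction of the whole time, \<open>\<phi>\<close> grows at rate
at most \<open>\<alpha>\<close>. If the averages are close to \<open>L\<close> at both times, this forces \<open>L \<le> \<alpha>\<close> in the limit.\<close>

lemma limit_le_of_low_stages:
  fixes \<phi> :: "nat \<Rightarrow> 'a \<Rightarrow> real"
  assumes aa: "almost_additive_with X T C \<phi>" and x: "x \<in> X" and N: "N \<ge> 1" and q: "q \<ge> 1"
    and stages: "\<And>j0. \<exists>J\<ge>j0. \<forall>i. q * J \<le> i \<and> i < q * J + J \<longrightarrow> \<phi> N ((T ^^ (N * i)) x) + C \<le> real N * \<alpha>"
    and lim: "(\<lambda>n. \<phi> n x / real n) \<longlonglongrightarrow> L"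
  shows "L \<le> \<alpha>"
proof (rule ccontr)
  assume "\<not> L \<le> \<alpha>"
  define e where "e = (L - \<alpha>) / (2 * real q + 2)"
  have e: "e > 0" "(2 * real q + 2) * e = L - \<alpha>" using \<open>\<not> L \<le> \<alpha>\<close> unfolding e_def by (auto simp: field_simps)
  obtain n0 where n0: "\<And>n. n \<ge> n0 \<Longrightarrow> \<bar>\<phi> n x / real n - L\<bar> < e"
    using LIMSEQ_D[OF lim e(1)] by auto
  obtain J where J: "J \<ge> max 1 n0"
    "\<And>i. \<lbrakk>q * J \<le> i; i < q * J + J\<rbrakk> \<Longrightarrow> \<phi> N ((T ^^ (N * i)) x) + C \<le> real N * \<alpha>"
    using stages by blast
  have step: "\<phi> (N * (q * J + r)) x \<le> \<phi> (N * (q * J)) x + real r * (real N * \<alpha>)" if "r \<le> J" for r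
    using that
  proof (induction r)
    case (Suc r)
    have "\<bar>\<phi> (N * (q * J + r) + N) x - (\<phi> (N * (q * J + r)) x + \<phi> N ((T ^^ (N * (q * J + r))) x))\<bar> \<le> C"
      using N q J(1) by (intro almost_additive_withD[OF aa _ _ x]) (auto simp: Suc_le_eq)
    moreover have "\<phi> N ((T ^^ (N * (q * J + r))) x) + C \<le> real N * \<alpha>"
      using Suc.prems by (intro J(2)) auto
    moreover have "\<phi> (N * (q * J + r)) x \<le> \<phi> (N * (q * J)) x + real r * (real N * \<alpha>)"
      using Suc by simp
    moreover have next_index: "N * (q * J + Suc r) = N * (q * J + r) + N" by simp
    moreover have "real (Suc r) * (real N * \<alpha>) = real r * (real N * \<alpha>) + real N * \<alpha>" by (simp add: algebra_simps)
    ultimately show ?case unfolding next_index by (simp only: abs_le_iff) linarith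
  qed simp
  define A1 A2 where "A1 = \<phi> (N * (q * J)) x / real (N * (q * J))"
    and "A2 = \<phi> (N * (q * J + J)) x / real (N * (q * J + J))"
  have pos: "real N * real J > 0" using N J(1) by auto
  have qJ: "n0 \<le> q * J" using q J(1) by (metis One_nat_def le_trans max.boundedE mult_le_mono1 nat_mult_1)
  then have "n0 \<le> N * (q * J)" using N by (metis le_trans mult_le_mono1 nat_mult_1 One_nat_def)
  then have "\<bar>A1 - L\<bar> < e" unfolding A1_def by (rule n0)
  moreover have "n0 \<le> N * (q * J + J)" using \<open>n0 \<le> N * (q * J)\<close> by (simp add: distrib_left)
  then have "\<bar>A2 - L\<bar> < e" unfolding A2_def by (rule n0)
  moreover have "(real q + 1) * A2 \<le> real q * A1 + \<alpha>"
  proof -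
    have "real (N * (q * J + J)) = (real N * real J) * (real q + 1)" by (simp add: algebra_simps)
    moreover have "real (N * (q * J + J)) * A2 = \<phi> (N * (q * J + J)) x"
      using N J(1) unfolding A2_def by (simp del: of_nat_mult of_nat_add)
    ultimately have "\<phi> (N * (q * J + J)) x = (real N * real J) * ((real q + 1) * A2)" by (simp only: mult.assoc)
    moreover have "real (N * (q * J)) = (real N * real J) * real q" by (simp add: algebra_simps)
    moreover have "real (N * (q * J)) * A1 = \<phi> (N * (q * J)) x"
      using N J(1) q unfolding A1_def by (simp del: of_nat_mult of_nat_add)
    ultimately have "\<phi> (N * (q * J + J)) x = (real N * real J) * ((real q + 1) * A2)"
      "\<phi> (N * (q * J)) x = (real N * real J) * (real q * A1)" by (simp_all only: mult.assoc)
    then have "(real N * real J) * ((real q + 1) * A2) \<le> (real N * real J) * (real q * A1 + \<alpha>)"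
      using step[of J] by (simp add: algebra_simps)
    then show ?thesis using pos by (simp only: mult_le_cancel_left_pos)
  qed
  ultimately have "L - e < A2" "A1 < L + e" "(real q + 1) * A2 \<le> real q * A1 + \<alpha>" by auto
  moreover from this have "(real q + 1) * (L - e) \<le> (real q + 1) * A2" "real q * A1 \<le> real q * (L + e)"
    by (auto intro!: mult_left_mono)
  ultimately have "(real q + 1) * (L - e) \<le> real q * (L + e) + \<alpha>" by linarith
  then have "L - \<alpha> \<le> (2 * real q + 1) * e" by (simp add: algebra_simps)
  then show False using e by (simp add: algebra_simps)
qed

context expanding_system
begin

lemma integrable_continuous_on_attractor:
  fixes g :: "real \<Rightarrow> 'b::euclidean_space"
  assumes \<nu>: "\<nu> \<in> invariant_measures \<Lambda> T" and g: "continuous_on \<Lambda> g"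
  shows "integrable \<nu> g"
proof -
  interpret measure_preserving \<nu> T by (rule invariant_measure_facts[OF \<nu>])
  obtain B where B: "\<And>x. x \<in> \<Lambda> \<Longrightarrow> norm (g x) \<le> B"
    using compact_imp_bounded[OF compact_continuous_image[OF g attractor_compact]]
    unfolding bounded_iff by auto
  have "g \<in> borel_measurable (restrict_space borel \<Lambda>)"
    by (rule borel_measurable_continuous_on_restrict[OF g])
  then have "g \<in> borel_measurable \<nu>"
    by (subst measurable_cong_sets[OF invariant_measure_facts(3)[OF \<nu>] refl])
  then show ?thesis
    using B invariant_measure_facts(2)[OF \<nu>] by (intro integrable_const_bound[of _ B]) auto
qed

lemma average_convergent:
  assumes \<nu>: "\<nu> \<in> invariant_measures \<Lambda> T"
    and cont: "\<And>n. n \<ge> 1 \<Longrightarrow> continuous_on \<Lambda> (\<phi> n)" and aa: "almost_additive_with \<Lambda> T C \<phi>"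
  shows "convergent (\<lambda>n. (\<integral>x. \<phi> n x \<partial>\<nu>) / real n)"
proof (rule convergent_almost_additive_average)
  interpret measure_preserving \<nu> T by (rule invariant_measure_facts[OF \<nu>])
  fix n p :: nat assume np: "n \<ge> 1" "p \<ge> 1"
  have int: "integrable \<nu> (\<phi> k)" if "k \<ge> 1" for k
    by (intro integrable_continuous_on_attractor \<nu> cont that)
  have int_T: "integrable \<nu> (\<lambda>x. \<phi> p ((T ^^ n) x))" by (intro integrable_iterate int np)
  let ?D = "\<lambda>x. \<phi> (n + p) x - (\<phi> n x + \<phi> p ((T ^^ n) x))"
  have int_D: "integrable \<nu> ?D"
    using int[of "n + p"] int[of n] int_T np by (intro Bochner_Integration.integrable_diff Bochner_Integration.integrable_add) auto
  have "(\<integral>x. \<phi> (n + p) x \<partial>\<nu>) - ((\<integral>x. \<phi> n x \<partial>\<nu>) + (\<integral>x. \<phi> p x \<partial>\<nu>)) = (\<integral>x. ?D x \<partial>\<nu>)"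
    using int[of "n + p"] int[of n] int_T np integral_iterate[OF borel_measurable_integrable[OF int[OF np(2)]], of n]
    by simp
  also have "\<bar>\<dots>\<bar> \<le> (\<integral>x. \<bar>?D x\<bar> \<partial>\<nu>)" by (rule integral_abs_bound)
  also have "\<dots> \<le> (\<integral>x. C \<partial>\<nu>)"
    using int_D invariant_measure_facts(2)[OF \<nu>]
    by (intro integral_mono integrable_abs almost_additive_withD[OF aa np]) auto
  finally show "\<bar>(\<integral>x. \<phi> (n + p) x \<partial>\<nu>) - ((\<integral>x. \<phi> n x \<partial>\<nu>) + (\<integral>x. \<phi> p x \<partial>\<nu>))\<bar> \<le> C"
    by (simp add: prob_space)
qed

text \<open>Split off \<open>k\<close> steps at a time. Each such step costs an error of \<open>2 C\<close> from almost additivity and of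
\<open>1\<close> from the variation of \<open>\<phi> k\<close> on a short cylinder, so that the variation of \<open>\<phi> n\<close> is at most
\<open>(2 C + 1) n / k\<close> up to a constant, and \<open>k\<close> is arbitrary.\<close>

lemma variation_on_cylinders:
  assumes cont: "\<And>n. n \<ge> 1 \<Longrightarrow> continuous_on \<Lambda> (\<phi> n)"
    and aa: "almost_additive_with \<Lambda> T C \<phi>" and C: "C > 0" and \<eta>: "\<eta> > 0"
  shows "\<exists>n0. \<forall>n\<ge>n0. \<forall>x\<in>\<Lambda>. \<forall>z\<in>\<Lambda>. code T \<sigma> n x = code T \<sigma> n z \<longrightarrow> \<phi> n z - \<phi> n x \<le> \<eta> * real n"
proof -
  obtain k :: nat where k: "real k * (\<eta> / 2) > 2 * C + 1"
    using reals_Archimedean3[of "\<eta> / 2"] \<eta> half_gt_zero by blast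
  have k1: "k \<ge> 1" using k C by (cases k) auto
  have "uniformly_continuous_on \<Lambda> (\<phi> k)"
    by (intro compact_uniformly_continuous cont k1 attractor_compact)
  then obtain e where e: "e > 0" "\<And>x y. \<lbrakk>x \<in> \<Lambda>; y \<in> \<Lambda>; dist y x < e\<rbrakk> \<Longrightarrow> dist (\<phi> k y) (\<phi> k x) < 1"
    unfolding uniformly_continuous_on_def by (meson zero_less_one)
  obtain M where M: "\<And>w x y. \<lbrakk>admissible w; M \<le> length w; x \<in> cyl w; y \<in> cyl w\<rbrakk> \<Longrightarrow> \<bar>x - y\<bar> < e"
    using cyl_small[OF e(1)] by blast
  have close: "\<bar>\<phi> k z - \<phi> k x\<bar> \<le> 1" if "x \<in> \<Lambda>" "z \<in> \<Lambda>" "code T \<sigma> n x = code T \<sigma> n z" "n \<ge> M" for x z n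
  proof -
    have "\<bar>z - x\<bar> < e"
      using M[OF admissible_code[OF that(1), of n], of z x] in_cyl_code[OF that(1), of n] in_cyl_code[OF that(2), of n] that
      by auto
    then show ?thesis using e(2)[OF that(1,2)] by (simp add: dist_real_def)
  qed
  have "\<exists>b\<ge>0. \<forall>x\<in>\<Lambda>. \<bar>\<phi> n x\<bar> \<le> b" if "n \<ge> 1" for n
  proof -
    obtain b where "\<forall>x\<in>\<Lambda>. \<bar>\<phi> n x\<bar> \<le> b"
      using compact_imp_bounded[OF compact_continuous_image[OF cont[OF \<open>n \<ge> 1\<close>] attractor_compact]]
      unfolding bounded_iff by auto
    then show ?thesis by (intro exI[of _ "max b 0"]) auto
  qed
  then obtain b where b: "\<And>n. n \<ge> 1 \<Longrightarrow> b n \<ge> 0" "\<And>n x. \<lbrakk>n \<ge> 1; x \<in> \<Lambda>\<rbrakk> \<Longrightarrow> \<bar>\<phi> n x\<bar> \<le> b n"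
    by metis
  define M' where "M' = max 1 M"
  define B where "B = (\<Sum>r<k. b (M' + r))"
  have b_le: "b (M' + r) \<le> B" if "r < k" for r
    unfolding B_def using that b(1) by (intro member_le_sum) (auto simp: M'_def)
  have var: "\<phi> (M' + r + q * k) z - \<phi> (M' + r + q * k) x \<le> 2 * B + real q * (2 * C + 1)"
    if "r < k" "x \<in> \<Lambda>" "z \<in> \<Lambda>" "code T \<sigma> (M' + r + q * k) x = code T \<sigma> (M' + r + q * k) z" for q r x z
    using that(2-4)
  proof (induction q arbitrary: x z)
    case 0
    have "\<bar>\<phi> (M' + r) x\<bar> \<le> b (M' + r)" "\<bar>\<phi> (M' + r) z\<bar> \<le> b (M' + r)"
      using 0 by (auto intro!: b(2) simp: M'_def)
    then show ?case using b_le[OF that(1)] by auto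
  next
    case (Suc q)
    let ?n = "M' + r + q * k"
    have n1: "?n \<ge> 1" by (simp add: M'_def)
    have eq: "M' + r + Suc q * k = k + ?n" by simp
    have add: "\<bar>\<phi> (k + ?n) y - (\<phi> k y + \<phi> ?n ((T ^^ k) y))\<bar> \<le> C" if "y \<in> \<Lambda>" for y
      by (intro almost_additive_withD[OF aa k1 n1 that])
    have codes: "code T \<sigma> (k + ?n) x = code T \<sigma> (k + ?n) z" using Suc.prems(3) unfolding eq .
    then have "drop k (code T \<sigma> (k + ?n) x) = drop k (code T \<sigma> (k + ?n) z)" by (rule arg_cong)
    then have "code T \<sigma> ?n ((T ^^ k) x) = code T \<sigma> ?n ((T ^^ k) z)" unfolding drop_code diff_add_inverse .
    then have "\<phi> ?n ((T ^^ k) z) - \<phi> ?n ((T ^^ k) x) \<le> 2 * B + real q * (2 * C + 1)"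
      using Suc.prems by (intro Suc.IH iterate_in)
    moreover have "\<bar>\<phi> k z - \<phi> k x\<bar> \<le> 1"
      using Suc.prems(1,2) codes by (rule close) (simp add: M'_def)
    ultimately show ?case
      unfolding eq using add[OF Suc.prems(1)] add[OF Suc.prems(2)] by (simp add: algebra_simps abs_le_iff)
  qed
  obtain n1 :: nat where n1: "real n1 * (\<eta> / 2) > 2 * B"
    using reals_Archimedean3[of "\<eta> / 2"] \<eta> half_gt_zero by blast
  have "\<phi> n z - \<phi> n x \<le> \<eta> * real n"
    if n: "n \<ge> max M' n1" and xz: "x \<in> \<Lambda>" "z \<in> \<Lambda>" "code T \<sigma> n x = code T \<sigma> n z" for n x z
  proof -
    define r q where "r = (n - M') mod k" and "q = (n - M') div k"
    have n_eq: "n = M' + r + q * k" unfolding r_def q_def using n by simp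
    have "\<phi> n z - \<phi> n x \<le> 2 * B + real q * (2 * C + 1)"
      using var[of r x z q] xz k1 unfolding n_eq[symmetric] by (simp add: r_def)
    also have "real q * (2 * C + 1) \<le> real q * (real k * (\<eta> / 2))" using k by (intro mult_left_mono) auto
    also have "\<dots> = real (q * k) * (\<eta> / 2)" by simp
    also have "\<dots> \<le> real n * (\<eta> / 2)" using n_eq \<eta> by (intro mult_right_mono) (auto simp del: of_nat_mult)
    also have "2 * B \<le> real n * (\<eta> / 2)"
    proof -
      have "real n1 * (\<eta> / 2) \<le> real n * (\<eta> / 2)" using n \<eta> by (intro mult_right_mono) auto
      then show ?thesis using n1 by linarith
    qed
    finally show ?thesis by (simp add: field_simps)
  qed
  then show ?thesis by blast
qed

text \<open>Some point has \<open>\<phi> n\<close> not larger than its integral; by \<open>variation_on_cylinders\<close> this carries over,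
up to \<open>o(n)\<close>, to all points with the same itinerary. The constant \<open>C\<close> is included so that such
words can be concatenated without loss.\<close>

lemma low_words:
  assumes \<nu>: "\<nu> \<in> invariant_measures \<Lambda> T"
    and cont: "\<And>n. n \<ge> 1 \<Longrightarrow> continuous_on \<Lambda> (\<phi> n)"
    and aa: "almost_additive_with \<Lambda> T C \<phi>" and C: "C > 0"
    and lim: "(\<lambda>n. (\<integral>x. \<phi> n x \<partial>\<nu>) / real n) \<longlonglongrightarrow> u" and u: "u < \<alpha>"
  shows "eventually (\<lambda>n. \<exists>x\<in>\<Lambda>. \<forall>z\<in>\<Lambda>. code T \<sigma> n z = code T \<sigma> n x \<longrightarrow> \<phi> n z + C \<le> real n * \<alpha>) sequentially"
proof -
  interpret measure_preserving \<nu> T by (rule invariant_measure_facts[OF \<nu>])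
  define \<eta> where "\<eta> = (\<alpha> - u) / 3"
  have \<eta>: "\<eta> > 0" "\<alpha> = u + 3 * \<eta>" using u by (simp_all add: \<eta>_def field_simps)
  obtain n0 where n0: "\<And>n x z. \<lbrakk>n \<ge> n0; x \<in> \<Lambda>; z \<in> \<Lambda>; code T \<sigma> n x = code T \<sigma> n z\<rbrakk> \<Longrightarrow> \<phi> n z - \<phi> n x \<le> \<eta> * real n"
    using variation_on_cylinders[OF cont aa C \<eta>(1)] by blast
  obtain n1 :: nat where n1: "real n1 * \<eta> > C" using reals_Archimedean3[OF \<eta>(1)] by blast
  have "eventually (\<lambda>n. (\<integral>x. \<phi> n x \<partial>\<nu>) / real n < u + \<eta>) sequentially"
    using order_tendstoD(2)[OF lim, of "u + \<eta>"] \<eta>(1) by simp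
  then show ?thesis
    using eventually_ge_at_top[of "max 1 (max n0 n1)"]
  proof eventually_elim
    case (elim n)
    then have n: "n \<ge> 1" "n \<ge> n0" "n \<ge> n1" by auto
    have int: "(\<integral>x. \<phi> n x \<partial>\<nu>) < real n * (u + \<eta>)" using elim(1) n by (simp add: field_simps)
    have "\<exists>x\<in>\<Lambda>. \<phi> n x \<le> real n * (u + \<eta>)"
    proof (rule ccontr)
      assume "\<not> ?thesis"
      then have "(\<integral>x. real n * (u + \<eta>) \<partial>\<nu>) \<le> (\<integral>x. \<phi> n x \<partial>\<nu>)"
        using invariant_measure_facts(2)[OF \<nu>]
        by (intro integral_mono integrable_continuous_on_attractor[OF \<nu> cont[OF n(1)]]) (auto simp: not_le intro: less_imp_le)
      then show False using int by (simp add: prob_space)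
    qed
    then obtain x where x: "x \<in> \<Lambda>" "\<phi> n x \<le> real n * (u + \<eta>)" by blast
    have "\<phi> n z + C \<le> real n * \<alpha>" if "z \<in> \<Lambda>" "code T \<sigma> n z = code T \<sigma> n x" for z
    proof -
      have "\<phi> n z - \<phi> n x \<le> \<eta> * real n" using n0[OF n(2) x(1) that(1)] that(2) by simp
      moreover have "C \<le> real n * \<eta>"
      proof -
        have "real n1 * \<eta> \<le> real n * \<eta>" using n \<eta> by (intro mult_right_mono) auto
        then show ?thesis using n1 by linarith
      qed
      ultimately show ?thesis using x(2) unfolding \<eta>(2) by (simp add: algebra_simps)
    qed
    then show ?case using x(1) by blast
  qed
qed

lemma limit_average_component:
  fixes \<Phi> :: "nat \<Rightarrow> real \<Rightarrow> real ^ 'd"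
  assumes \<nu>: "\<nu> \<in> invariant_measures \<Lambda> T" and \<Phi>: "almost_additive_vec \<Lambda> T \<Phi>"
  shows "(\<lambda>n. (\<integral>x. \<Phi> n x $ j \<partial>\<nu>) / real n) \<longlonglongrightarrow> limit_average \<Phi> \<nu> $ j"
proof -
  have aa: "almost_additive \<Lambda> T (\<lambda>n x. \<Phi> n x $ i)" for i
    using \<Phi> unfolding almost_additive_vec_def by blast
  have cont_i: "continuous_on \<Lambda> (\<lambda>x. \<Phi> n x $ i)" if "n \<ge> 1" for n i
    using aa[of i] that unfolding almost_additive_def by blast
  have "continuous_on \<Lambda> (\<lambda>x. \<chi> i. \<Phi> n x $ i)" if "n \<ge> 1" for n
    by (intro continuous_on_vec_lambda cont_i that)
  then have cont: "continuous_on \<Lambda> (\<Phi> n)" if "n \<ge> 1" for n using that by simp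
  have comp: "(\<integral>x. \<Phi> n x \<partial>\<nu>) $ i = (\<integral>x. \<Phi> n x $ i \<partial>\<nu>)" if "n \<ge> 1" for n i
    using integral_bounded_linear[OF bounded_linear_vec_nth integrable_continuous_on_attractor[OF \<nu> cont[OF that]]]
    by simp
  have "convergent (\<lambda>n. (\<integral>x. \<Phi> n x $ i \<partial>\<nu>) / real n)" for i
  proof -
    obtain C where "almost_additive_with \<Lambda> T C (\<lambda>n x. \<Phi> n x $ i)"
      using almost_additive_obtain_constant[OF aa] .
    then show ?thesis by (intro average_convergent[OF \<nu> cont_i])
  qed
  then obtain l where l: "\<And>i. (\<lambda>n. (\<integral>x. \<Phi> n x $ i \<partial>\<nu>) / real n) \<longlonglongrightarrow> l i"
    unfolding convergent_def by metis
  have "(\<lambda>n. ((1 / real n) *\<^sub>R (\<integral>x. \<Phi> n x \<partial>\<nu>)) $ i) \<longlonglongrightarrow> (\<chi> i. l i) $ i" for i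
  proof (rule Lim_transform_eventually)
    show "(\<lambda>n. (\<integral>x. \<Phi> n x $ i \<partial>\<nu>) / real n) \<longlonglongrightarrow> (\<chi> i. l i) $ i" using l by simp
    show "eventually (\<lambda>n. (\<integral>x. \<Phi> n x $ i \<partial>\<nu>) / real n = ((1 / real n) *\<^sub>R (\<integral>x. \<Phi> n x \<partial>\<nu>)) $ i) sequentially"
      using eventually_ge_at_top[of 1] by eventually_elim (simp add: comp)
  qed
  then have "(\<lambda>n. (1 / real n) *\<^sub>R (\<integral>x. \<Phi> n x \<partial>\<nu>)) \<longlonglongrightarrow> (\<chi> i. l i)"
    by (rule vec_tendstoI)
  then have "limit_average \<Phi> \<nu> = (\<chi> i. l i)" unfolding limit_average_def by (rule limI)
  then show ?thesis using l[of j] by simp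
qed

end

section \<open>Sparse stages\<close>

text \<open>In units of blocks, the stage \<open>j\<close> starts at time \<open>q J\<close> and has length \<open>J = q\<^sup>j\<close>, a fraction \<open>1/q\<close> of the
time elapsed. Stages are disjoint and have density at most \<open>2/q\<close>.\<close>

definition stage :: "nat \<Rightarrow> nat \<Rightarrow> nat set" where
  "stage q j = {q * q ^ j..<q * q ^ j + q ^ j}"

lemma stage_disjoint:
  assumes "q \<ge> 2" "i \<in> stage q j" "i \<in> stage q j'"
  shows "j = j'"
proof -
  have "\<not> j < j'" if "i \<in> stage q j" "i \<in> stage q j'" for j j'
  proof
    assume "j < j'"
    then have "q ^ Suc j \<le> q ^ j'" using assms(1) by (intro power_increasing) auto
    then have le: "q * q ^ Suc j \<le> q * q ^ j'" by (rule mult_le_mono2)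
    have "1 * q ^ j \<le> q * q ^ j" using assms(1) by (intro mult_le_mono1) auto
    then have "q * q ^ j + q ^ j \<le> 2 * (q * q ^ j)" by simp
    also have "\<dots> \<le> q * q ^ Suc j" using assms(1) by simp
    finally have "q * q ^ j + q ^ j \<le> q * q ^ Suc j" .
    then show False using le that unfolding stage_def atLeastLessThan_iff by linarith
  qed
  then show ?thesis using assms(2,3) by (metis nat_neq_iff)
qed

lemma card_stages_le:
  assumes "q \<ge> 2"
  shows "q * card {i. i < k \<and> (\<exists>j. i \<in> stage q j)} \<le> 2 * k"
proof -
  let ?F = "{i. i < k \<and> (\<exists>j. i \<in> stage q j)}"
  have geometric: "(\<Sum>j\<le>J. q ^ j) \<le> 2 * q ^ J" for J
  proof (induction J)
    case (Suc J)
    have "2 * q ^ J \<le> q * q ^ J" using assms by (intro mult_le_mono1)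
    then show ?case using Suc.IH unfolding sum.atMost_Suc power_Suc by linarith
  qed simp
  have "k \<le> q * q ^ J \<Longrightarrow> q * card ?F \<le> 2 * k" for J
  proof (induction J)
    case 0
    have "q \<le> i" if "i \<in> stage q j" for i j
    proof -
      have "q * 1 \<le> q * q ^ j" using assms by (intro mult_le_mono2) simp
      then show ?thesis using that unfolding stage_def atLeastLessThan_iff by linarith
    qed
    then have "?F = {}" using 0 by force
    then show ?case by (simp only: card.empty)
  next
    case (Suc J)
    show ?case
    proof (cases "k \<le> q * q ^ J")
      case False
      have "?F \<subseteq> (\<Union>j\<le>J. stage q j)"
      proof
        fix i assume i: "i \<in> ?F"
        then obtain j where j: "i \<in> stage q j" by blast
        have "j \<le> J"
        proof (rule ccontr)
          assume "\<not> j \<le> J"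
          then have "q ^ Suc J \<le> q ^ j" using assms by (intro power_increasing) auto
          then have "q * q ^ Suc J \<le> q * q ^ j" by (rule mult_le_mono2)
          moreover have "i < k" "q * q ^ j \<le> i" using i j by (auto simp: stage_def)
          ultimately show False using Suc.prems by linarith
        qed
        then show "i \<in> (\<Union>j\<le>J. stage q j)" using j by blast
      qed
      then have "card ?F \<le> card (\<Union>j\<le>J. stage q j)" by (intro card_mono) (auto simp: stage_def)
      also have "\<dots> \<le> (\<Sum>j\<le>J. card (stage q j))" by (rule card_UN_le) simp
      also have "\<dots> \<le> 2 * q ^ J" using geometric by (simp add: stage_def)
      finally have "q * card ?F \<le> q * (2 * q ^ J)" by (rule mult_le_mono2)
      also have "q * (2 * q ^ J) = 2 * (q * q ^ J)" by (simp only: mult_ac)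
      also have "\<dots> \<le> 2 * k" using False by (intro mult_le_mono2) simp
      finally show ?thesis .
    qed (rule Suc.IH)
  qed
  moreover have "k \<le> q * q ^ k"
  proof -
    have "k < 2 ^ Suc k" using less_exp[of "Suc k"] by linarith
    also have "\<dots> \<le> q ^ Suc k" using assms by (intro power_mono) auto
    finally show ?thesis by simp
  qed
  ultimately show ?thesis by blast
qed

section \<open>A Cantor set of irregular points\<close>

lemma map_blocks_eq_concat:
  assumes "\<And>i. length (\<omega> i) = N"
  shows "map (\<lambda>t. \<omega> (t div N) ! (t mod N)) [0..<N * k] = concat (map \<omega> [0..<k])"
proof (cases "N = 0")
  case True
  then show ?thesis using assms by simp
next
  case False
  show ?thesis
  proof (induction k)
    case (Suc k)
    have "map (\<lambda>t. \<omega> (t div N) ! (t mod N)) [N * k..<N * k + N]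
        = map (\<lambda>r. \<omega> ((N * k + r) div N) ! ((N * k + r) mod N)) [0..<N]"
      by (rule nth_equalityI) auto
    also have "\<dots> = map ((!) (\<omega> k)) [0..<N]" using False by (intro map_cong) auto
    also have "\<dots> = \<omega> k" using assms by (metis map_nth)
    finally have "map (\<lambda>t. \<omega> (t div N) ! (t mod N)) [N * k..<N * k + N] = \<omega> k" .
    moreover have "[0..<N * Suc k] = [0..<N * k] @ [N * k..<N * k + N]"
      using upt_add_eq_append[of 0 "N * k" N] by (simp add: add.commute)
    ultimately show ?case using Suc by simp
  qed simp
qed

context expanding_system
begin

lemma log_expansion_concat:
  assumes "\<And>i. admissible (\<omega> i)"
  shows "log_expansion (concat (map \<omega> [0..<k])) \<le> (\<Sum>i<k. log_expansion (\<omega> i))"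
proof (induction k)
  case (Suc k)
  have "log_expansion (concat (map \<omega> [0..<k]) @ \<omega> k) \<le> log_expansion (concat (map \<omega> [0..<k])) + log_expansion (\<omega> k)"
    using assms by (intro log_expansion_append) auto
  then show ?case using Suc by simp
qed simp

lemma compact_words_separated:
  assumes fin: "finite A" and adm: "\<And>w. w \<in> A \<Longrightarrow> admissible w"
    and disj: "\<And>v w. \<lbrakk>v \<in> A; w \<in> A; v \<noteq> w\<rbrakk> \<Longrightarrow> cyl v \<inter> cyl w = {}"
  shows "\<exists>\<delta>>0. \<forall>v\<in>A. \<forall>w\<in>A. v \<noteq> w \<longrightarrow> (\<forall>x\<in>cyl v. \<forall>y\<in>cyl w. \<delta> \<le> \<bar>x - y\<bar>)"
proof -
  have "\<exists>e>0. v \<noteq> w \<longrightarrow> (\<forall>x\<in>cyl v. \<forall>y\<in>cyl w. e \<le> \<bar>x - y\<bar>)" if "v \<in> A" "w \<in> A" for v w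
  proof (cases "v = w")
    case False
    then show ?thesis
      using separate_compact_closed[OF cyl_compact[OF adm[OF that(1)]]
          compact_imp_closed[OF cyl_compact[OF adm[OF that(2)]]] disj[OF that False]]
      unfolding dist_real_def by blast
  qed (auto intro: exI[of _ 1])
  then obtain e where e: "\<And>v w. \<lbrakk>v \<in> A; w \<in> A\<rbrakk> \<Longrightarrow> e v w > 0"
    "\<And>v w x y. \<lbrakk>v \<in> A; w \<in> A; v \<noteq> w; x \<in> cyl v; y \<in> cyl w\<rbrakk> \<Longrightarrow> e v w \<le> \<bar>x - y\<bar>" by metis
  define \<delta> where "\<delta> = Min (insert 1 ((\<lambda>(v, w). e v w) ` (A \<times> A)))"
  have "\<delta> > 0" unfolding \<delta>_def using e(1) fin by (subst Min_gr_iff) auto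
  moreover have "\<delta> \<le> e v w" if "v \<in> A" "w \<in> A" for v w
    unfolding \<delta>_def using that fin by (intro Min_le) auto
  ultimately show ?thesis using e(2) order_trans by blast
qed

text \<open>The set is coded by sequences of blocks of common length \<open>N = n + 2\<close>: \<open>a\<close> in stages of even index,
\<open>b\<close> in stages of odd index, and elsewhere any word of length \<open>n\<close> followed by the mark \<open>c\<close>. Sequences
can only differ at free positions, where the cylinders of distinct blocks are \<open>\<delta>\<close> apart; pulling back
by \<open>expansion_bound\<close> gives the distance of the coded points.\<close>

lemma irregular_set_has_mass:
  fixes \<phi> :: "nat \<Rightarrow> real \<Rightarrow> real"
  assumes aa: "almost_additive_with \<Lambda> T C \<phi>" and s: "s > 0" and t: "0 \<le> t" "t \<le> s"
    and c: "admissible c" "length c = 2" "cyl c \<subseteq> {0<..<1}"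
    and Z: "(\<Sum>w\<in>words {1..m} n. exp (- s * log_expansion (w @ c))) > 1"
    and a: "admissible a" "length a = n + 2" and b: "admissible b" "length b = n + 2"
    and low: "\<And>z. \<lbrakk>z \<in> \<Lambda>; code T \<sigma> (n + 2) z = a\<rbrakk> \<Longrightarrow> \<phi> (n + 2) z + C \<le> real (n + 2) * \<alpha>"
    and high: "\<And>z. \<lbrakk>z \<in> \<Lambda>; code T \<sigma> (n + 2) z = b\<rbrakk> \<Longrightarrow> real (n + 2) * \<beta> \<le> \<phi> (n + 2) z - C"
    and \<alpha>\<beta>: "\<alpha> < \<beta>"
    and X: "{x \<in> \<Lambda>. \<not> convergent (\<lambda>n. \<phi> n x / real n)} \<subseteq> X"
  shows "hausdorff_measure t X \<noteq> 0"
proof -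
  define N where "N = n + 2"
  define Z where "Z = (\<Sum>w\<in>words {1..m} n. exp (- s * log_expansion (w @ c)))"
  define \<kappa> where "\<kappa> = ln Z"
  have Z1: "Z > 1" and \<kappa>: "\<kappa> > 0" using Z unfolding \<kappa>_def Z_def by auto
  define A where "A = (\<lambda>w. w @ c) ` words {1..m} n"
  have finA: "finite A" unfolding A_def by (simp add: finite_words)
  have A_word: "admissible w" "length w = N" if "w \<in> A" for w
  proof -
    obtain v where "w = v @ c" "v \<in> words {1..m} n" using \<open>w \<in> A\<close> unfolding A_def by blast
    then show "admissible w" "length w = N" using c(1,2) unfolding N_def words_def by simp_all
  qed
  have sumA: "(\<Sum>w\<in>A. exp (- s * log_expansion w)) = Z"
    unfolding A_def Z_def by (subst sum.reindex) (auto simp: inj_on_def)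
  have A_disjoint: "cyl v \<inter> cyl w = {}" if "v \<in> A" "w \<in> A" "v \<noteq> w" for v w
  proof -
    obtain v' w' where "v = v' @ c" "v' \<in> words {1..m} n" "w = w' @ c" "w' \<in> words {1..m} n"
      using \<open>v \<in> A\<close> \<open>w \<in> A\<close> unfolding A_def by blast
    then show ?thesis
      using \<open>v \<noteq> w\<close> marked_cyl_disjoint[OF _ _ _ _ c(1,3), of v' w'] unfolding words_def by simp
  qed
  obtain \<delta> where \<delta>: "\<delta> > 0" "\<And>v w x y. \<lbrakk>v \<in> A; w \<in> A; v \<noteq> w; x \<in> cyl v; y \<in> cyl w\<rbrakk> \<Longrightarrow> \<delta> \<le> \<bar>x - y\<bar>"
    using compact_words_separated[OF finA A_word(1) A_disjoint] by blast

  \<comment> \<open>A free block gains the factor \<open>exp \<kappa>\<close> in the comparison of mass with the \<open>s\<close>-th power of length;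
    replacing it by a forced one costs at most \<open>exp D\<close>. With \<open>q\<close> as below, the stages are so sparse
    that half of the gain pays for them, and at least half of all positions are free.\<close>
  define D where "D = \<kappa> + s * G * real N"
  have D: "D > 0" unfolding D_def using \<kappa> s G(1) by (intro add_pos_nonneg) auto
  obtain q0 :: nat where q0: "4 * D / \<kappa> < real q0" using reals_Archimedean2 by blast
  define q where "q = max 4 q0"
  have q: "q \<ge> 4" "4 * D \<le> \<kappa> * real q"
  proof -
    have "4 * D / \<kappa> \<le> real q" using q0 unfolding q_def by simp
    then show "4 * D \<le> \<kappa> * real q" using \<kappa> by (simp add: field_simps)
  qed (simp add: q_def)
  define forced where "forced i \<longleftrightarrow> (\<exists>j. i \<in> stage q j)" for i
  define S where "S i = (if \<exists>j. even j \<and> i \<in> stage q j then {a} else if forced i then {b} else A)" for i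
  define p where "p i w = (if forced i then 1 else exp (- s * log_expansion w) / Z)" for i w
  define F where "F k = card {i. i < k \<and> forced i}" for k
  have F: "real q * real (F k) \<le> 2 * real k" for k
    using card_stages_le[of q k] q(1) unfolding F_def forced_def
    by (metis (mono_tags, lifting) le_trans numeral_le_iff of_nat_le_iff of_nat_mult of_nat_numeral semiring_norm(69) semiring_norm(71) semiring_norm(68))
  have S_even: "S i = {a}" if "i \<in> stage q j" "even j" for i j
    unfolding S_def using that by auto
  have S_odd: "S i = {b}" if "i \<in> stage q j" "odd j" for i j
  proof -
    have q2: "q \<ge> 2" using q(1) by simp
    have "odd j'" if "i \<in> stage q j'" for j'
      using stage_disjoint[OF q2 \<open>i \<in> stage q j\<close> that] \<open>odd j\<close> by simp
    then have "\<not> (\<exists>j. even j \<and> i \<in> stage q j)" by blast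
    moreover have "forced i" unfolding forced_def using that(1) by blast
    ultimately show ?thesis unfolding S_def by (simp only: if_True if_False)
  qed
  have S_free: "S i = A" if "\<not> forced i" for i
  proof -
    have "\<not> (\<exists>j. even j \<and> i \<in> stage q j)" using that unfolding forced_def by blast
    then show ?thesis using that unfolding S_def by (simp only: if_False)
  qed
  have S_forced: "S i = {a} \<or> S i = {b}" if "forced i" for i
    using that S_even S_odd unfolding forced_def by blast
  have S_word: "admissible w" "length w = N" if "w \<in> S i" for w i
  proof -
    have "w \<in> A \<or> w = a \<or> w = b"
      using S_forced[of i] S_free[of i] \<open>w \<in> S i\<close> by (cases "forced i") auto
    then show "admissible w" "length w = N" using A_word a b unfolding N_def by blast+
  qed
  have finS: "finite (S i)" for i by (metis S_forced S_free finA finite.emptyI finite_insert)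
  have p_nonneg: "0 \<le> p i w" for i w using Z1 unfolding p_def by auto
  have p_sum: "(\<Sum>w\<in>S i. p i w) = 1" for i
  proof (cases "forced i")
    case True
    from S_forced[OF True] show ?thesis unfolding p_def if_P[OF True] by (elim disjE) simp_all
  next
    case False
    then show ?thesis using Z1 sumA by (simp add: S_free p_def flip: sum_divide_distrib)
  qed

  have \<omega>S: "\<omega> i \<in> S i" if "\<omega> \<in> PiE UNIV S" for \<omega> i using that by auto
  have mass: "(\<Prod>i<k. p i (\<omega> i)) \<le> exp (- s * (\<Sum>i<k. log_expansion (\<omega> i)) - \<kappa> * real k / 2)"
    if "\<omega> \<in> PiE UNIV S" for \<omega> k
  proof -
    let ?e = "\<lambda>i. - \<kappa> + (if forced i then D else 0)"
    have "p i (\<omega> i) \<le> exp (- s * log_expansion (\<omega> i) + ?e i)" for i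
    proof (cases "forced i")
      case True
      have "log_expansion (\<omega> i) \<le> G * real N"
        using log_expansion_le[OF S_word(1)[OF \<omega>S[OF that]]] S_word(2)[OF \<omega>S[OF that]] by metis
      then have "s * log_expansion (\<omega> i) \<le> s * (G * real N)" using s by (intro mult_left_mono) auto
      then show ?thesis using True unfolding p_def D_def by (simp add: mult.assoc)
    next
      case False
      have "exp (- s * log_expansion (\<omega> i) - \<kappa>) = exp (- s * log_expansion (\<omega> i)) / Z"
        unfolding exp_diff \<kappa>_def using Z1 by simp
      then show ?thesis using False unfolding p_def by simp
    qed
    then have "(\<Prod>i<k. p i (\<omega> i)) \<le> (\<Prod>i<k. exp (- s * log_expansion (\<omega> i) + ?e i))"
      using p_nonneg by (intro prod_mono) auto
    also have "\<dots> = exp (\<Sum>i<k. - s * log_expansion (\<omega> i) + ?e i)" by (simp add: exp_sum)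
    also have "(\<Sum>i<k. - s * log_expansion (\<omega> i) + ?e i)
        = - s * (\<Sum>i<k. log_expansion (\<omega> i)) + (- \<kappa> * real k + D * real (F k))"
    proof -
      have "(\<Sum>i<k. if forced i then D else 0) = (\<Sum>i\<in>{i. i < k \<and> forced i}. D)"
        by (rule sum.mono_neutral_cong_right) auto
      then have "(\<Sum>i<k. if forced i then D else 0) = D * real (F k)" by (simp add: F_def)
      moreover have "(\<Sum>i<k. - \<kappa>) = - \<kappa> * real k" by simp
      ultimately show ?thesis by (simp only: sum.distrib sum_distrib_left)
    qed
    also have "D * real (F k) \<le> \<kappa> * real k / 2"
    proof -
      have "4 * D * real (F k) \<le> \<kappa> * real q * real (F k)" using q(2) by (intro mult_right_mono) auto
      also have "\<dots> \<le> \<kappa> * (2 * real k)" unfolding mult.assoc using \<kappa> F[of k] by (intro mult_left_mono) auto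
      finally show ?thesis by simp
    qed
    also have "- s * (\<Sum>i<k. log_expansion (\<omega> i)) + (- \<kappa> * real k + \<kappa> * real k / 2)
        = - s * (\<Sum>i<k. log_expansion (\<omega> i)) - \<kappa> * real k / 2" by linarith
    finally show ?thesis by simp
  qed

  define u where "u \<omega> i = (\<omega> :: nat \<Rightarrow> nat list) (i div N) ! (i mod N)" for \<omega> i
  define pt where "pt \<omega> = (SOME x. \<forall>k. x \<in> cyl (map (u \<omega>) [0..<k]))" for \<omega>
  have N: "N \<ge> 1" unfolding N_def by simp
  have u_adm: "u \<omega> i \<in> {1..m}" if "\<omega> \<in> PiE UNIV S" for \<omega> i
  proof -
    have "i mod N < length (\<omega> (i div N))" using S_word(2)[OF \<omega>S[OF that, of "i div N"]] N by simp
    then show ?thesis unfolding u_def using S_word(1)[OF \<omega>S[OF that, of "i div N"]] nth_mem by blast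
  qed
  have pt: "pt \<omega> \<in> cyl (map (u \<omega>) [0..<k])" if "\<omega> \<in> PiE UNIV S" for \<omega> k
  proof -
    have "\<exists>x. \<forall>k. x \<in> cyl (map (u \<omega>) [0..<k])" by (rule nested_cylinders) (rule u_adm[OF that])
    from someI_ex[OF this] show ?thesis unfolding pt_def by blast
  qed
  have u_blocks: "map (u \<omega>) [0..<N * k] = concat (map \<omega> [0..<k])" if "\<omega> \<in> PiE UNIV S" for \<omega> k
    unfolding u_def using S_word(2)[OF \<omega>S[OF that]] by (intro map_blocks_eq_concat) auto
  have concat_adm: "admissible (concat (map \<omega> [0..<k]))" if "\<omega> \<in> PiE UNIV S" for \<omega> k
    using S_word(1)[OF \<omega>S[OF that]] by auto
  have pt_block: "pt \<omega> \<in> cyl (concat (map \<omega> [0..<k]))" "fwd (concat (map \<omega> [0..<k])) (pt \<omega>) \<in> cyl (\<omega> k)"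
    if "\<omega> \<in> PiE UNIV S" for \<omega> k
  proof -
    have "pt \<omega> \<in> cyl (concat (map \<omega> [0..<k]) @ \<omega> k)"
      using pt[OF that, of "N * Suc k"] unfolding u_blocks[OF that] by simp
    then show "pt \<omega> \<in> cyl (concat (map \<omega> [0..<k]))" "fwd (concat (map \<omega> [0..<k])) (pt \<omega>) \<in> cyl (\<omega> k)"
      using cyl_append[OF concat_adm[OF that] S_word(1)[OF \<omega>S[OF that]]] by auto
  qed

  have sep: "(\<Prod>i<k. p i (\<omega> i)) \<le> \<delta> powr (- s) * \<bar>pt \<omega>' - pt \<omega>\<bar> powr s"
    if \<omega>: "\<omega> \<in> PiE UNIV S" and \<omega>': "\<omega>' \<in> PiE UNIV S" and agree: "\<forall>i<k. \<omega>' i = \<omega> i" and differ: "\<omega>' k \<noteq> \<omega> k" for \<omega> \<omega>' k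
  proof -
    let ?u = "concat (map \<omega> [0..<k])"
    have same: "concat (map \<omega>' [0..<k]) = ?u" using agree by (intro arg_cong[of _ _ concat] map_cong) auto
    have inS: "\<omega> k \<in> S k" "\<omega>' k \<in> S k" by (rule \<omega>S[OF \<omega>], rule \<omega>S[OF \<omega>'])
    have "\<not> forced k"
    proof
      assume "forced k"
      then have "S k = {a} \<or> S k = {b}" by (rule S_forced)
      then show False using inS differ by (elim disjE) simp_all
    qed
    then have inA: "\<omega> k \<in> A" "\<omega>' k \<in> A" using inS unfolding S_free[OF \<open>\<not> forced k\<close>] by blast+
    let ?E = "\<Sum>i<k. log_expansion (\<omega> i)"
    have "\<delta> \<le> \<bar>fwd ?u (pt \<omega>') - fwd ?u (pt \<omega>)\<bar>"
      using pt_block(2)[OF \<omega>, of k] pt_block(2)[OF \<omega>', of k] differ inA unfolding same by (intro \<delta>(2)) auto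
    also have "\<dots> \<le> exp (log_expansion ?u) * \<bar>pt \<omega>' - pt \<omega>\<bar>"
      using pt_block(1)[OF \<omega>, of k] pt_block(1)[OF \<omega>', of k] unfolding same by (intro expansion_bound concat_adm \<omega>)
    also have "\<dots> \<le> exp ?E * \<bar>pt \<omega>' - pt \<omega>\<bar>"
      using log_expansion_concat[of \<omega> k] S_word(1)[OF \<omega>S[OF \<omega>]] by (intro mult_right_mono) auto
    finally have "\<delta> powr s \<le> (exp ?E * \<bar>pt \<omega>' - pt \<omega>\<bar>) powr s" using \<delta>(1) s by (intro powr_mono2) auto
    also have "\<dots> = exp (s * ?E) * \<bar>pt \<omega>' - pt \<omega>\<bar> powr s" by (simp add: powr_mult exp_powr_real mult.commute)
    finally have "exp (- s * ?E) * \<delta> powr s \<le> exp (- s * ?E) * (exp (s * ?E) * \<bar>pt \<omega>' - pt \<omega>\<bar> powr s)"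
      by (intro mult_left_mono) auto
    also have "\<dots> = \<bar>pt \<omega>' - pt \<omega>\<bar> powr s" by (simp add: mult.assoc[symmetric] exp_add[symmetric])
    finally have "\<delta> powr (- s) * (exp (- s * ?E) * \<delta> powr s) \<le> \<delta> powr (- s) * \<bar>pt \<omega>' - pt \<omega>\<bar> powr s"
      by (intro mult_left_mono) auto
    moreover have "\<delta> powr (- s) * (exp (- s * ?E) * \<delta> powr s) = exp (- s * ?E)"
      using \<delta>(1) by (simp add: powr_minus field_simps)
    moreover have "exp (- s * ?E - \<kappa> * real k / 2) \<le> exp (- s * ?E)" using \<kappa> by simp
    ultimately show ?thesis using mass[OF \<omega>, of k] by linarith
  qed

  have vanish: "(\<lambda>k. \<Prod>i<k. p i (\<omega> i)) \<longlonglongrightarrow> 0" if \<omega>: "\<omega> \<in> PiE UNIV S" for \<omega>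
  proof (rule tendsto_sandwich[OF _ _ tendsto_const])
    show "eventually (\<lambda>k. 0 \<le> (\<Prod>i<k. p i (\<omega> i))) sequentially"
      using p_nonneg by (intro always_eventually allI prod_nonneg) auto
    have "(\<Prod>i<k. p i (\<omega> i)) \<le> exp (- \<kappa> / 2) ^ k" for k
    proof -
      have "0 \<le> s * (\<Sum>i<k. log_expansion (\<omega> i))"
        using s S_word(1)[OF \<omega>S[OF \<omega>]] by (intro mult_nonneg_nonneg sum_nonneg log_expansion_nonneg) auto
      then have "exp (- s * (\<Sum>i<k. log_expansion (\<omega> i)) - \<kappa> * real k / 2) \<le> exp (real k * (- \<kappa> / 2))"
        by (simp add: mult.commute[of "real k" \<kappa>])
      also have "\<dots> = exp (- \<kappa> / 2) ^ k" by (rule exp_of_nat_mult)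
      finally show ?thesis using mass[OF \<omega>, of k] by (rule order_trans[rotated])
    qed
    then show "eventually (\<lambda>k. (\<Prod>i<k. p i (\<omega> i)) \<le> exp (- \<kappa> / 2) ^ k) sequentially" by simp
    show "(\<lambda>k. exp (- \<kappa> / 2) ^ k) \<longlonglongrightarrow> 0" using \<kappa> by (intro LIMSEQ_power_zero) auto
  qed

  have irregular: "pt \<omega> \<in> X" if \<omega>: "\<omega> \<in> PiE UNIV S" for \<omega>
  proof -
    \<comment> \<open>At the mark of each free block the orbit is in the open unit interval, so it never gets stuck
      at \<open>0\<close> or \<open>1\<close>.\<close>
    have inner: "\<exists>k\<ge>k0. fwd (map (u \<omega>) [0..<k]) (pt \<omega>) \<in> {0<..<1}" for k0
    proof -
      have "\<exists>i\<ge>k0. \<not> forced i"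
      proof (rule ccontr)
        assume "\<not> ?thesis"
        then have "{k0..<2 * k0 + 1} \<subseteq> {i. i < 2 * k0 + 1 \<and> forced i}" by auto
        then have "card {k0..<2 * k0 + 1} \<le> F (2 * k0 + 1)" unfolding F_def by (intro card_mono) auto
        then have "real k0 + 1 \<le> real (F (2 * k0 + 1))" by simp
        then have "4 * (real k0 + 1) \<le> real q * real (F (2 * k0 + 1))" using q(1) by (intro mult_mono) auto
        then show False using F[of "2 * k0 + 1"] by simp
      qed
      then obtain i where i: "i \<ge> k0" "\<not> forced i" by blast
      then obtain w where w: "\<omega> i = w @ c" "w \<in> words {1..m} n" using \<omega>S[OF \<omega>, of i] S_free unfolding A_def by auto
      have blocks: "concat (map \<omega> [0..<Suc i]) = (concat (map \<omega> [0..<i]) @ w) @ c" by (simp add: w)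
      have len: "length (concat (map \<omega> [0..<i]) @ w) = N * i + n"
        using arg_cong[OF u_blocks[OF \<omega>, of i], of length] w(2) by (simp add: words_def)
      have "map (u \<omega>) [0..<N * Suc i] = (concat (map \<omega> [0..<i]) @ w) @ c" unfolding u_blocks[OF \<omega>] by (rule blocks)
      then have "take (N * i + n) (map (u \<omega>) [0..<N * Suc i]) = concat (map \<omega> [0..<i]) @ w" using len by simp
      moreover have "take (N * i + n) [0..<N * Suc i] = [0..<N * i + n]"
        by (subst take_upt) (simp_all add: N_def)
      ultimately have pre: "map (u \<omega>) [0..<N * i + n] = concat (map \<omega> [0..<i]) @ w"
        by (simp only: take_map)
      have "pt \<omega> \<in> cyl ((concat (map \<omega> [0..<i]) @ w) @ c)" using pt_block(1)[OF \<omega>, of "Suc i"] unfolding blocks .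
      then have "fwd (concat (map \<omega> [0..<i]) @ w) (pt \<omega>) \<in> cyl c"
        using concat_adm[OF \<omega>, of i] w(2) c(1) by (subst (asm) cyl_append) (auto simp: words_def)
      then have "fwd (map (u \<omega>) [0..<N * i + n]) (pt \<omega>) \<in> {0<..<1}" unfolding pre using c(3) by blast
      moreover have "N * i + n \<ge> k0" using i(1) N by (metis le_add1 le_trans mult_le_mono1 nat_mult_1 One_nat_def)
      ultimately show ?thesis by blast
    qed
    note itinerary = itinerary_realized[OF u_adm[OF \<omega>] pt[OF \<omega>] inner]
    have x: "pt \<omega> \<in> \<Lambda>" by (rule itinerary(1))
    have code_block: "code T \<sigma> N ((T ^^ (N * i)) (pt \<omega>)) = \<omega> i" for i
    proof (rule nth_equalityI)
      fix r assume "r < length (code T \<sigma> N ((T ^^ (N * i)) (pt \<omega>)))"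
      then have r: "r < N" by simp
      have "(T ^^ r) ((T ^^ (N * i)) (pt \<omega>)) = (T ^^ (N * i + r)) (pt \<omega>)" by (simp add: funpow_add add.commute)
      then show "code T \<sigma> N ((T ^^ (N * i)) (pt \<omega>)) ! r = \<omega> i ! r"
        using r itinerary(2)[of "N * i + r"] by (simp add: u_def)
    qed (simp add: S_word(2)[OF \<omega>S[OF \<omega>]])
    have pow_ge: "j0 \<le> q ^ j" if "j0 \<le> j" for j0 j
    proof -
      have "j < 2 ^ j" by (rule less_exp)
      also have "(2::nat) ^ j \<le> q ^ j" using q(1) by (intro power_mono) auto
      finally show ?thesis using that by simp
    qed
    have low_stages: "\<exists>J\<ge>j0. \<forall>i. q * J \<le> i \<and> i < q * J + J \<longrightarrow> \<phi> N ((T ^^ (N * i)) (pt \<omega>)) + C \<le> real N * \<alpha>" for j0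
    proof (intro exI[of _ "q ^ (2 * j0)"] conjI allI impI)
      fix i assume "q * q ^ (2 * j0) \<le> i \<and> i < q * q ^ (2 * j0) + q ^ (2 * j0)"
      then have "S i = {a}" by (intro S_even[of i "2 * j0"]) (auto simp: stage_def)
      then have "\<omega> i = a" using \<omega>S[OF \<omega>, of i] by simp
      then show "\<phi> N ((T ^^ (N * i)) (pt \<omega>)) + C \<le> real N * \<alpha>"
        using code_block[of i] low[OF iterate_in[OF x]] unfolding N_def by blast
    qed (rule pow_ge, simp)
    have high_stages: "\<exists>J\<ge>j0. \<forall>i. q * J \<le> i \<and> i < q * J + J \<longrightarrow> - \<phi> N ((T ^^ (N * i)) (pt \<omega>)) + C \<le> real N * (- \<beta>)" for j0
    proof (intro exI[of _ "q ^ (2 * j0 + 1)"] conjI allI impI)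
      fix i assume "q * q ^ (2 * j0 + 1) \<le> i \<and> i < q * q ^ (2 * j0 + 1) + q ^ (2 * j0 + 1)"
      then have "S i = {b}" by (intro S_odd[of i "2 * j0 + 1"]) (auto simp: stage_def)
      then have "\<omega> i = b" using \<omega>S[OF \<omega>, of i] by simp
      then have "real N * \<beta> \<le> \<phi> N ((T ^^ (N * i)) (pt \<omega>)) - C"
        using code_block[of i] high[OF iterate_in[OF x]] unfolding N_def by blast
      then show "- \<phi> N ((T ^^ (N * i)) (pt \<omega>)) + C \<le> real N * (- \<beta>)" by simp
    qed (rule pow_ge, simp)
    have "\<not> convergent (\<lambda>n. \<phi> n (pt \<omega>) / real n)"
    proof
      assume "convergent (\<lambda>n. \<phi> n (pt \<omega>) / real n)"
      then obtain L where L: "(\<lambda>n. \<phi> n (pt \<omega>) / real n) \<longlonglongrightarrow> L" unfolding convergent_def by blast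
      have q1: "q \<ge> 1" using q(1) by simp
      have "L \<le> \<alpha>" by (rule limit_le_of_low_stages[OF aa x N q1 low_stages L])
      moreover have "- L \<le> - \<beta>"
        using tendsto_minus[OF L]
        by (intro limit_le_of_low_stages[OF almost_additive_with_uminus[OF aa] x N q1 high_stages]) simp
      ultimately show False using \<alpha>\<beta> by simp
    qed
    then show ?thesis using X x by blast
  qed
  show ?thesis
    using irregular \<delta>(1) s t
    by (intro mass_distribution[where S = S and p = p and X = pt and K = "\<delta> powr (- s)" and s = s] finS p_nonneg p_sum vanish sep) auto
qed

text \<open>The partition function has to beat the bounded factor \<open>exp (2 s G)\<close>, which is what the marks of
length \<open>2\<close> may cost. The words \<open>a\<close> and \<open>b\<close> are different, hence there are at least two branches,
and a mark exists.\<close>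

lemma hausdorff_measure_irregular_set:
  fixes \<Phi> :: "nat \<Rightarrow> real \<Rightarrow> real ^ 'd"
  assumes \<Phi>: "almost_additive_vec \<Lambda> T \<Phi>"
    and \<nu>: "\<nu> \<in> invariant_measures \<Lambda> T" and lyap: "lyapunov_exponent (system_deriv I f \<sigma>) \<nu> > 0"
    and h: "ereal (s * lyapunov_exponent (system_deriv I f \<sigma>) \<nu>) < metric_entropy \<nu> T"
    and s: "s > 0" and t: "0 \<le> t" "t \<le> s"
    and \<mu>: "\<mu>1 \<in> invariant_measures \<Lambda> T" "\<mu>2 \<in> invariant_measures \<Lambda> T"
    and less: "limit_average \<Phi> \<mu>1 $ j < limit_average \<Phi> \<mu>2 $ j"
  shows "hausdorff_measure t (irregular_set \<Lambda> \<Phi>) \<noteq> 0"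
proof -
  let ?\<phi> = "\<lambda>n x. \<Phi> n x $ j"
  have aaj: "almost_additive \<Lambda> T ?\<phi>" using \<Phi> unfolding almost_additive_vec_def by blast
  then obtain C where C: "C > 0" and aa: "almost_additive_with \<Lambda> T C ?\<phi>"
    by (rule almost_additive_obtain_constant)
  have cont: "continuous_on \<Lambda> (?\<phi> n)" if "n \<ge> 1" for n using aaj that unfolding almost_additive_def by blast
  define \<gamma> where "\<gamma> = (limit_average \<Phi> \<mu>2 $ j - limit_average \<Phi> \<mu>1 $ j) / 3"
  define \<alpha> \<beta> where "\<alpha> = limit_average \<Phi> \<mu>1 $ j + \<gamma>" and "\<beta> = limit_average \<Phi> \<mu>2 $ j - \<gamma>"
  have \<gamma>: "\<gamma> > 0" and \<alpha>\<beta>: "\<alpha> < \<beta>" using less unfolding \<alpha>_def \<beta>_def \<gamma>_def by (auto simp: field_simps)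
  have ev_low: "eventually (\<lambda>n. \<exists>x\<in>\<Lambda>. \<forall>z\<in>\<Lambda>. code T \<sigma> n z = code T \<sigma> n x \<longrightarrow> ?\<phi> n z + C \<le> real n * \<alpha>) sequentially"
    using \<gamma> by (intro low_words[OF \<mu>(1) cont aa C limit_average_component[OF \<mu>(1) \<Phi>]]) (auto simp: \<alpha>_def)
  have "(\<lambda>n. (\<integral>x. - ?\<phi> n x \<partial>\<mu>2) / real n) \<longlonglongrightarrow> - (limit_average \<Phi> \<mu>2 $ j)"
    using tendsto_minus[OF limit_average_component[OF \<mu>(2) \<Phi>, of j]] by simp
  then have ev_high: "eventually (\<lambda>n. \<exists>x\<in>\<Lambda>. \<forall>z\<in>\<Lambda>. code T \<sigma> n z = code T \<sigma> n x \<longrightarrow> - ?\<phi> n z + C \<le> real n * (- \<beta>)) sequentially"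
    using \<gamma> by (intro low_words[OF \<mu>(2) _ almost_additive_with_uminus[OF aa] C])
      (auto simp: \<beta>_def intro!: continuous_on_minus cont)
  have ev_Z: "eventually (\<lambda>n. partition_function s n > exp (s * (2 * G))) sequentially"
    using s by (intro partition_function_large[OF \<nu> lyap _ h]) auto
  have "eventually (\<lambda>n. partition_function s n > exp (s * (2 * G)) \<and>
      (\<exists>x\<in>\<Lambda>. \<forall>z\<in>\<Lambda>. code T \<sigma> (n + 2) z = code T \<sigma> (n + 2) x \<longrightarrow> ?\<phi> (n + 2) z + C \<le> real (n + 2) * \<alpha>) \<and>
      (\<exists>x\<in>\<Lambda>. \<forall>z\<in>\<Lambda>. code T \<sigma> (n + 2) z = code T \<sigma> (n + 2) x \<longrightarrow> - ?\<phi> (n + 2) z + C \<le> real (n + 2) * (- \<beta>))) sequentially"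
    using ev_Z sequentially_offset[OF ev_low, of 2] sequentially_offset[OF ev_high, of 2]
    by eventually_elim blast
  then obtain n where large: "partition_function s n > exp (s * (2 * G))"
    and ex_low: "\<exists>x\<in>\<Lambda>. \<forall>z\<in>\<Lambda>. code T \<sigma> (n + 2) z = code T \<sigma> (n + 2) x \<longrightarrow> ?\<phi> (n + 2) z + C \<le> real (n + 2) * \<alpha>"
    and ex_high: "\<exists>x\<in>\<Lambda>. \<forall>z\<in>\<Lambda>. code T \<sigma> (n + 2) z = code T \<sigma> (n + 2) x \<longrightarrow> - ?\<phi> (n + 2) z + C \<le> real (n + 2) * (- \<beta>)"
    using eventually_happens'[OF sequentially_bot] by blast
  obtain x y where xy: "x \<in> \<Lambda>" "y \<in> \<Lambda>"
    and low: "\<And>z. \<lbrakk>z \<in> \<Lambda>; code T \<sigma> (n + 2) z = code T \<sigma> (n + 2) x\<rbrakk> \<Longrightarrow> ?\<phi> (n + 2) z + C \<le> real (n + 2) * \<alpha>"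
    and high: "\<And>z. \<lbrakk>z \<in> \<Lambda>; code T \<sigma> (n + 2) z = code T \<sigma> (n + 2) y\<rbrakk> \<Longrightarrow> - ?\<phi> (n + 2) z + C \<le> real (n + 2) * (- \<beta>)"
    using ex_low ex_high by blast
  let ?a = "code T \<sigma> (n + 2) x" and ?b = "code T \<sigma> (n + 2) y"
  have "?a \<noteq> ?b"
  proof
    assume eq: "?a = ?b"
    have "?\<phi> (n + 2) x + C \<le> real (n + 2) * \<alpha>" by (rule low[OF xy(1) refl])
    moreover have "- ?\<phi> (n + 2) x + C \<le> real (n + 2) * (- \<beta>)" by (rule high[OF xy(1) eq])
    moreover have "real (n + 2) * \<alpha> < real (n + 2) * \<beta>" using \<alpha>\<beta> by (intro mult_strict_left_mono) auto
    ultimately show False using C by linarith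
  qed
  then obtain i where i: "i < n + 2" "?a ! i \<noteq> ?b ! i" by (auto simp: list_eq_iff_nth_eq)
  have "?a ! i \<in> {1..m}" "?b ! i \<in> {1..m}"
    using i admissible_code[OF xy(1), of "n + 2"] admissible_code[OF xy(2), of "n + 2"]
    by (metis length_code nth_mem subsetD)+
  then obtain c where c: "admissible c" "length c = 2" "cyl c \<subseteq> {0<..<1}"
    using interior_word_exists i(2) by blast
  have Z: "(\<Sum>w\<in>words {1..m} n. exp (- s * log_expansion (w @ c))) > 1"
  proof -
    have "1 = exp (- s * (2 * G)) * exp (s * (2 * G))" by (simp add: exp_add[symmetric])
    also have "\<dots> < exp (- s * (2 * G)) * partition_function s n" using large by (intro mult_strict_left_mono) auto
    also have "\<dots> = (\<Sum>w\<in>words {1..m} n. exp (- s * (log_expansion w + 2 * G)))"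
      unfolding partition_function_def sum_distrib_left by (simp add: exp_add[symmetric] algebra_simps)
    also have "\<dots> \<le> (\<Sum>w\<in>words {1..m} n. exp (- s * log_expansion (w @ c)))"
    proof (intro sum_mono)
      fix w assume "w \<in> words {1..m} n"
      then have "log_expansion (w @ c) \<le> log_expansion w + log_expansion c"
        using c by (intro log_expansion_append) (auto simp: words_def)
      moreover have "log_expansion c \<le> 2 * G" using log_expansion_le[OF c(1)] c(2) by simp
      ultimately have "s * log_expansion (w @ c) \<le> s * (log_expansion w + 2 * G)" using s by (intro mult_left_mono) auto
      then show "exp (- s * (log_expansion w + 2 * G)) \<le> exp (- s * log_expansion (w @ c))" by simp
    qed
    finally show ?thesis .
  qed
  show ?thesis
  proof (rule irregular_set_has_mass[OF aa s t c Z, of ?a ?b])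
    show "{x \<in> \<Lambda>. \<not> convergent (\<lambda>n. ?\<phi> n x / real n)} \<subseteq> irregular_set \<Lambda> \<Phi>"
    proof
      fix x assume x: "x \<in> {x \<in> \<Lambda>. \<not> convergent (\<lambda>n. ?\<phi> n x / real n)}"
      have "\<not> convergent (\<lambda>n. (1 / real n) *\<^sub>R \<Phi> n x)"
      proof
        assume "convergent (\<lambda>n. (1 / real n) *\<^sub>R \<Phi> n x)"
        then obtain L where "(\<lambda>n. (1 / real n) *\<^sub>R \<Phi> n x) \<longlonglongrightarrow> L" unfolding convergent_def by blast
        then have "(\<lambda>n. ((1 / real n) *\<^sub>R \<Phi> n x) $ j) \<longlonglongrightarrow> L $ j" by (rule tendsto_vec_nth)
        then show False using x by (auto simp: convergent_def)
      qed
      then show "x \<in> irregular_set \<Lambda> \<Phi>" using x unfolding irregular_set_def by blast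
    qed
    show "real (n + 2) * \<beta> \<le> ?\<phi> (n + 2) z - C" if "z \<in> \<Lambda>" "code T \<sigma> (n + 2) z = ?b" for z
      using high[OF that] by simp
  qed (rule admissible_code[OF xy(1)] admissible_code[OF xy(2)] length_code \<alpha>\<beta> | (rule low, assumption+))+
qed

end

theorem theorem4:
  fixes m :: nat
    and I :: "nat \<Rightarrow> real set"
    and f :: "nat \<Rightarrow> real \<Rightarrow> real"
    and \<sigma> :: "real \<Rightarrow> nat"
    and \<Phi> :: "nat \<Rightarrow> real \<Rightarrow> real ^ 'd"
    and \<Lambda> :: "real set"
    and T T' :: "real \<Rightarrow> real"
  defines "\<Lambda> \<equiv> attractor m I f"
    and "T \<equiv> system_map f \<sigma>"
    and "T' \<equiv> system_deriv I f \<sigma>"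
  assumes "interval_system m I f"
    and "branch_choice m I f \<sigma>"
    and "almost_additive_vec \<Lambda> T \<Phi>"
    and "\<forall>\<epsilon>>0. \<exists>\<nu>\<in>invariant_measures \<Lambda> T.
           lyapunov_exponent T' \<nu> > 0 \<and>
           metric_entropy \<nu> T / ereal (lyapunov_exponent T' \<nu>) > hausdorff_dim \<Lambda> - ereal \<epsilon>"
    and "\<exists>u\<in>limit_average \<Phi> ` invariant_measures \<Lambda> T.
           \<exists>v\<in>limit_average \<Phi> ` invariant_measures \<Lambda> T. u \<noteq> v"
  shows "hausdorff_dim (irregular_set \<Lambda> \<Phi>) = hausdorff_dim \<Lambda>"
proof (rule antisym)
  interpret expanding_system m I f \<sigma> using assms(4,5) by unfold_locales
  show "hausdorff_dim (irregular_set \<Lambda> \<Phi>) \<le> hausdorff_dim \<Lambda>"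
    by (rule hausdorff_dim_mono) (auto simp: irregular_set_def)
  obtain \<mu>1 \<mu>2 where \<mu>: "\<mu>1 \<in> invariant_measures \<Lambda> T" "\<mu>2 \<in> invariant_measures \<Lambda> T"
    "limit_average \<Phi> \<mu>1 \<noteq> limit_average \<Phi> \<mu>2"
    using assms(8) by blast
  then obtain j where "limit_average \<Phi> \<mu>1 $ j \<noteq> limit_average \<Phi> \<mu>2 $ j" by (auto simp: vec_eq_iff)
  then obtain \<mu>1 \<mu>2 where \<mu>: "\<mu>1 \<in> invariant_measures \<Lambda> T" "\<mu>2 \<in> invariant_measures \<Lambda> T"
    "limit_average \<Phi> \<mu>1 $ j < limit_average \<Phi> \<mu>2 $ j"
    using \<mu> by (meson linorder_neqE_linordered_idom)
  have "hausdorff_dim \<Lambda> \<le> ereal t"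
    if t: "0 \<le> t" "hausdorff_measure t (irregular_set \<Lambda> \<Phi>) = 0" for t
  proof (rule ccontr)
    assume "\<not> hausdorff_dim \<Lambda> \<le> ereal t"
    then obtain s where r: "t < s" "ereal s < hausdorff_dim \<Lambda>" by (metis ereal_dense2 ereal_less_ereal_Ex less_ereal.simps(1) not_le)
    have s: "s > 0" "t \<le> s" using r t by auto
    have "\<exists>\<epsilon>>0. ereal s \<le> hausdorff_dim \<Lambda> - ereal \<epsilon>"
    proof (cases "hausdorff_dim \<Lambda>")
      case (real D)
      then show ?thesis using r by (intro exI[of _ "D - s"]) auto
    qed (use r in \<open>auto intro: exI[of _ 1]\<close>)
    then obtain \<epsilon> where \<epsilon>: "\<epsilon> > 0" "ereal s \<le> hausdorff_dim \<Lambda> - ereal \<epsilon>" by blast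
    obtain \<nu> where \<nu>: "\<nu> \<in> invariant_measures \<Lambda> T" "lyapunov_exponent T' \<nu> > 0"
      "metric_entropy \<nu> T / ereal (lyapunov_exponent T' \<nu>) > hausdorff_dim \<Lambda> - ereal \<epsilon>"
      using assms(7) \<epsilon>(1) by blast
    have "ereal s < metric_entropy \<nu> T / ereal (lyapunov_exponent T' \<nu>)"
      using \<epsilon>(2) \<nu>(3) by (rule le_less_trans)
    then have "ereal (s * lyapunov_exponent T' \<nu>) < metric_entropy \<nu> T"
      using \<nu>(2) by (subst (asm) ereal_less_divide_pos) (auto simp: mult.commute)
    then have "hausdorff_measure t (irregular_set \<Lambda> \<Phi>) \<noteq> 0"
      using assms(6) \<nu> \<mu> s t unfolding \<Lambda>_def T_def T'_def
      by (intro hausdorff_measure_irregular_set)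
    then show False using t(2) by simp
  qed
  then show "hausdorff_dim \<Lambda> \<le> hausdorff_dim (irregular_set \<Lambda> \<Phi>)"
    unfolding hausdorff_dim_def[of "irregular_set \<Lambda> \<Phi>"] by (intro INF_greatest) auto
qed

end
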